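(* Let $n \geq 1$ and $m > 0$. There exist a constant $C > 0$ depending on $m$ and a constant $\alpha > 0$ independent of $m$ such that, for all initial data $[u_{0},u_{1}] \in (H^{1}(\mathbf{R}^{n}) \cap L^{1}(\mathbf{R}^{n})) \times (L^{2}(\mathbf{R}^{n}) \cap L^{1}(\mathbf{R}^{n}))$, the weak solution $u \in C([0,\infty);H^{1}(\mathbf{R}^{n})) \cap C^{1}([0,\infty);L^{2}(\mathbf{R}^{n}))$ of the Cauchy problem $$u_{tt} - \Delta u + m^{2}u - \Delta u_{t} = 0 \ \text{ in } (0,\infty)\times\mathbf{R}^{n}, \qquad u(0,x)=u_{0}(x),\quad u_{t}(0,x)=u_{1}(x),$$ satisfies, for every $t \geq 0$, $$\Vert u_{t}(t,\cdot)\Vert + \Vert u(t,\cdot)\Vert + \Vert\nabla u(t,\cdot)\Vert \leq C(1+t)^{-\frac{n}{4}}\left(\Vert u_{1}\Vert_{1} + \Vert u_{0}\Vert_{1}\right) + Ce^{-\alpha t}\left(\Vert u_{1}\Vert + \Vert u_{0}\Vert_{H^{1}}\right).$$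
   Context: $\Vert\cdot\Vert_{q}$ denotes the $L^{q}(\mathbf{R}^{n})$-norm, and $\Vert\cdot\Vert$ denotes the $L^{2}(\mathbf{R}^{n})$-norm. For $[u_{0},u_{1}] \in H^{1}(\mathbf{R}^{n}) \times L^{2}(\mathbf{R}^{n})$ it is known that the Cauchy problem has a unique weak solution $u \in C([0,\infty);H^{1}(\mathbf{R}^{n})) \cap C^{1}([0,\infty);L^{2}(\mathbf{R}^{n}))$. Its Fourier transform in $x$, $\hat{u}(t,\xi)$, solves for (almost) every $\xi$ the ordinary differential equation $\hat{u}_{tt}+|\xi|^{2}\hat{u}_{t}+(|\xi|^{2}+m^{2})\hat{u}=0$ with $\hat{u}(0,\xi)=\hat{u}_{0}(\xi)$, $\hat{u}_{t}(0,\xi)=\hat{u}_{1}(\xi)$. *)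

theory Defs
  imports "HOL-Analysis.Analysis"
begin

subsection \<open>Smooth functions and test functions\<close>

definition dir_deriv :: "'a::euclidean_space \<Rightarrow> ('a \<Rightarrow> real) \<Rightarrow> 'a \<Rightarrow> real"
  where "dir_deriv v f x = frechet_derivative f (at x) v"

primrec iter_dir_deriv :: "'a::euclidean_space list \<Rightarrow> ('a \<Rightarrow> real) \<Rightarrow> 'a \<Rightarrow> real"
  where
    "iter_dir_deriv [] f = f"
  | "iter_dir_deriv (v # vs) f = dir_deriv v (iter_dir_deriv vs f)"

text \<open>This is \<open>C\<^sup>\<infinity>\<close>: differentiability of all iterated derivatives includes their continuity.\<close>

definition smooth :: "('a::euclidean_space \<Rightarrow> real) \<Rightarrow> bool"
  where "smooth f \<longleftrightarrow> (\<forall>vs. iter_dir_deriv vs f differentiable_on UNIV)"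

definition test_function :: "'a::euclidean_space set \<Rightarrow> ('a \<Rightarrow> real) \<Rightarrow> bool"
  where "test_function S \<phi> \<longleftrightarrow>
    smooth \<phi> \<and> (\<exists>K. compact K \<and> K \<subseteq> S \<and> (\<forall>x. x \<notin> K \<longrightarrow> \<phi> x = 0))"

subsection \<open>Lebesgue and Sobolev spaces\<close>

text \<open>Elements of the spaces are represented by functions, not by equivalence classes.\<close>

definition Lp :: "real \<Rightarrow> ('a::euclidean_space \<Rightarrow> 'b::euclidean_space) \<Rightarrow> bool"
  where "Lp q f \<longleftrightarrow>
    f \<in> borel_measurable lebesgue \<and> integrable lebesgue (\<lambda>x. norm (f x) powr q)"

definition Lp_norm :: "real \<Rightarrow> ('a::euclidean_space \<Rightarrow> 'b::euclidean_space) \<Rightarrow> real"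
  where "Lp_norm q f = (LINT x|lebesgue. norm (f x) powr q) powr (1 / q)"

text \<open>Real-valued test functions suffice for complex-valued \<open>f\<close>, by linearity.\<close>

definition weak_gradient :: "(real^'n::finite \<Rightarrow> complex) \<Rightarrow> (real^'n \<Rightarrow> complex^'n) \<Rightarrow> bool"
  where "weak_gradient f g \<longleftrightarrow>
    (\<forall>\<phi> j. test_function UNIV \<phi> \<longrightarrow>
      (LINT x|lebesgue. dir_deriv (axis j 1) \<phi> x *\<^sub>R f x) =
      - (LINT x|lebesgue. \<phi> x *\<^sub>R (g x $ j)))"

definition H1 :: "(real^'n::finite \<Rightarrow> complex) \<Rightarrow> bool"
  where "H1 f \<longleftrightarrow> Lp 2 f \<and> (\<exists>g. Lp 2 g \<and> weak_gradient f g)"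

text \<open>The weak gradient is unique only up to null sets; a representative is chosen.
  It is meaningful for \<open>f\<close> in \<open>H\<^sup>1\<close>.\<close>

definition grad :: "(real^'n::finite \<Rightarrow> complex) \<Rightarrow> real^'n \<Rightarrow> complex^'n"
  where "grad f = (SOME g. Lp 2 g \<and> weak_gradient f g)"

definition H1_norm :: "(real^'n::finite \<Rightarrow> complex) \<Rightarrow> real"
  where "H1_norm f = sqrt ((Lp_norm 2 f)\<^sup>2 + (Lp_norm 2 (grad f))\<^sup>2)"

subsection \<open>Time-dependent functions\<close>

text \<open>Only the values at times \<open>t \<ge> 0\<close> matter; at \<open>t = 0\<close> limits are one-sided.\<close>

definition continuous_H1 :: "(real \<Rightarrow> real^'n::finite \<Rightarrow> complex) \<Rightarrow> bool"
  where "continuous_H1 u \<longleftrightarrow>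
    (\<forall>t\<ge>0. H1 (u t) \<and>
      ((\<lambda>s. H1_norm (\<lambda>x. u s x - u t x)) \<longlongrightarrow> 0) (at t within {0..}))"

definition continuous_L2 :: "(real \<Rightarrow> real^'n::finite \<Rightarrow> complex) \<Rightarrow> bool"
  where "continuous_L2 u \<longleftrightarrow>
    (\<forall>t\<ge>0. Lp 2 (u t) \<and>
      ((\<lambda>s. Lp_norm 2 (\<lambda>x. u s x - u t x)) \<longlongrightarrow> 0) (at t within {0..}))"

text \<open>\<open>u\<close> belongs to \<open>C\<^sup>1([0,\<infinity>);L\<^sup>2)\<close> and \<open>ut\<close> is its derivative in time.\<close>

definition C1_L2 ::
  "(real \<Rightarrow> real^'n::finite \<Rightarrow> complex) \<Rightarrow> (real \<Rightarrow> real^'n \<Rightarrow> complex) \<Rightarrow> bool"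
  where "C1_L2 u ut \<longleftrightarrow>
    continuous_L2 u \<and> continuous_L2 ut \<and>
    (\<forall>t\<ge>0. ((\<lambda>s. Lp_norm 2 (\<lambda>x. (u s x - u t x) /\<^sub>R (s - t) - ut t x)) \<longlongrightarrow> 0)
      (at t within {0..}))"

subsection \<open>Weak solutions\<close>

abbreviation e_t :: "real \<times> (real^'n::finite)"
  where "e_t \<equiv> (1, 0)"

abbreviation e_x :: "'n \<Rightarrow> real \<times> (real^'n::finite)"
  where "e_x j \<equiv> (0, axis j 1)"

text \<open>The formal transpose
  \<open>\<phi> \<mapsto> \<phi>\<^sub>t\<^sub>t - \<Delta>\<phi> + m\<^sup>2\<phi> + \<Delta>\<phi>\<^sub>t\<close> of the operator
  \<open>u \<mapsto> u\<^sub>t\<^sub>t - \<Delta>u + m\<^sup>2u - \<Delta>u\<^sub>t\<close>.\<close>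

definition adjoint_op :: "real \<Rightarrow> (real \<times> (real^'n::finite) \<Rightarrow> real) \<Rightarrow> real \<times> (real^'n) \<Rightarrow> real"
  where "adjoint_op m \<phi> z =
    iter_dir_deriv [e_t, e_t] \<phi> z
    - (\<Sum>j\<in>UNIV. iter_dir_deriv [e_x j, e_x j] \<phi> z)
    + m\<^sup>2 * \<phi> z
    + (\<Sum>j\<in>UNIV. iter_dir_deriv [e_x j, e_x j, e_t] \<phi> z)"

text \<open>\<open>u\<close>, with derivative \<open>ut\<close> in time, solves the equation in the sense of distributions
  on \<open>(0,\<infinity>) \<times> \<real>\<^sup>n\<close> and attains the initial data. The integral is an iterated one
  since the representatives \<open>u t\<close> need not be jointly measurable in \<open>(t, x)\<close>;
  the inner integral is continuous in \<open>t\<close>.\<close>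

definition weak_solution ::
  "real \<Rightarrow> (real^'n::finite \<Rightarrow> complex) \<Rightarrow> (real^'n \<Rightarrow> complex) \<Rightarrow>
   (real \<Rightarrow> real^'n \<Rightarrow> complex) \<Rightarrow> (real \<Rightarrow> real^'n \<Rightarrow> complex) \<Rightarrow> bool"
  where "weak_solution m u0 u1 u ut \<longleftrightarrow>
    continuous_H1 u \<and> C1_L2 u ut \<and>
    (AE x in lebesgue. u 0 x = u0 x) \<and> (AE x in lebesgue. ut 0 x = u1 x) \<and>
    (\<forall>\<phi>. test_function ({0<..} \<times> UNIV) \<phi> \<longrightarrow>
      (LINT t:{0<..}|lebesgue. (LINT x|lebesgue. adjoint_op m \<phi> (t, x) *\<^sub>R u t x)) = 0)"

end

theory Submission
  imports Defs "HOL-Probability.Characteristic_Functions"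
begin

text \<open>
  In Fourier variables the equation is the oscillator \<open>y'' + ay' + by = 0\<close> with \<open>a = \<bar>\<xi>\<bar>\<^sup>2\<close> and
  \<open>b = \<bar>\<xi>\<bar>\<^sup>2 + m\<^sup>2\<close>, whose energy decays like \<open>exp (- min 1 \<bar>\<xi>\<bar>\<^sup>2 t / 2)\<close>. For \<open>\<bar>\<xi>\<bar> \<le> 1\<close> this is
  a heat kernel, which turns \<open>L\<^sup>1\<close> bounds of the data into the rate \<open>(1 + t)\<^sup>-\<^sup>n\<^sup>/\<^sup>4\<close>; for
  \<open>\<bar>\<xi>\<bar> > 1\<close> the decay is exponential at a rate independent of \<open>m\<close>.

  No Fourier transform of the solution is needed. The solution is paired with inverse Fourier
  integrals of bounded, compactly supported functions \<open>h\<close>. For such integrals the half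
  \<open>\<parallel>F h\<parallel> \<le> (2\<pi>)\<^sup>n\<^sup>/\<^sup>2 \<parallel>h\<parallel>\<close> of Plancherel's theorem is elementary, and they are dense in \<open>L\<^sup>2\<close>.
  Pairing a solution with them while \<open>h\<close> evolves by the time-reversed scalar equation gives a
  conserved quantity, which expresses \<open>u t\<close> and \<open>ut t\<close> by the initial data.
\<close>

section \<open>The damped oscillator\<close>

text \<open>The obstacle is the weak notion of solution: \<open>u t\<close> and \<open>ut t\<close>
  are representatives without joint measurability, and the equation is known only against compactly
  supported real test functions of space-time. Band-limited \<open>h\<close> fit this well. On
  bounded frequencies every multiplier in use is bounded, so the class is stable under derivatives
  and under the scalar evolution. \<open>synth\<close> takes a real part because test functions are
  real. As \<open>synth h\<close> is smooth but not compactly supported, it is multiplied by growing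
  cutoffs whose derivatives tend to zero. A bound of the pairing with \<open>synth h\<close> by a
  multiple of \<open>Lp_norm 2 h\<close>, for all band-limited \<open>h\<close>, then yields an L^2
  bound by duality; gradients are reached through their components, where integration by parts turns
  the pairing into one with \<open>u t\<close>. The rate 1/4 is half the energy rate at |\<xi>|
  \<ge> 1, since norms are square roots of energies. The energy rate does not involve m; m enters
  only the constants of the multiplier bounds.\<close>

definition osc_s :: "real \<Rightarrow> real \<Rightarrow> real" where
  "osc_s D t = (if D > 0 then sinh (sqrt D * t) / sqrt D
    else if D < 0 then sin (sqrt (- D) * t) / sqrt (- D) else t)"

definition osc_c :: "real \<Rightarrow> real \<Rightarrow> real" where
  "osc_c D t = (if D > 0 then cosh (sqrt D * t) else if D < 0 then cos (sqrt (- D) * t) else 1)"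

lemma osc_s_deriv: "(osc_s D has_real_derivative osc_c D t) (at t)"
proof -
  consider "D > 0" | "D < 0" | "D = 0" by linarith
  then show ?thesis
  proof cases
    case 1
    then have "osc_s D = (\<lambda>t. sinh (sqrt D * t) / sqrt D)" by (auto simp: osc_s_def)
    then show ?thesis using 1
      by (auto simp: osc_c_def mult.assoc intro!: derivative_eq_intros)
  next
    case 2
    then have "osc_s D = (\<lambda>t. sin (sqrt (- D) * t) / sqrt (- D))" by (auto simp: osc_s_def)
    then show ?thesis using 2
      by (auto simp: osc_c_def mult.assoc intro!: derivative_eq_intros)
  next
    case 3
    then have "osc_s D = (\<lambda>t. t)" by (auto simp: osc_s_def)
    then show ?thesis using 3 by (auto simp: osc_c_def)
  qed
qed

lemma osc_c_deriv: "(osc_c D has_real_derivative D * osc_s D t) (at t)"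
proof -
  consider "D > 0" | "D < 0" | "D = 0" by linarith
  then show ?thesis
  proof cases
    case 1
    then have "osc_c D = (\<lambda>t. cosh (sqrt D * t))" by (auto simp: osc_c_def)
    then show ?thesis using 1
      by (auto simp: osc_s_def field_simps intro!: derivative_eq_intros)
  next
    case 2
    then have "osc_c D = (\<lambda>t. cos (sqrt (- D) * t))" by (auto simp: osc_c_def)
    moreover have "sqrt (- D) * sqrt (- D) = - D" using 2 by simp
    then have "- (x * sqrt (- D)) = D * x / sqrt (- D)" for x
      using 2 by (simp add: field_simps del: real_sqrt_mult_self)
    ultimately show ?thesis using 2
      by (auto simp: osc_s_def intro!: derivative_eq_intros)
  next
    case 3
    then have "osc_c D = (\<lambda>t. 1)" by (auto simp: osc_c_def)
    then show ?thesis using 3 by simp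
  qed
qed

text \<open>The solution of y'' + ay' + by = 0 with data 0, 1; \<open>kern_d\<close> is its
  derivative. Factoring out exp (- a t / 2) leaves z'' = D z with the discriminant D = a^2 / 4 - b,
  and \<open>osc_s\<close>, \<open>osc_c\<close> are the solutions of the latter with data 0, 1 and
  1, 0.\<close>

definition kern :: "real \<Rightarrow> real \<Rightarrow> real \<Rightarrow> real" where
  "kern a b t = exp (- a * t / 2) * osc_s (a\<^sup>2 / 4 - b) t"

definition kern_d :: "real \<Rightarrow> real \<Rightarrow> real \<Rightarrow> real" where
  "kern_d a b t = exp (- a * t / 2) * (osc_c (a\<^sup>2 / 4 - b) t - a / 2 * osc_s (a\<^sup>2 / 4 - b) t)"

lemma kern_0 [simp]: "kern a b 0 = 0"
  by (simp add: kern_def osc_s_def)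

lemma kern_d_0 [simp]: "kern_d a b 0 = 1"
  by (simp add: kern_d_def osc_s_def osc_c_def)

lemma kern_deriv: "(kern a b has_real_derivative kern_d a b t) (at t)"
  unfolding kern_def [abs_def] kern_d_def
  by (auto intro!: derivative_eq_intros osc_s_deriv osc_c_deriv simp: algebra_simps)

lemma kern_d_deriv: "(kern_d a b has_real_derivative - a * kern_d a b t - b * kern a b t) (at t)"
  unfolding kern_def kern_d_def [abs_def]
  by (auto intro!: derivative_eq_intros osc_s_deriv osc_c_deriv simp: field_simps power2_eq_square)

text \<open>Time is fixed and the coefficients vary, since they will be functions of the frequency.
  Multipliers only have to be Borel and locally bounded, so the case distinction on the sign of D
  does no harm and continuity across D = 0 is not examined.\<close>

lemma kern_measurable [measurable]:
  assumes [measurable]: "f \<in> borel_measurable M" "g \<in> borel_measurable M"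
  shows "(\<lambda>x. kern (f x) (g x) t) \<in> borel_measurable M"
    and "(\<lambda>x. kern_d (f x) (g x) t) \<in> borel_measurable M"
  unfolding kern_def kern_d_def osc_s_def osc_c_def sinh_def cosh_def by measurable

text \<open>Multiplying the equation by \<open>y' + \<beta>y\<close> gives a Lyapunov function that is comparable with the
  energy \<open>y'\<^sup>2 + by\<^sup>2\<close>.\<close>

lemma damped_oscillator_energy:
  fixes y y1 :: "real \<Rightarrow> real"
  assumes y: "\<And>t. (y has_real_derivative y1 t) (at t)"
    and y1: "\<And>t. (y1 has_real_derivative - a * y1 t - b * y t) (at t)"
    and \<beta>: "0 \<le> \<beta>" "\<beta> \<le> 1/2" "2 * \<beta> \<le> a" "4 * \<beta>\<^sup>2 \<le> b" "a \<le> b" and t: "0 \<le> t"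
  shows "(y1 t)\<^sup>2 + b * (y t)\<^sup>2 \<le> 4 * exp (- \<beta> * t) * ((y1 0)\<^sup>2 + b * (y 0)\<^sup>2)"
proof -
  define E where "E = (\<lambda>t. (y1 t)\<^sup>2 + b * (y t)\<^sup>2)"
  \<comment> \<open>The term with \<beta> a / 2 cancels the mixed term that \<beta> y' y produces
    through the damping, so that F' is -(a - \<beta>) y'^2 - \<beta> b y^2.\<close>
  define F where "F = (\<lambda>t. E t / 2 + \<beta> * (y1 t * y t) + \<beta> * a / 2 * (y t)\<^sup>2)"
  have cross: "\<bar>\<beta> * (y1 t * y t)\<bar> \<le> E t / 4" for t
  proof -
    have "0 \<le> (y1 t - 2 * \<beta> * y t)\<^sup>2" "0 \<le> (y1 t + 2 * \<beta> * y t)\<^sup>2" by simp_all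
    moreover have "4 * \<beta>\<^sup>2 * (y t)\<^sup>2 \<le> b * (y t)\<^sup>2" using \<beta> by (intro mult_right_mono) auto
    ultimately show ?thesis
      unfolding E_def by (simp add: power2_diff power2_sum power_mult_distrib algebra_simps abs_le_iff)
  qed
  have ba: "\<beta> * a / 2 * (y t)\<^sup>2 \<le> E t / 4" for t
  proof -
    have "\<beta> * a \<le> 1/2 * b" using \<beta> by (intro mult_mono) auto
    then have "\<beta> * a / 2 * (y t)\<^sup>2 \<le> b / 4 * (y t)\<^sup>2" by (intro mult_right_mono) auto
    then show ?thesis unfolding E_def by (simp add: add_increasing)
  qed
  have nn: "0 \<le> \<beta> * a / 2 * (y t)\<^sup>2" for t using \<beta> by auto
  \<comment> \<open>These two bounds are the origin of the factor 4 in the conclusion.\<close>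
  have F_lower: "E t / 4 \<le> F t" and F_upper: "F t \<le> E t" for t
    using cross [of t] ba [of t] nn [of t] unfolding F_def abs_le_iff by linarith+
  define G where "G = (\<lambda>t. exp (\<beta> * t) * F t)"
  have "G t \<le> G 0"
  proof (rule DERIV_nonpos_imp_nonincreasing [OF t])
    fix s :: real
    let ?F' = "- (a - \<beta>) * (y1 s)\<^sup>2 - \<beta> * b * (y s)\<^sup>2"
    have "(F has_real_derivative ?F') (at s)"
      unfolding F_def E_def
      by (auto intro!: derivative_eq_intros y y1 simp: algebra_simps power2_eq_square)
    then have G': "(G has_real_derivative exp (\<beta> * s) * (\<beta> * F s + ?F')) (at s)"
      unfolding G_def by (auto intro!: derivative_eq_intros simp: algebra_simps)
    \<comment> \<open>Here 2 \<beta> \<le> a enters: the dissipation is at least \<beta> E, which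
      dominates \<beta> F.\<close>
    have "\<beta> * (y1 s)\<^sup>2 \<le> (a - \<beta>) * (y1 s)\<^sup>2" using \<beta> by (intro mult_right_mono) auto
    moreover have "\<beta> * F s \<le> \<beta> * E s" using F_upper \<beta> by (intro mult_left_mono) auto
    ultimately have "\<beta> * F s + ?F' \<le> 0" unfolding E_def by (simp add: algebra_simps)
    then show "\<exists>z. (G has_real_derivative z) (at s) \<and> z \<le> 0"
      using G' by (auto intro!: exI mult_nonneg_nonpos)
  qed
  then have "exp (\<beta> * t) * F t \<le> F 0" by (simp add: G_def)
  then have "F t \<le> exp (- \<beta> * t) * F 0"
    by (simp add: exp_minus field_simps)
  also have "\<dots> \<le> exp (- \<beta> * t) * E 0" using F_upper by simp
  finally show ?thesis using F_lower [of t] unfolding E_def by simp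
qed

section \<open>Smooth functions and cutoffs\<close>

lemma dir_deriv_eqI: "(f has_derivative f') (at x) \<Longrightarrow> dir_deriv v f x = f' v"
  unfolding dir_deriv_def by (metis frechet_derivative_at)

lemma smooth_differentiable: "smooth f \<Longrightarrow> f differentiable (at x)"
  unfolding smooth_def differentiable_on_def by (metis UNIV_I iter_dir_deriv.simps(1))

lemma smooth_has_derivative:
  assumes "smooth f" shows "(f has_derivative (\<lambda>v. dir_deriv v f x)) (at x)"
  using smooth_differentiable [OF assms, of x]
  by (simp add: dir_deriv_def frechet_derivative_works)

lemma smooth_continuous: "smooth f \<Longrightarrow> continuous_on UNIV f"
  by (simp add: continuous_at_imp_continuous_on differentiable_imp_continuous_within smooth_differentiable)

lemma smooth_measurable: "smooth f \<Longrightarrow> f \<in> borel_measurable borel"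
  by (simp add: borel_measurable_continuous_onI smooth_continuous)

lemma iter_dir_deriv_append:
  "iter_dir_deriv (vs @ ws) f = iter_dir_deriv vs (iter_dir_deriv ws f)"
  by (induction vs) auto

lemma smooth_iter_dir_deriv: "smooth f \<Longrightarrow> smooth (iter_dir_deriv ws f)"
  unfolding smooth_def by (metis iter_dir_deriv_append)

lemma smooth_dir_deriv: "smooth f \<Longrightarrow> smooth (dir_deriv v f)"
  using smooth_iter_dir_deriv [of f "[v]"] by simp

text \<open>Smoothness as a greatest fixed point. It replaces formulas for iterated derivatives: for
  each construction it is enough to find a class \<open>S\<close> of differentiable functions that
  is invariant under directional derivatives.\<close>

lemma smooth_coinduct:
  assumes "S f" and diff: "\<And>g x. S g \<Longrightarrow> g differentiable (at x)"
    and step: "\<And>g v. S g \<Longrightarrow> S (dir_deriv v g)"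
  shows "smooth f"
proof -
  have "S (iter_dir_deriv vs f)" for vs
    by (induction vs) (auto intro: assms)
  then show ?thesis
    unfolding smooth_def differentiable_on_def using diff by (auto intro: differentiable_at_withinI)
qed

lemma dir_deriv_compose_linear:
  assumes L: "bounded_linear L" and f: "smooth f"
  shows "dir_deriv v (\<lambda>x. f (L x)) = (\<lambda>x. dir_deriv (L v) f (L x))"
  and "(\<lambda>x. f (L x)) differentiable (at x)"
proof -
  have "((\<lambda>x. f (L x)) has_derivative (\<lambda>v. dir_deriv (L v) f (L x))) (at x)" for x
    using has_derivative_compose [OF bounded_linear_imp_has_derivative [OF L]
        smooth_has_derivative [OF f]] .
  then show "dir_deriv v (\<lambda>x. f (L x)) = (\<lambda>x. dir_deriv (L v) f (L x))"
    "(\<lambda>x. f (L x)) differentiable (at x)"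
    by (auto simp: differentiable_def intro!: ext dir_deriv_eqI)
qed

lemma smooth_compose_linear:
  assumes L: "bounded_linear L" and f: "smooth f"
  shows "smooth (\<lambda>x. f (L x))"
proof (rule smooth_coinduct [where S = "\<lambda>g. \<exists>f. smooth f \<and> g = (\<lambda>x. f (L x))"])
  show "\<exists>f'. smooth f' \<and> (\<lambda>x. f (L x)) = (\<lambda>x. f' (L x))" using f by auto
qed (auto simp: dir_deriv_compose_linear [OF L] intro: smooth_dir_deriv)

lemma dir_deriv_add:
  assumes "\<And>x. f differentiable (at x)" "\<And>x. g differentiable (at x)"
  shows "dir_deriv v (\<lambda>x. f x + g x) = (\<lambda>x. dir_deriv v f x + dir_deriv v g x)"
  using assms unfolding dir_deriv_def frechet_derivative_works
  by (intro ext) (metis (no_types) frechet_derivative_at has_derivative_add)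

lemma dir_deriv_mult:
  assumes "\<And>x. f differentiable (at x)" "\<And>x. g differentiable (at x)"
  shows "dir_deriv v (\<lambda>x. f x * g x) = (\<lambda>x. f x * dir_deriv v g x + dir_deriv v f x * g x)"
proof
  fix x
  have "((\<lambda>x. f x * g x) has_derivative
     (\<lambda>v. f x * dir_deriv v g x + dir_deriv v f x * g x)) (at x)"
    using assms [of x] unfolding dir_deriv_def frechet_derivative_works
    by (rule has_derivative_mult)
  then show "dir_deriv v (\<lambda>x. f x * g x) x = f x * dir_deriv v g x + dir_deriv v f x * g x"
    by (rule dir_deriv_eqI)
qed

lemma smooth_add:
  assumes "smooth f" "smooth g" shows "smooth (\<lambda>x. f x + g x)"
  by (rule smooth_coinduct [where S = "\<lambda>h. \<exists>f g. smooth f \<and> smooth g \<and> h = (\<lambda>x. f x + g x)"])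
    (use assms in \<open>auto simp: dir_deriv_add smooth_differentiable, blast intro: smooth_dir_deriv\<close>)

text \<open>By Leibniz's rule products alone are not invariant under differentiation, but finite
  sums of products are; this is the class for the coinduction.\<close>

inductive sum_of_products :: "('a::euclidean_space \<Rightarrow> real) \<Rightarrow> bool" where
  "smooth f \<Longrightarrow> smooth g \<Longrightarrow> sum_of_products (\<lambda>x. f x * g x)"
| "sum_of_products f \<Longrightarrow> sum_of_products g \<Longrightarrow> sum_of_products (\<lambda>x. f x + g x)"

lemma sum_of_products_differentiable: "sum_of_products h \<Longrightarrow> h differentiable (at x)"
  by (induction rule: sum_of_products.induct) (auto simp: smooth_differentiable)

lemma sum_of_products_dir_deriv: "sum_of_products h \<Longrightarrow> sum_of_products (dir_deriv v h)"
proof (induction rule: sum_of_products.induct)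
  case (1 f g)
  then show ?case
    by (auto simp: dir_deriv_mult smooth_differentiable intro!: sum_of_products.intros smooth_dir_deriv)
next
  case (2 f g)
  then show ?case
    by (auto simp: dir_deriv_add sum_of_products_differentiable intro!: sum_of_products.intros)
qed

lemma smooth_mult:
  assumes "smooth f" "smooth g" shows "smooth (\<lambda>x. f x * g x)"
  by (rule smooth_coinduct [where S = sum_of_products])
    (use assms in \<open>auto intro: sum_of_products.intros sum_of_products_differentiable
      sum_of_products_dir_deriv\<close>)

lemma dir_deriv_const [simp]: "dir_deriv v (\<lambda>x. c) = (\<lambda>x. 0)"
  by (rule ext, subst dir_deriv_eqI [OF has_derivative_const]) simp

lemma smooth_const [simp]: "smooth (\<lambda>x. c)"
  by (rule smooth_coinduct [where S = "\<lambda>h. \<exists>c. h = (\<lambda>x. c)"]) auto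

lemma smooth_cmult: "smooth f \<Longrightarrow> smooth (\<lambda>x. c * f x)"
  by (simp add: smooth_mult)

lemma smooth_minus: "smooth f \<Longrightarrow> smooth (\<lambda>x. - f x)"
  using smooth_cmult [of f "-1"] by simp

lemma smooth_diff: "smooth f \<Longrightarrow> smooth g \<Longrightarrow> smooth (\<lambda>x. f x - g x)"
  using smooth_add [of f "\<lambda>x. - g x"] by (simp add: smooth_minus)

lemma smooth_prod: "(\<And>i. i \<in> I \<Longrightarrow> smooth (f i)) \<Longrightarrow> smooth (\<lambda>x. \<Prod>i\<in>I. f i x)"
  by (induction I rule: infinite_finite_induct) (auto intro: smooth_mult)

lemma dir_deriv_cmult:
  assumes "\<And>x. f differentiable (at x)"
  shows "dir_deriv v (\<lambda>x. c * f x) = (\<lambda>x. c * dir_deriv v f x)"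
  using dir_deriv_mult [of "\<lambda>x. c" f v] assms by simp

lemma dir_deriv_real:
  fixes f :: "real \<Rightarrow> real"
  assumes "\<And>x. (f has_real_derivative f' x) (at x)"
  shows "dir_deriv v f = (\<lambda>x. v * f' x)"
  by (rule ext, subst dir_deriv_eqI [OF assms [unfolded has_field_derivative_def]]) simp

text \<open>On the line a directional derivative is \<open>v\<close> times the ordinary one.
  Enlarging \<open>S\<close> by scalar multiples absorbs the factor \<open>v\<close>, and only
  ordinary derivatives remain to be computed.\<close>

lemma smooth_real_coinduct:
  fixes f :: "real \<Rightarrow> real"
  assumes "S f" and step: "\<And>g. S g \<Longrightarrow> \<exists>g'. S g' \<and> (\<forall>x. (g has_real_derivative g' x) (at x))"
  shows "smooth f"
proof (rule smooth_coinduct [where S = "\<lambda>h. \<exists>c g. S g \<and> h = (\<lambda>x. c * g x)"])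
  show "\<exists>c g. S g \<and> f = (\<lambda>x. c * g x)" using \<open>S f\<close> by (auto intro: exI [of _ 1])
next
  fix h :: "real \<Rightarrow> real" and x assume "\<exists>c g. S g \<and> h = (\<lambda>x. c * g x)"
  then obtain c g where "S g" "h = (\<lambda>x. c * g x)" by auto
  then show "h differentiable (at x)"
    using step [of g] by (auto simp: real_differentiable_def intro: DERIV_cmult)
next
  fix h :: "real \<Rightarrow> real" and v assume "\<exists>c g. S g \<and> h = (\<lambda>x. c * g x)"
  then obtain c g where g: "S g" "h = (\<lambda>x. c * g x)" by auto
  obtain g' where "S g'" and g': "\<And>x. (g has_real_derivative g' x) (at x)" using step [OF g(1)] by auto
  have "dir_deriv v h = (\<lambda>x. (v * c) * g' x)"
    using dir_deriv_real [OF DERIV_cmult [OF g']] g by (simp add: ac_simps)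
  then show "\<exists>c g. S g \<and> dir_deriv v h = (\<lambda>x. c * g x)" using \<open>S g'\<close> by auto
qed

section \<open>A smooth step function and cutoffs built from exp (-1/x)\<close>

definition flat :: "real poly \<Rightarrow> real \<Rightarrow> real" where
  "flat p x = (if x > 0 then poly p (1 / x) * exp (- 1 / x) else 0)"

lemma poly_over_exp_tendsto_0:
  fixes p :: "real poly" shows "((\<lambda>y. poly p y * exp (- y)) \<longlongrightarrow> 0) at_top"
proof -
  have "((\<lambda>y. \<Sum>i\<le>degree p. coeff p i * (y ^ i / exp y)) \<longlongrightarrow> (\<Sum>i\<le>degree p. coeff p i * 0)) at_top"
    by (intro tendsto_sum tendsto_mult tendsto_const tendsto_power_div_exp_0)
  then show ?thesis by (simp add: poly_altdef sum_distrib_right exp_minus divide_inverse mult.assoc)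
qed

text \<open>For x > 0 the chain rule gives the polynomial y^2 (p - p') in y = 1 / x. Hence the
  functions p (1 / x) exp (-1 / x), extended by zero, are closed under differentiation, which is why
  \<open>flat\<close> carries a polynomial.\<close>

lemma flat_deriv:
  "(flat p has_real_derivative flat ([:0, 0, 1:] * (p - pderiv p)) x) (at x)"
proof -
  consider "x > 0" | "x < 0" | "x = 0" by linarith
  then show ?thesis
  proof cases
    case 1
    then have "((\<lambda>x. poly p (1 / x) * exp (- 1 / x)) has_real_derivative
        flat ([:0, 0, 1:] * (p - pderiv p)) x) (at x)"
      by (auto simp: flat_def field_simps power2_eq_square intro!: derivative_eq_intros
          poly_DERIV [THEN DERIV_chain2])
    then show ?thesis
      by (rule DERIV_cong_ev [THEN iffD1, rotated -1])
        (use 1 in \<open>auto simp: flat_def intro: eventually_mono [OF order_tendstoD(1)[OF tendsto_ident_at]]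
          eventually_nhds_in_open [of "{0<..}", THEN eventually_mono]\<close>)
  next
    case 2
    have "((\<lambda>x. 0) has_real_derivative flat ([:0, 0, 1:] * (p - pderiv p)) x) (at x)"
      using 2 by (simp add: flat_def)
    then show ?thesis
      by (rule DERIV_cong_ev [THEN iffD1, rotated -1])
        (use 2 in \<open>auto simp: flat_def intro: eventually_nhds_in_open [of "{..<0}", THEN eventually_mono]\<close>)
  next
    case 3
    have "((\<lambda>y. flat p y / y) \<longlongrightarrow> 0) (at_right 0)"
    proof -
      \<comment> \<open>The difference quotient at 0 is again a polynomial in 1 / y times exp (-1 /
        y), now for y p, and the exponential wins.\<close>
      have "filterlim (\<lambda>y::real. inverse y) at_top (at_right 0)" by (rule filterlim_inverse_at_top_right)
      from filterlim_compose [OF poly_over_exp_tendsto_0 [of "[:0,1:] * p"] this]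
      show ?thesis
        by (rule Lim_transform_eventually)
          (auto simp: flat_def eventually_at_right_less divide_inverse eventually_at_filter)
    qed
    moreover have "((\<lambda>y. flat p y / y) \<longlongrightarrow> 0) (at_left 0)"
      by (rule Lim_transform_eventually [OF tendsto_const])
        (auto simp: flat_def eventually_at_filter)
    ultimately have "((\<lambda>y. flat p y / y) \<longlongrightarrow> 0) (at 0)"
      by (simp add: filterlim_split_at)
    then show ?thesis using 3 by (simp add: has_field_derivative_iff flat_def)
  qed
qed

lemma smooth_flat: "smooth (flat p)"
  by (rule smooth_real_coinduct [where S = "\<lambda>h. \<exists>p. h = flat p"]) (use flat_deriv in blast)+

lemma smooth_has_real_derivative:
  fixes f :: "real \<Rightarrow> real"
  assumes "smooth f" shows "(f has_real_derivative dir_deriv 1 f x) (at x)"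
proof -
  obtain f' where f': "(f has_real_derivative f') (at x)"
    using smooth_differentiable [OF assms, of x] real_differentiable_def by blast
  then have "dir_deriv 1 f x = f'" by (simp add: dir_deriv_eqI has_field_derivative_def)
  then show ?thesis using f' by simp
qed

text \<open>The power in the denominator is there for the coinduction: with \<open>f\<close> fixed,
  differentiating g / f^k gives another smooth numerator over f^(k + 1).\<close>

lemma smooth_divide_power:
  fixes f g :: "real \<Rightarrow> real"
  assumes f: "smooth f" and pos: "\<And>x. f x > 0" and "smooth g"
  shows "smooth (\<lambda>x. g x / f x ^ k)"
proof (rule smooth_real_coinduct [where S = "\<lambda>h. \<exists>g k. smooth g \<and> h = (\<lambda>x. g x / f x ^ k)"])
  show "\<exists>g' k'. smooth g' \<and> (\<lambda>x. g x / f x ^ k) = (\<lambda>x. g' x / f x ^ k')"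
    using \<open>smooth g\<close> by auto
next
  fix h assume "\<exists>g k. smooth g \<and> h = (\<lambda>x. g x / f x ^ k)"
  then obtain g k where g: "smooth g" and h: "h = (\<lambda>x. g x / f x ^ k)" by auto
  note D = smooth_has_real_derivative
  let ?g' = "\<lambda>x. dir_deriv 1 g x * f x - real k * g x * dir_deriv 1 f x"
  have "(h has_real_derivative ?g' x / f x ^ Suc k) (at x)" for x
  proof (cases k)
    case 0
    then show ?thesis unfolding h using pos [of x] by (auto intro!: derivative_eq_intros D g)
  next
    case (Suc n)
    have eq: "(a * (F * P) - b * (c * (d * P))) / (F * P * (F * P)) = (a * F - c * b * d) / (F * (F * P))"
      if "F > 0" "P > 0" for a b c d F P :: real
      using that by (simp add: field_simps)
    have "(h has_real_derivative (dir_deriv 1 g x * f x ^ k - g x * (real k * (dir_deriv 1 f x * f x ^ n)))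
        / (f x ^ k * f x ^ k)) (at x)"
      unfolding h using DERIV_divide [OF D [OF g, of x] DERIV_power [OF D [OF f, of x], of k]]
        pos [of x] Suc by (simp add: mult.commute)
    then show ?thesis using eq [of "f x" "f x ^ n"] pos [of x] Suc by simp
  qed
  moreover have "smooth ?g'"
    by (intro smooth_diff smooth_mult smooth_dir_deriv smooth_const f g)
  ultimately show "\<exists>g'. (\<exists>g k. smooth g \<and> g' = (\<lambda>x. g x / f x ^ k)) \<and>
      (\<forall>x. (h has_real_derivative g' x) (at x))"
    by blast
qed

lemma smooth_affine_real:
  fixes f :: "real \<Rightarrow> real"
  assumes "smooth f" shows "smooth (\<lambda>x. f (c * x + d))"
proof (rule smooth_real_coinduct [where S = "\<lambda>h. \<exists>f. smooth f \<and> h = (\<lambda>x. f (c * x + d))"])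
  show "\<exists>f'. smooth f' \<and> (\<lambda>x. f (c * x + d)) = (\<lambda>x. f' (c * x + d))" using assms by auto
next
  fix h assume "\<exists>f. smooth f \<and> h = (\<lambda>x. f (c * x + d))"
  then obtain f where f: "smooth f" and h: "h = (\<lambda>x. f (c * x + d))" by auto
  have "((\<lambda>x. f (c * x + d)) has_derivative (\<lambda>v. dir_deriv (c * v) f (c * x + d))) (at x)" for x
    by (rule has_derivative_compose [OF _ smooth_has_derivative [OF f]])
      (auto intro!: derivative_eq_intros)
  moreover have "dir_deriv (c * v) f y = c * dir_deriv 1 f y * v" for v y
    using linear.scaleR [OF has_derivative_linear [OF smooth_has_derivative [OF f]], of "c * v" 1 y] by simp
  ultimately have "(h has_real_derivative c * dir_deriv 1 f (c * x + d)) (at x)" for x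
    unfolding h has_field_derivative_def by simp
  then show "\<exists>g'. (\<exists>f. smooth f \<and> g' = (\<lambda>x. f (c * x + d))) \<and>
      (\<forall>x. (h has_real_derivative g' x) (at x))"
    using f by (intro exI [of _ "\<lambda>x. c * dir_deriv 1 f (c * x + d)"])
      (auto intro!: exI [of _ "\<lambda>x. c * dir_deriv 1 f x"] smooth_cmult smooth_dir_deriv)
qed

text \<open>A smooth Heaviside function that rises from 0 to 1 on the unit interval. The denominator
  is positive because x and 1 - x are never both nonpositive.\<close>

definition step :: "real \<Rightarrow> real" where
  "step x = flat 1 x / (flat 1 x + flat 1 (1 - x))"

lemma smooth_step: "smooth step"
proof -
  have "flat 1 x + flat 1 (1 - x) > 0" for x by (auto simp: flat_def add_pos_pos)
  moreover have "smooth (\<lambda>x. flat 1 x + flat 1 (1 - x))"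
    using smooth_affine_real [OF smooth_flat, of 1 "-1" 1] by (auto intro: smooth_add smooth_flat)
  ultimately show ?thesis
    using smooth_divide_power [of "\<lambda>x. flat 1 x + flat 1 (1 - x)" "flat 1" 1] smooth_flat
    by (simp add: step_def [abs_def])
qed

lemma step_eq_0: "x \<le> 0 \<Longrightarrow> step x = 0"
  by (simp add: step_def flat_def)

lemma step_eq_1: "x \<ge> 1 \<Longrightarrow> step x = 1"
  by (simp add: step_def flat_def)

text \<open>The product over coordinates needs only compositions with linear functionals, so the
  non-smoothness of the norm never matters. The result is 1 on the unit ball and 0 outside a
  box.\<close>

definition cutoff :: "'a::euclidean_space \<Rightarrow> real" where
  "cutoff x = (\<Prod>b\<in>Basis. step (2 + x \<bullet> b) * step (2 - x \<bullet> b))"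

lemma smooth_cutoff: "smooth (cutoff :: 'a::euclidean_space \<Rightarrow> real)"
proof -
  have "smooth (\<lambda>x::'a. step (2 + x \<bullet> b))" "smooth (\<lambda>x::'a. step (2 - x \<bullet> b))" for b
    using smooth_compose_linear [OF bounded_linear_inner_left smooth_affine_real [OF smooth_step, of 1 2], of b]
      smooth_compose_linear [OF bounded_linear_inner_left smooth_affine_real [OF smooth_step, of "-1" 2], of b]
    by (simp_all add: add.commute)
  then show ?thesis
    unfolding cutoff_def [abs_def] by (intro smooth_prod smooth_mult)
qed

lemma cutoff_eq_1: "norm x \<le> 1 \<Longrightarrow> cutoff x = 1"
  unfolding cutoff_def
proof (intro prod.neutral ballI)
  fix b :: 'a assume "norm x \<le> 1" "b \<in> Basis"
  then have "\<bar>x \<bullet> b\<bar> \<le> 1" using Basis_le_norm order_trans by blast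
  then show "step (2 + x \<bullet> b) * step (2 - x \<bullet> b) = 1" by (simp add: step_eq_1 abs_le_iff)
qed

lemma cutoff_eq_0:
  fixes x :: "'a::euclidean_space"
  assumes "x \<notin> cbox (- 2 *\<^sub>R One) (2 *\<^sub>R One)" shows "cutoff x = 0"
proof -
  obtain b :: 'a where "b \<in> Basis" "x \<bullet> b < - 2 \<or> 2 < x \<bullet> b"
    using assms by (auto simp: mem_box not_le)
  then have "step (2 + x \<bullet> b) * step (2 - x \<bullet> b) = 0" by (auto simp: step_eq_0)
  then show ?thesis unfolding cutoff_def using \<open>b \<in> Basis\<close> by (auto intro: prod_zero)
qed

lemma dir_deriv_eq_0_outside_closed:
  assumes "closed K" "\<And>x. x \<notin> K \<Longrightarrow> f x = 0" "x \<notin> K"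
  shows "dir_deriv v f x = 0"
proof -
  have "(f has_derivative (\<lambda>v. 0)) (at x)"
    by (rule has_derivative_transform_within_open [OF has_derivative_const [of 0], of "- K"])
      (use assms in auto)
  then show ?thesis by (simp add: dir_deriv_eqI)
qed

lemma iter_dir_deriv_eq_0_outside_closed:
  assumes "closed K" "\<And>x. x \<notin> K \<Longrightarrow> f x = 0" "x \<notin> K"
  shows "iter_dir_deriv vs f x = 0"
  using assms(3)
  by (induction vs arbitrary: x) (auto simp: assms intro: dir_deriv_eq_0_outside_closed [OF assms(1)])

lemma bounded_iter_dir_deriv_cutoff:
  "\<exists>C. \<forall>x::'a::euclidean_space. \<bar>iter_dir_deriv vs cutoff x\<bar> \<le> C"
proof -
  let ?K = "cbox (- 2 *\<^sub>R One) (2 *\<^sub>R One) :: 'a set"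
  have "compact (iter_dir_deriv vs cutoff ` ?K)"
    by (intro compact_continuous_image continuous_on_subset [OF smooth_continuous]
        smooth_iter_dir_deriv smooth_cutoff) auto
  then obtain C where C: "\<And>x. x \<in> ?K \<Longrightarrow> \<bar>iter_dir_deriv vs cutoff x\<bar> \<le> C"
    by (auto dest!: compact_imp_bounded simp: bounded_iff) blast
  have "iter_dir_deriv vs cutoff x = 0" if "x \<notin> ?K" for x :: 'a
    by (rule iter_dir_deriv_eq_0_outside_closed [OF closed_cbox cutoff_eq_0 that])
  then have "\<bar>iter_dir_deriv vs cutoff x\<bar> \<le> max C 0" for x :: 'a
    using C [of x] by (cases "x \<in> ?K") auto
  then show ?thesis by blast
qed

section \<open>Square-integrable functions and Gaussians\<close>

lemma cis_measurable [measurable]: "cis \<in> borel_measurable borel"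
  by (simp add: borel_measurable_continuous_onI continuous_on_cis)

lemma cnj_measurable [measurable]: "cnj \<in> borel_measurable borel"
  by (simp add: borel_measurable_continuous_onI continuous_on_cnj)

lemma Lp_2_iff:
  "Lp 2 f \<longleftrightarrow> f \<in> borel_measurable lebesgue \<and> integrable lebesgue (\<lambda>x. (norm (f x))\<^sup>2)"
  by (simp add: Lp_def)

lemma Lp_norm_2_eq: "Lp_norm 2 f = sqrt (LINT x|lebesgue. (norm (f x))\<^sup>2)"
  by (simp add: Lp_norm_def powr_half_sqrt)

lemma Lp_norm_2_sq: "(Lp_norm 2 f)\<^sup>2 = (LINT x|lebesgue. (norm (f x))\<^sup>2)"
  by (simp add: Lp_norm_2_eq)

lemma Lp_norm_nonneg [simp]: "0 \<le> Lp_norm q f"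
  by (simp add: Lp_norm_def)

text \<open>Norms are defined over the completed measure, while Fubini and substitution are applied
  over \<open>lborel\<close>. For Borel functions the two integrals agree, and this is the bridge
  between them.\<close>

lemma Lp_2_lborel:
  assumes f: "f \<in> borel_measurable borel"
  shows "Lp 2 f \<longleftrightarrow> integrable lborel (\<lambda>x. (norm (f x))\<^sup>2)"
    and "Lp_norm 2 f = sqrt (LINT x|lborel. (norm (f x))\<^sup>2)"
  using f by (auto simp: Lp_2_iff Lp_norm_2_eq integrable_completion integral_completion
      intro: measurable_completion)

lemma Lp_2_Cauchy_Schwarz:
  fixes f :: "'a::euclidean_space \<Rightarrow> real" and g :: "'a \<Rightarrow> 'b::euclidean_space"
  assumes f: "Lp 2 f" and g: "Lp 2 g"
  shows "integrable lebesgue (\<lambda>x. f x *\<^sub>R g x)"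
    and "(LINT x|lebesgue. \<bar>f x\<bar> * norm (g x)) \<le> Lp_norm 2 f * Lp_norm 2 g"
    and "norm (LINT x|lebesgue. f x *\<^sub>R g x) \<le> Lp_norm 2 f * Lp_norm 2 g"
proof -
  have [measurable]: "f \<in> borel_measurable lebesgue" "g \<in> borel_measurable lebesgue"
    and int: "integrable lebesgue (\<lambda>x. (f x)\<^sup>2)" "integrable lebesgue (\<lambda>x. (norm (g x))\<^sup>2)"
    using f g by (auto simp: Lp_2_iff)
  have "integrable lebesgue (\<lambda>x. (f x)\<^sup>2 + (norm (g x))\<^sup>2)"
    using int by simp
  then show i1: "integrable lebesgue (\<lambda>x. f x *\<^sub>R g x)"
  proof (rule Bochner_Integration.integrable_bound, measurable, intro AE_I2)
    fix x
    have "0 \<le> (\<bar>f x\<bar> - norm (g x))\<^sup>2" "0 \<le> \<bar>f x\<bar> * norm (g x)" by simp_all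
    then have "\<bar>f x\<bar> * norm (g x) \<le> (f x)\<^sup>2 + (norm (g x))\<^sup>2"
      unfolding power2_diff power2_abs by linarith
    then show "norm (f x *\<^sub>R g x) \<le> norm ((f x)\<^sup>2 + (norm (g x))\<^sup>2)" by simp
  qed
  then have i2: "integrable lebesgue (\<lambda>x. \<bar>f x\<bar> * norm (g x))"
    using integrable_norm by fastforce
  let ?A = "LINT x|lebesgue. \<bar>f x\<bar> * norm (g x)"
  have "(\<integral>\<^sup>+x. ennreal \<bar>f x\<bar> * ennreal (norm (g x)) \<partial>lebesgue)\<^sup>2
      \<le> (\<integral>\<^sup>+x. (ennreal \<bar>f x\<bar>)\<^sup>2 \<partial>lebesgue) * (\<integral>\<^sup>+x. (ennreal (norm (g x)))\<^sup>2 \<partial>lebesgue)"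
    by (rule Cauchy_Schwarz_nn_integral) measurable
  moreover have "(\<integral>\<^sup>+x. ennreal \<bar>f x\<bar> * ennreal (norm (g x)) \<partial>lebesgue) = ennreal ?A"
    using nn_integral_eq_integral [OF i2] by (simp add: ennreal_mult)
  moreover have "(\<integral>\<^sup>+x. (ennreal \<bar>f x\<bar>)\<^sup>2 \<partial>lebesgue) = ennreal ((Lp_norm 2 f)\<^sup>2)"
    using nn_integral_eq_integral [OF int(1)] by (simp add: ennreal_power Lp_norm_2_sq)
  moreover have "(\<integral>\<^sup>+x. (ennreal (norm (g x)))\<^sup>2 \<partial>lebesgue) = ennreal ((Lp_norm 2 g)\<^sup>2)"
    using nn_integral_eq_integral [OF int(2)] by (simp add: ennreal_power Lp_norm_2_sq)
  moreover have A: "0 \<le> ?A" by (intro integral_nonneg_AE) auto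
  ultimately have "?A\<^sup>2 \<le> (Lp_norm 2 f * Lp_norm 2 g)\<^sup>2"
    by (simp add: ennreal_power power_mult_distrib flip: ennreal_mult)
  then show *: "?A \<le> Lp_norm 2 f * Lp_norm 2 g"
    by (rule power2_le_imp_le) simp
  have "norm (LINT x|lebesgue. f x *\<^sub>R g x) \<le> (LINT x|lebesgue. norm (f x *\<^sub>R g x))"
    by (rule integral_norm_bound)
  with * show "norm (LINT x|lebesgue. f x *\<^sub>R g x) \<le> Lp_norm 2 f * Lp_norm 2 g" by simp
qed

lemma Lp_2_triangle:
  fixes f g :: "'a::euclidean_space \<Rightarrow> 'b::euclidean_space"
  assumes f: "Lp 2 f" and g: "Lp 2 g"
  shows "Lp 2 (\<lambda>x. f x + g x)" and "Lp_norm 2 (\<lambda>x. f x + g x) \<le> Lp_norm 2 f + Lp_norm 2 g"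
proof -
  have [measurable]: "f \<in> borel_measurable lebesgue" "g \<in> borel_measurable lebesgue"
    and int: "integrable lebesgue (\<lambda>x. (norm (f x))\<^sup>2)" "integrable lebesgue (\<lambda>x. (norm (g x))\<^sup>2)"
    using f g by (auto simp: Lp_2_iff)
  have nf: "Lp 2 (\<lambda>x. norm (f x))" using f by (auto simp: Lp_2_iff)
  have nf': "Lp_norm 2 (\<lambda>x. norm (f x)) = Lp_norm 2 f" by (simp add: Lp_norm_2_eq)
  have ifg: "integrable lebesgue (\<lambda>x. norm (f x) * norm (g x))"
    using integrable_norm [OF Lp_2_Cauchy_Schwarz(1) [OF nf g]] by simp
  have ifg': "(LINT x|lebesgue. norm (f x) * norm (g x)) \<le> Lp_norm 2 f * Lp_norm 2 g"
    using Lp_2_Cauchy_Schwarz(2) [OF nf g] nf' by simp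
  have le: "(norm (f x + g x))\<^sup>2 \<le> (norm (f x))\<^sup>2 + (norm (g x))\<^sup>2 + 2 * (norm (f x) * norm (g x))" for x
    using power_mono [OF norm_triangle_ineq [of "f x" "g x"], of 2] by (simp add: power2_sum)
  have i: "integrable lebesgue (\<lambda>x. (norm (f x))\<^sup>2 + (norm (g x))\<^sup>2 + 2 * (norm (f x) * norm (g x)))"
    using int ifg by simp
  have i': "integrable lebesgue (\<lambda>x. (norm (f x + g x))\<^sup>2)"
    by (rule Bochner_Integration.integrable_bound [OF i]) (use le in auto)
  then show "Lp 2 (\<lambda>x. f x + g x)" by (auto simp: Lp_2_iff)
  have "(Lp_norm 2 (\<lambda>x. f x + g x))\<^sup>2 \<le> (Lp_norm 2 f)\<^sup>2 + (Lp_norm 2 g)\<^sup>2 + 2 * (Lp_norm 2 f * Lp_norm 2 g)"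
    unfolding Lp_norm_2_sq using integral_mono [OF i' i] le int ifg ifg' by simp
  then have "(Lp_norm 2 (\<lambda>x. f x + g x))\<^sup>2 \<le> (Lp_norm 2 f + Lp_norm 2 g)\<^sup>2"
    by (simp add: power2_sum)
  then show "Lp_norm 2 (\<lambda>x. f x + g x) \<le> Lp_norm 2 f + Lp_norm 2 g"
    by (rule power2_le_imp_le) simp
qed

lemma Lp_2_scale:
  fixes f :: "'a::euclidean_space \<Rightarrow> 'b::euclidean_space"
  assumes f: "Lp 2 f"
  shows "Lp 2 (\<lambda>x. c *\<^sub>R f x)"
  using assms by (auto simp: Lp_2_iff power_mult_distrib)

lemma Lp_2_diff:
  fixes f g :: "'a::euclidean_space \<Rightarrow> 'b::euclidean_space"
  assumes f: "Lp 2 f" and g: "Lp 2 g" shows "Lp 2 (\<lambda>x. f x - g x)"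
  using Lp_2_triangle(1) [OF f Lp_2_scale [OF g, of "-1"]] by simp

section \<open>Gaussian integrals\<close>

lemma gaussian_integral_real:
  assumes s: "s > 0"
  shows "integrable lborel (\<lambda>x. cis (x * z) * of_real (exp (- s * x\<^sup>2 / 2)))"
    and "(LINT x|lborel. cis (x * z) * of_real (exp (- s * x\<^sup>2 / 2))) =
      of_real (sqrt (2 * pi / s) * exp (- z\<^sup>2 / (2 * s)))"
proof -
  \<comment> \<open>Scaling by \<open>sqrt s\<close> reduces the integral to the characteristic
    function of the standard normal distribution, evaluated at \<open>t\<close>.\<close>
  define t where "t = z / sqrt s"
  define f where "f x = exp (- x\<^sup>2 / 2) *\<^sub>R cis (t * x)" for x
  have [measurable]: "f \<in> borel_measurable borel" unfolding f_def by measurable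
  have f_eq: "f (0 + sqrt s * x) = cis (x * z) * of_real (exp (- s * x\<^sup>2 / 2))" for x
    using s by (simp add: f_def t_def scaleR_conv_of_real mult.commute power_mult_distrib)
  have f_std: "f x = sqrt (2 * pi) *\<^sub>R (std_normal_density x *\<^sub>R cis (t * x))" for x
    by (simp add: f_def std_normal_density_def)
  have "integrable lborel std_normal_density" by simp
  then have "integrable lborel (\<lambda>x. std_normal_density x *\<^sub>R cis (t * x))"
    by (rule Bochner_Integration.integrable_bound) auto
  then have int: "integrable lborel f" unfolding f_std [abs_def] by (rule integrable_scaleR_right)
  have "(LINT x|std_normal_distribution. cis (t * x)) = of_real (exp (- (t\<^sup>2) / 2))"
    using char_std_normal_distribution
    by (simp add: char_def fun_eq_iff cis_conv_exp del: of_real_exp)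
  then have "(LINT x|lborel. std_normal_density x *\<^sub>R cis (t * x)) = of_real (exp (- (t\<^sup>2) / 2))"
    by (subst (asm) integral_density) auto
  then have val: "(LINT x|lborel. f x) = of_real (sqrt (2 * pi) * exp (- (t\<^sup>2) / 2))"
    by (simp add: f_std scaleR_conv_of_real del: of_real_exp)
  show "integrable lborel (\<lambda>x. cis (x * z) * of_real (exp (- s * x\<^sup>2 / 2)))"
    using lborel_integrable_real_affine [OF int, of "sqrt s" 0] s unfolding f_eq by simp
  have "(LINT x|lborel. f x) = sqrt s *\<^sub>R (LINT x|lborel. f (0 + sqrt s * x))"
    using lborel_integral_real_affine [of "sqrt s" f 0] s by simp
  then have "(LINT x|lborel. f (0 + sqrt s * x)) = (1 / sqrt s) *\<^sub>R (LINT x|lborel. f x)"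
    using s by simp
  then show "(LINT x|lborel. cis (x * z) * of_real (exp (- s * x\<^sup>2 / 2))) =
      of_real (sqrt (2 * pi / s) * exp (- z\<^sup>2 / (2 * s)))"
    unfolding f_eq val using s
    by (simp add: t_def power_divide real_sqrt_divide scaleR_conv_of_real mult.commute)
qed

lemma sum_Basis_cis: "(\<Prod>b\<in>B. cis (f b)) = cis (\<Sum>b\<in>B. f b)"
  by (induction B rule: infinite_finite_induct) (auto simp: cis_mult)

text \<open>\<open>lborel\<close> is the image of the product of one-dimensional Lebesgue measures
  under the coordinate map, so integrals of products over coordinates factor.\<close>

lemma
  fixes f :: "'a::euclidean_space \<Rightarrow> real \<Rightarrow> complex"
  assumes f: "\<And>b. b \<in> Basis \<Longrightarrow> integrable lborel (f b)"
  shows integrable_lborel_prod: "integrable lborel (\<lambda>x. \<Prod>b\<in>Basis. f b (x \<bullet> b))"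
    and integral_lborel_prod: "(LINT x|lborel. (\<Prod>b\<in>Basis. f b (x \<bullet> b))) = (\<Prod>b\<in>Basis. LINT x|lborel. f b x)"
proof -
  interpret product_sigma_finite "\<lambda>b::'a. lborel :: real measure" ..
  have [measurable]: "\<And>b. b \<in> Basis \<Longrightarrow> f b \<in> borel_measurable borel"
    using f borel_measurable_integrable by fastforce
  have [measurable]: "(\<lambda>x. \<Prod>b\<in>Basis. f b (x \<bullet> b)) \<in> borel_measurable borel"
    by measurable
  have m: "(\<lambda>f. \<Sum>b\<in>Basis. f b *\<^sub>R b) \<in> measurable (\<Pi>\<^sub>M b\<in>Basis. lborel) (borel :: 'a measure)"
    by measurable
  show "integrable lborel (\<lambda>x. \<Prod>b\<in>Basis. f b (x \<bullet> b))"
    by (subst lborel_eq, subst integrable_distr_eq [OF m])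
      (use product_integrable_prod [of Basis f] f in auto)
  show "(LINT x|lborel. (\<Prod>b\<in>Basis. f b (x \<bullet> b))) = (\<Prod>b\<in>Basis. LINT x|lborel. f b x)"
    by (subst lborel_eq, subst integral_distr [OF m])
      (use product_integral_prod [of Basis f] f in auto)
qed

text \<open>\<open>s\<close> is an inverse variance and there is no normalisation. Thus
  \<open>gauss s\<close> tends to 1 pointwise as \<open>s\<close> tends to 0, which is how it serves
  as a removable weight.\<close>

definition gauss :: "real \<Rightarrow> 'a::euclidean_space \<Rightarrow> real" where
  "gauss s x = exp (- s * (norm x)\<^sup>2 / 2)"

lemma gauss_measurable [measurable]: "gauss s \<in> borel_measurable borel"
  unfolding gauss_def [abs_def] by measurable

lemma gauss_pos [simp]: "0 < gauss s x" "0 \<le> gauss s x"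
  by (simp_all add: gauss_def)

lemma gauss_le_1: "s \<ge> 0 \<Longrightarrow> gauss s x \<le> 1"
  by (simp add: gauss_def)

lemma gauss_eq_prod: "gauss s x = (\<Prod>b\<in>Basis. exp (- s * (x \<bullet> b)\<^sup>2 / 2))"
  unfolding gauss_def power2_norm_eq_inner euclidean_inner [of x x]
  by (simp add: exp_sum [symmetric] power2_eq_square sum_distrib_left sum_divide_distrib sum_negf)

lemma gaussian_integral:
  fixes z :: "'a::euclidean_space"
  assumes s: "s > 0"
  shows "integrable lborel (\<lambda>x. cis (x \<bullet> z) * of_real (gauss s x))" (is ?i)
    and "(LINT x|lborel. cis (x \<bullet> z) * of_real (gauss s x)) =
      of_real (sqrt (2 * pi / s) ^ DIM('a) * gauss (1 / s) z)" (is ?v)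
proof -
  let ?f = "\<lambda>(b::'a) x. cis (x * (z \<bullet> b)) * of_real (exp (- s * x\<^sup>2 / 2))"
  have eq: "cis (x \<bullet> z) * of_real (gauss s x) = (\<Prod>b\<in>Basis. ?f b (x \<bullet> b))" for x
    unfolding gauss_eq_prod prod.distrib of_real_prod sum_Basis_cis euclidean_inner [of x z] ..
  show ?i unfolding eq using s by (intro integrable_lborel_prod gaussian_integral_real)
  have "(LINT x|lborel. cis (x \<bullet> z) * of_real (gauss s x)) =
      (\<Prod>b\<in>(Basis::'a set). of_real (sqrt (2 * pi / s) * exp (- (z \<bullet> b)\<^sup>2 / (2 * s))))"
    unfolding eq using s
    using gaussian_integral_real [OF s]
    by (subst integral_lborel_prod) (auto intro!: prod.cong simp del: of_real_mult)
  also have "\<dots> = of_real (sqrt (2 * pi / s) ^ DIM('a) * gauss (1 / s) z)"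
    unfolding of_real_prod [symmetric] prod.distrib prod_constant gauss_eq_prod using s
    by (simp add: mult.commute)
  finally show ?v .
qed

lemma
  assumes s: "s > 0"
  shows integrable_gauss: "integrable lborel (gauss s :: 'a::euclidean_space \<Rightarrow> real)"
    and integral_gauss: "(LINT x::'a|lborel. gauss s x) = sqrt (2 * pi / s) ^ DIM('a)"
proof -
  have eq: "gauss s = (\<lambda>x::'a. Re (cis (x \<bullet> 0) * of_real (gauss s x)))" by auto
  show "integrable lborel (gauss s :: 'a \<Rightarrow> real)"
    by (subst eq) (intro integrable_Re gaussian_integral s)
  have "(LINT x::'a|lborel. gauss s x) = Re (LINT x::'a|lborel. cis (x \<bullet> 0) * of_real (gauss s x))"
    by (subst eq, subst integral_Re) (auto intro: gaussian_integral [OF s, of 0, simplified])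
  then show "(LINT x::'a|lborel. gauss s x) = sqrt (2 * pi / s) ^ DIM('a)"
    using gaussian_integral(2) [OF s, of "0::'a"] by (simp add: gauss_def del: of_real_mult of_real_power)
qed

section \<open>Fourier integrals\<close>

text \<open>The inverse transform without its factor (2 \<pi>)^(-n); the missing normalisation is
  the reason for (2 \<pi>)^n in the L^2 bound.\<close>

definition fourier :: "('a::euclidean_space \<Rightarrow> complex) \<Rightarrow> 'a \<Rightarrow> complex" where
  "fourier h x = (LINT \<xi>|lborel. cis (x \<bullet> \<xi>) * h \<xi>)"

lemma integrable_cis_mult:
  assumes h: "integrable lborel h"
  shows "integrable lborel (\<lambda>\<xi>. cis (x \<bullet> \<xi>) * h \<xi>)"
proof -
  have [measurable]: "h \<in> borel_measurable borel" using h borel_measurable_integrable by fastforce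
  show ?thesis by (rule Bochner_Integration.integrable_bound [OF h]) (auto simp: norm_mult)
qed

lemma norm_fourier_le: "norm (fourier h x) \<le> (LINT \<xi>|lborel. norm (h \<xi>))"
  unfolding fourier_def using integral_norm_bound [of lborel "\<lambda>\<xi>. cis (x \<bullet> \<xi>) * h \<xi>"]
  by (simp add: norm_mult)

lemma fourier_measurable:
  assumes [measurable]: "h \<in> borel_measurable borel"
  shows "fourier h \<in> borel_measurable borel"
  unfolding fourier_def [abs_def] by measurable

lemma integrable_lborel_pair_mult:
  fixes f :: "'a::euclidean_space \<Rightarrow> real" and g :: "'b::euclidean_space \<Rightarrow> real"
  assumes f: "integrable lborel f" and g: "integrable lborel g"
  shows "integrable (lborel \<Otimes>\<^sub>M lborel) (\<lambda>(x, y). f x * g y)"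
proof -
  have [measurable]: "f \<in> borel_measurable borel" "g \<in> borel_measurable borel"
    using f g borel_measurable_integrable by fastforce+
  show ?thesis
    using f g by (intro lborel_pair.Fubini_integrable) (auto simp: abs_mult)
qed

lemma nn_integral_lborel_minus:
  fixes f :: "'a::euclidean_space \<Rightarrow> ennreal"
  assumes [measurable]: "f \<in> borel_measurable borel"
  shows "(\<integral>\<^sup>+y. f (x - y) \<partial>lborel) = (\<integral>\<^sup>+y. f y \<partial>lborel)"
proof -
  have "(\<integral>\<^sup>+y. f y \<partial>lborel) = (\<integral>\<^sup>+y. f y \<partial>density (distr lborel borel (\<lambda>y. x - y)) (\<lambda>_. 1))"
    using lborel_affine [of "-1" x] by simp
  also have "\<dots> = (\<integral>\<^sup>+y. f (x - y) \<partial>lborel)"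
    by (simp add: nn_integral_density nn_integral_distr)
  finally show ?thesis ..
qed

text \<open>Weighting \<open>\<bar>fourier h\<bar>\<^sup>2\<close> with a Gaussian makes the triple integral absolutely convergent; the
  \<open>x\<close>-integral then yields a Gaussian kernel of mass \<open>(2\<pi>)\<^sup>n\<close>, whatever the weight.\<close>

lemma fourier_gauss_weighted:
  fixes h :: "'a::euclidean_space \<Rightarrow> complex"
  assumes h: "integrable lborel h" and h2: "integrable lborel (\<lambda>\<xi>. (norm (h \<xi>))\<^sup>2)" and s: "s > 0"
  shows "(LINT x|lborel. (norm (fourier h x))\<^sup>2 * gauss s x)
    \<le> (2 * pi) ^ DIM('a) * (LINT \<xi>|lborel. (norm (h \<xi>))\<^sup>2)"
proof -
  have [measurable]: "h \<in> borel_measurable borel" using h borel_measurable_integrable by fastforce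
  note [measurable] = fourier_measurable [of h]
  let ?N = "LINT \<xi>|lborel. norm (h \<xi>)"
  let ?c = "sqrt (2 * pi / s) ^ DIM('a)"
  define \<gamma> where "\<gamma> z = ?c * gauss (1 / s) z" for z :: 'a
  have [measurable]: "\<gamma> \<in> borel_measurable borel" unfolding \<gamma>_def by measurable
  have \<gamma>_nonneg: "0 \<le> \<gamma> z" for z unfolding \<gamma>_def using s by simp
  have int_h: "integrable lborel (\<lambda>\<xi>. norm (h \<xi>))" using h by simp
  have int_gauss: "integrable lborel (gauss s :: 'a \<Rightarrow> real)" using s by (rule integrable_gauss)
  have \<gamma>_mass: "(\<integral>\<^sup>+z. \<gamma> z \<partial>lborel) = ennreal ((2 * pi) ^ DIM('a))"
  proof -
    have "integrable lborel \<gamma>" unfolding \<gamma>_def [abs_def] using s by (simp add: integrable_gauss)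
    then have "(\<integral>\<^sup>+z. \<gamma> z \<partial>lborel) = ennreal (LINT z|lborel. \<gamma> z)"
      using \<gamma>_nonneg by (intro nn_integral_eq_integral) auto
    also have "(LINT z|lborel. \<gamma> z) = (sqrt (2 * pi / s) * sqrt (2 * pi / (1 / s))) ^ DIM('a)"
      unfolding \<gamma>_def using s by (simp add: integral_gauss power_mult_distrib)
    also have "sqrt (2 * pi / s) * sqrt (2 * pi / (1 / s)) = sqrt ((2 * pi)\<^sup>2)"
      using s unfolding real_sqrt_mult [symmetric] by (simp add: power2_eq_square)
    also have "\<dots> = 2 * pi" unfolding real_sqrt_abs by simp
    finally show ?thesis .
  qed
  \<comment> \<open>The convolution of the conjugate of \<open>h\<close> with the kernel \<gamma>,
    which the x-integral produces from the Gaussian weight and the two exponentials.\<close>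
  define I where "I \<xi> = (LINT \<eta>|lborel. cnj (h \<eta>) * of_real (\<gamma> (\<xi> - \<eta>)))" for \<xi>
  have inner: "(LINT x|lborel. of_real (gauss s x) * cis (x \<bullet> \<xi>) * cnj (fourier h x)) = I \<xi>" for \<xi>
  proof -
    have "(LINT x|lborel. of_real (gauss s x) * cis (x \<bullet> \<xi>) * cnj (fourier h x)) =
        (LINT x|lborel. LINT \<eta>|lborel. of_real (gauss s x) * cis (x \<bullet> \<xi>) * cnj (cis (x \<bullet> \<eta>) * h \<eta>))"
      unfolding fourier_def by (simp only: integral_mult_right_zero Bochner_Integration.integral_cnj)
    also have "\<dots> = (LINT \<eta>|lborel. LINT x|lborel. of_real (gauss s x) * cis (x \<bullet> \<xi>) * cnj (cis (x \<bullet> \<eta>) * h \<eta>))"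
    proof (rule lborel_pair.Fubini_integral [symmetric])
      show "integrable (lborel \<Otimes>\<^sub>M lborel)
          (\<lambda>(x, \<eta>). of_real (gauss s x) * cis (x \<bullet> \<xi>) * cnj (cis (x \<bullet> \<eta>) * h \<eta>))"
        by (rule Bochner_Integration.integrable_bound [OF integrable_lborel_pair_mult [OF int_gauss int_h]])
          (auto simp: norm_mult split: prod.split)
    qed
    also have "\<dots> = I \<xi>"
      unfolding I_def
    proof (rule Bochner_Integration.integral_cong [OF refl])
      fix \<eta>
      have "of_real (gauss s x) * cis (x \<bullet> \<xi>) * cnj (cis (x \<bullet> \<eta>) * h \<eta>) =
          cnj (h \<eta>) * (cis (x \<bullet> (\<xi> - \<eta>)) * of_real (gauss s x))" for x
      proof -
        have "cis (x \<bullet> \<xi>) * cis (- (x \<bullet> \<eta>)) = cis (x \<bullet> (\<xi> - \<eta>))"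
          by (simp add: cis_mult inner_diff_right)
        then show ?thesis by (simp add: cis_cnj mult_ac)
      qed
      then show "(LINT x|lborel. of_real (gauss s x) * cis (x \<bullet> \<xi>) * cnj (cis (x \<bullet> \<eta>) * h \<eta>)) =
          cnj (h \<eta>) * of_real (\<gamma> (\<xi> - \<eta>))"
        by (simp only: integral_mult_right_zero gaussian_integral(2) [OF s] \<gamma>_def)
    qed
    finally show ?thesis .
  qed
  \<comment> \<open>In |fourier h|^2 only one of the two conjugate factors is expanded at a time:
    one in \<open>inner\<close>, the other here. So Fubini is needed for double integrals
    only.\<close>
  have "of_real (LINT x|lborel. (norm (fourier h x))\<^sup>2 * gauss s x) =
      (LINT x|lborel. of_real ((norm (fourier h x))\<^sup>2 * gauss s x) :: complex)"
    by (rule integral_complex_of_real [symmetric])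
  also have "\<dots> = (LINT x|lborel. LINT \<xi>|lborel. of_real (gauss s x) * cnj (fourier h x) * (cis (x \<bullet> \<xi>) * h \<xi>))"
  proof (rule Bochner_Integration.integral_cong [OF refl])
    fix x
    have "(LINT \<xi>|lborel. of_real (gauss s x) * cnj (fourier h x) * (cis (x \<bullet> \<xi>) * h \<xi>)) =
      of_real (gauss s x) * cnj (fourier h x) * fourier h x"
      by (simp add: fourier_def [symmetric])
    then show "of_real ((norm (fourier h x))\<^sup>2 * gauss s x) =
        (LINT \<xi>|lborel. of_real (gauss s x) * cnj (fourier h x) * (cis (x \<bullet> \<xi>) * h \<xi>))"
      by (simp only: of_real_mult complex_norm_square) (simp only: mult_ac)
  qed
  also have "\<dots> = (LINT \<xi>|lborel. LINT x|lborel. of_real (gauss s x) * cnj (fourier h x) * (cis (x \<bullet> \<xi>) * h \<xi>))"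
  proof (rule lborel_pair.Fubini_integral [symmetric])
    have "integrable (lborel \<Otimes>\<^sub>M lborel) (\<lambda>(x::'a, \<xi>::'a). gauss s x * (?N * norm (h \<xi>)))"
      using int_h by (intro integrable_lborel_pair_mult int_gauss) simp
    then show "integrable (lborel \<Otimes>\<^sub>M lborel)
        (\<lambda>(x, \<xi>). of_real (gauss s x) * cnj (fourier h x) * (cis (x \<bullet> \<xi>) * h \<xi>))"
    proof (rule Bochner_Integration.integrable_bound)
      show "AE z in lborel \<Otimes>\<^sub>M lborel.
         norm (case z of (x, \<xi>) \<Rightarrow> of_real (gauss s x) * cnj (fourier h x) * (cis (x \<bullet> \<xi>) * h \<xi>))
         \<le> norm (case z of (x::'a, \<xi>) \<Rightarrow> gauss s x * (?N * norm (h \<xi>)))"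
      proof (intro AE_I2, clarify)
        fix x \<xi>
        have "norm (fourier h x) * norm (h \<xi>) \<le> ?N * norm (h \<xi>)"
          using norm_fourier_le by (rule mult_right_mono) simp
        then have "gauss s x * (norm (fourier h x) * norm (h \<xi>)) \<le> gauss s x * (?N * norm (h \<xi>))"
          by (rule mult_left_mono) simp
        also have "\<dots> \<le> norm (gauss s x * (?N * norm (h \<xi>)))" by simp
        finally show "norm (of_real (gauss s x) * cnj (fourier h x) * (cis (x \<bullet> \<xi>) * h \<xi>))
            \<le> norm (gauss s x * (?N * norm (h \<xi>)))"
          by (simp add: norm_mult mult.assoc)
      qed
    qed measurable
  qed
  also have "\<dots> = (LINT \<xi>|lborel. h \<xi> * I \<xi>)"
    unfolding inner [symmetric] by (simp add: mult_ac flip: integral_mult_right_zero)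
  finally have eq: "of_real (LINT x|lborel. (norm (fourier h x))\<^sup>2 * gauss s x) = (LINT \<xi>|lborel. h \<xi> * I \<xi>)" .
  have [measurable]: "I \<in> borel_measurable borel" unfolding I_def [abs_def] by measurable
  have "ennreal (norm (LINT \<xi>|lborel. h \<xi> * I \<xi>)) \<le> (\<integral>\<^sup>+\<xi>. ennreal (norm (h \<xi> * I \<xi>)) \<partial>lborel)"
    by (cases "integrable lborel (\<lambda>\<xi>. h \<xi> * I \<xi>)")
      (auto simp: not_integrable_integral_eq intro: integral_norm_bound_ennreal)
  also have "\<dots> \<le> (\<integral>\<^sup>+\<xi>. \<integral>\<^sup>+\<eta>. ennreal (norm (h \<xi>) * (norm (h \<eta>) * \<gamma> (\<xi> - \<eta>))) \<partial>lborel \<partial>lborel)"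
  proof (rule nn_integral_mono)
    fix \<xi>
    have "ennreal (norm (I \<xi>)) \<le> (\<integral>\<^sup>+\<eta>. ennreal (norm (cnj (h \<eta>) * of_real (\<gamma> (\<xi> - \<eta>)) :: complex)) \<partial>lborel)"
      unfolding I_def
      by (cases "integrable lborel (\<lambda>\<eta>. cnj (h \<eta>) * of_real (\<gamma> (\<xi> - \<eta>)) :: complex)")
        (auto simp: not_integrable_integral_eq intro: integral_norm_bound_ennreal)
    also have "\<dots> = (\<integral>\<^sup>+\<eta>. ennreal (norm (h \<eta>) * \<gamma> (\<xi> - \<eta>)) \<partial>lborel)"
      using \<gamma>_nonneg by (simp add: norm_mult)
    finally have "ennreal (norm (h \<xi>)) * ennreal (norm (I \<xi>)) \<le>
        ennreal (norm (h \<xi>)) * (\<integral>\<^sup>+\<eta>. ennreal (norm (h \<eta>) * \<gamma> (\<xi> - \<eta>)) \<partial>lborel)"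
      by (rule mult_left_mono) simp
    then show "ennreal (norm (h \<xi> * I \<xi>)) \<le> (\<integral>\<^sup>+\<eta>. ennreal (norm (h \<xi>) * (norm (h \<eta>) * \<gamma> (\<xi> - \<eta>))) \<partial>lborel)"
      using \<gamma>_nonneg by (simp add: norm_mult ennreal_mult nn_integral_cmult)
  qed
  \<comment> \<open>Schur's test: bounding a product by half the sum of squares leaves, in each
    summand, one variable in which only \<gamma> is integrated.\<close>
  also have "\<dots> \<le> (\<integral>\<^sup>+\<xi>. \<integral>\<^sup>+\<eta>. ennreal ((norm (h \<xi>))\<^sup>2 / 2 * \<gamma> (\<xi> - \<eta>)) + ennreal ((norm (h \<eta>))\<^sup>2 / 2 * \<gamma> (\<xi> - \<eta>)) \<partial>lborel \<partial>lborel)"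
  proof (intro nn_integral_mono)
    fix \<xi> \<eta>
    have "norm (h \<xi>) * norm (h \<eta>) \<le> (norm (h \<xi>))\<^sup>2 / 2 + (norm (h \<eta>))\<^sup>2 / 2"
      using zero_le_power2 [of "norm (h \<xi>) - norm (h \<eta>)"] by (simp add: power2_diff)
    then have "norm (h \<xi>) * norm (h \<eta>) * \<gamma> (\<xi> - \<eta>) \<le> ((norm (h \<xi>))\<^sup>2 / 2 + (norm (h \<eta>))\<^sup>2 / 2) * \<gamma> (\<xi> - \<eta>)"
      by (rule mult_right_mono) (rule \<gamma>_nonneg)
    then show "ennreal (norm (h \<xi>) * (norm (h \<eta>) * \<gamma> (\<xi> - \<eta>)))
      \<le> ennreal ((norm (h \<xi>))\<^sup>2 / 2 * \<gamma> (\<xi> - \<eta>)) + ennreal ((norm (h \<eta>))\<^sup>2 / 2 * \<gamma> (\<xi> - \<eta>))"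
      using \<gamma>_nonneg [of "\<xi> - \<eta>"] by (simp add: distrib_right mult.assoc flip: ennreal_plus)
  qed
  also have "\<dots> = (\<integral>\<^sup>+\<xi>. \<integral>\<^sup>+\<eta>. ennreal ((norm (h \<xi>))\<^sup>2 / 2 * \<gamma> (\<xi> - \<eta>)) \<partial>lborel \<partial>lborel)
     + (\<integral>\<^sup>+\<xi>. \<integral>\<^sup>+\<eta>. ennreal ((norm (h \<eta>))\<^sup>2 / 2 * \<gamma> (\<xi> - \<eta>)) \<partial>lborel \<partial>lborel)"
    by (simp add: nn_integral_add)
  also have "(\<integral>\<^sup>+\<xi>. \<integral>\<^sup>+\<eta>. ennreal ((norm (h \<eta>))\<^sup>2 / 2 * \<gamma> (\<xi> - \<eta>)) \<partial>lborel \<partial>lborel) =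
      (\<integral>\<^sup>+\<eta>. \<integral>\<^sup>+\<xi>. ennreal ((norm (h \<eta>))\<^sup>2 / 2 * \<gamma> (\<xi> - \<eta>)) \<partial>lborel \<partial>lborel)"
    by (rule lborel_pair.Fubini') measurable
  also have "\<dots> = (\<integral>\<^sup>+\<eta>. \<integral>\<^sup>+\<xi>. ennreal ((norm (h \<eta>))\<^sup>2 / 2 * \<gamma> (\<eta> - \<xi>)) \<partial>lborel \<partial>lborel)"
    by (simp add: \<gamma>_def gauss_def norm_minus_commute)
  also have "(\<integral>\<^sup>+\<xi>. \<integral>\<^sup>+\<eta>. ennreal ((norm (h \<xi>))\<^sup>2 / 2 * \<gamma> (\<xi> - \<eta>)) \<partial>lborel \<partial>lborel) =
      (\<integral>\<^sup>+\<xi>. ennreal ((norm (h \<xi>))\<^sup>2 / 2 * (2 * pi) ^ DIM('a)) \<partial>lborel)"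
  proof (rule nn_integral_cong)
    fix \<xi>
    have "(\<integral>\<^sup>+\<eta>. ennreal ((norm (h \<xi>))\<^sup>2 / 2 * \<gamma> (\<xi> - \<eta>)) \<partial>lborel) =
        ennreal ((norm (h \<xi>))\<^sup>2 / 2) * (\<integral>\<^sup>+\<eta>. ennreal (\<gamma> (\<xi> - \<eta>)) \<partial>lborel)"
      using \<gamma>_nonneg
      by (subst nn_integral_cmult [symmetric], measurable, subst ennreal_mult [symmetric]) simp_all
    also have "(\<integral>\<^sup>+\<eta>. ennreal (\<gamma> (\<xi> - \<eta>)) \<partial>lborel) = ennreal ((2 * pi) ^ DIM('a))"
      using \<gamma>_mass nn_integral_lborel_minus [of "\<lambda>z. ennreal (\<gamma> z)" \<xi>] by simp
    finally show "(\<integral>\<^sup>+\<eta>. ennreal ((norm (h \<xi>))\<^sup>2 / 2 * \<gamma> (\<xi> - \<eta>)) \<partial>lborel) =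
        ennreal ((norm (h \<xi>))\<^sup>2 / 2 * (2 * pi) ^ DIM('a))"
      by (subst ennreal_mult) auto
  qed
  also have "\<dots> + \<dots> = ennreal ((2 * pi) ^ DIM('a) * (LINT \<xi>|lborel. (norm (h \<xi>))\<^sup>2))"
  proof -
    have "integrable lborel (\<lambda>\<xi>. (norm (h \<xi>))\<^sup>2 / 2 * (2 * pi) ^ DIM('a))" using h2 by simp
    then have "(\<integral>\<^sup>+\<xi>. ennreal ((norm (h \<xi>))\<^sup>2 / 2 * (2 * pi) ^ DIM('a)) \<partial>lborel) =
      ennreal ((LINT \<xi>|lborel. (norm (h \<xi>))\<^sup>2) / 2 * (2 * pi) ^ DIM('a))"
      by (subst nn_integral_eq_integral) auto
    then show ?thesis by (simp flip: ennreal_plus add: mult.commute)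
  qed
  finally have "norm (LINT \<xi>|lborel. h \<xi> * I \<xi>) \<le> (2 * pi) ^ DIM('a) * (LINT \<xi>|lborel. (norm (h \<xi>))\<^sup>2)"
    by simp
  then show ?thesis using eq [symmetric] by (simp add: abs_le_iff)
qed

text \<open>The weighted bound does not depend on the weight, so Fatou's lemma removes the Gaussian
  as its parameter tends to zero.\<close>

lemma
  fixes h :: "'a::euclidean_space \<Rightarrow> complex"
  assumes h: "integrable lborel h" and h2: "integrable lborel (\<lambda>\<xi>. (norm (h \<xi>))\<^sup>2)"
  shows fourier_L2_integrable: "integrable lborel (\<lambda>x. (norm (fourier h x))\<^sup>2)"
    and fourier_L2_bound: "(LINT x|lborel. (norm (fourier h x))\<^sup>2)
      \<le> (2 * pi) ^ DIM('a) * (LINT \<xi>|lborel. (norm (h \<xi>))\<^sup>2)"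
proof -
  have [measurable]: "h \<in> borel_measurable borel" using h borel_measurable_integrable by fastforce
  note [measurable] = fourier_measurable [of h]
  let ?B = "(2 * pi) ^ DIM('a) * (LINT \<xi>|lborel. (norm (h \<xi>))\<^sup>2)"
  define s where "s n = 1 / real (Suc n)" for n
  have s_pos: "s n > 0" for n by (simp add: s_def)
  have lim: "(\<lambda>n. ennreal ((norm (fourier h x))\<^sup>2 * gauss (s n) x)) \<longlonglongrightarrow> ennreal ((norm (fourier h x))\<^sup>2)" for x
  proof -
    have "s \<longlonglongrightarrow> 0" unfolding s_def by (rule LIMSEQ_Suc [OF lim_1_over_n])
    then have "(\<lambda>n. gauss (s n) x) \<longlonglongrightarrow> exp (- 0 * (norm x)\<^sup>2 / 2)"
      unfolding gauss_def by (intro tendsto_intros) auto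
    then have "(\<lambda>n. (norm (fourier h x))\<^sup>2 * gauss (s n) x) \<longlonglongrightarrow> (norm (fourier h x))\<^sup>2 * 1"
      by (intro tendsto_mult tendsto_const) simp
    then show ?thesis by simp
  qed
  have bound: "(\<integral>\<^sup>+x. ennreal ((norm (fourier h x))\<^sup>2 * gauss (s n) x) \<partial>lborel) \<le> ennreal ?B" for n
  proof -
    have "integrable lborel (\<lambda>x. (norm (fourier h x))\<^sup>2 * gauss (s n) x)"
    proof (rule Bochner_Integration.integrable_bound)
      show "integrable lborel (\<lambda>x::'a. (LINT \<xi>|lborel. norm (h \<xi>))\<^sup>2 * gauss (s n) x)"
        by (intro integrable_mult_right integrable_gauss s_pos)
      show "AE x in lborel. norm ((norm (fourier h x))\<^sup>2 * gauss (s n) x)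
          \<le> norm ((LINT \<xi>|lborel. norm (h \<xi>))\<^sup>2 * gauss (s n) x)"
        by (auto simp: abs_mult intro!: mult_right_mono power_mono norm_fourier_le)
    qed measurable
    then show ?thesis
      using fourier_gauss_weighted [OF h h2 s_pos, of n]
      by (subst nn_integral_eq_integral) (auto intro: ennreal_leI)
  qed
  have "(\<integral>\<^sup>+x. ennreal ((norm (fourier h x))\<^sup>2) \<partial>lborel) =
      (\<integral>\<^sup>+x. liminf (\<lambda>n. ennreal ((norm (fourier h x))\<^sup>2 * gauss (s n) x)) \<partial>lborel)"
    using lim_imp_Liminf [OF _ lim] by simp
  also have "\<dots> \<le> liminf (\<lambda>n. \<integral>\<^sup>+x. ennreal ((norm (fourier h x))\<^sup>2 * gauss (s n) x) \<partial>lborel)"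
    by (rule nn_integral_liminf) measurable
  also have "\<dots> \<le> ennreal ?B"
    using bound by (intro Liminf_le) auto
  finally have *: "(\<integral>\<^sup>+x. ennreal ((norm (fourier h x))\<^sup>2) \<partial>lborel) \<le> ennreal ?B" .
  then show i: "integrable lborel (\<lambda>x. (norm (fourier h x))\<^sup>2)"
    by (intro integrableI_bounded) (auto simp: less_top [symmetric] top_unique)
  show "(LINT x|lborel. (norm (fourier h x))\<^sup>2) \<le> ?B"
    using * nn_integral_eq_integral [OF i] by simp
qed

section \<open>Band-limited functions and their real inverse Fourier integrals\<close>

definition band_limited :: "('a::euclidean_space \<Rightarrow> complex) \<Rightarrow> bool" where
  "band_limited h \<longleftrightarrow> h \<in> borel_measurable borel \<and>
    (\<exists>R. \<forall>\<xi>. norm \<xi> > R \<longrightarrow> h \<xi> = 0) \<and> (\<exists>B. \<forall>\<xi>. norm (h \<xi>) \<le> B)"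

text \<open>The real part makes \<open>synth h\<close> usable in test functions, which are real. As
  \<open>h\<close> ranges over complex functions, passing from h to i h exchanges real and imaginary
  parts up to sign. No continuity is asked of \<open>h\<close>, so sharp cuts in frequency stay
  within the class.\<close>

definition synth :: "('a::euclidean_space \<Rightarrow> complex) \<Rightarrow> 'a \<Rightarrow> real" where
  "synth h x = Re (fourier h x)"

lemma band_limited_measurable: "band_limited h \<Longrightarrow> h \<in> borel_measurable borel"
  by (simp add: band_limited_def)

lemma integrable_bounded_support:
  fixes h :: "'a::euclidean_space \<Rightarrow> 'b::{banach, second_countable_topology}"
  assumes "h \<in> borel_measurable borel" and R: "\<And>x. norm x > R \<Longrightarrow> h x = 0" and B: "\<And>x. norm (h x) \<le> B"
  shows "integrable lborel h"
proof -
  have "integrable lborel (\<lambda>x. indicator (cball (0::'a) R) x *\<^sub>R B)"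
    by (rule borel_integrable_compact) auto
  then show ?thesis
  proof (rule Bochner_Integration.integrable_bound)
    have "norm (h x) \<le> norm (indicator (cball (0::'a) R) x *\<^sub>R B)" for x
      using R [of x] B [of x] by (auto simp: indicator_def not_le intro: order_trans)
    then show "AE x in lborel. norm (h x) \<le> norm (indicator (cball (0::'a) R) x *\<^sub>R B)" by simp
  qed (use assms in simp)
qed

lemma
  assumes "band_limited h"
  shows band_limited_integrable: "integrable lborel h"
    and band_limited_square_integrable: "integrable lborel (\<lambda>\<xi>. (norm (h \<xi>))\<^sup>2)"
proof -
  obtain R B where [measurable]: "h \<in> borel_measurable borel"
    and R: "\<And>\<xi>. norm \<xi> > R \<Longrightarrow> h \<xi> = 0" and B: "\<And>\<xi>. norm (h \<xi>) \<le> B"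
    using assms unfolding band_limited_def by blast
  show "integrable lborel h" using R B by (intro integrable_bounded_support) auto
  have "(norm (h \<xi>))\<^sup>2 \<le> B\<^sup>2" for \<xi> using B [of \<xi>] by (rule power_mono) simp
  then show "integrable lborel (\<lambda>\<xi>. (norm (h \<xi>))\<^sup>2)"
    using R by (intro integrable_bounded_support [where R = R and B = "B\<^sup>2"]) auto
qed

lemma band_limited_mult:
  assumes h: "band_limited h" and [measurable]: "q \<in> borel_measurable borel"
    and q: "\<And>R. \<exists>B. \<forall>\<xi>. norm \<xi> \<le> R \<longrightarrow> norm (q \<xi>) \<le> B"
  shows "band_limited (\<lambda>\<xi>. q \<xi> * h \<xi>)"
proof -
  obtain R B where [measurable]: "h \<in> borel_measurable borel"
    and R: "\<And>\<xi>. norm \<xi> > R \<Longrightarrow> h \<xi> = 0" and B: "\<And>\<xi>. norm (h \<xi>) \<le> B"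
    using h unfolding band_limited_def by blast
  obtain Q where Q: "\<And>\<xi>. norm \<xi> \<le> R \<Longrightarrow> norm (q \<xi>) \<le> Q" using q by blast
  have "norm (q \<xi> * h \<xi>) \<le> \<bar>Q\<bar> * \<bar>B\<bar>" for \<xi>
  proof (cases "norm \<xi> \<le> R")
    case True
    then show ?thesis using Q [OF True] B [of \<xi>] by (auto simp: norm_mult intro!: mult_mono)
  qed (use R in auto)
  then show ?thesis unfolding band_limited_def using R by auto
qed

lemma band_limited_mult_continuous:
  assumes h: "band_limited h" and q: "continuous_on UNIV q"
  shows "band_limited (\<lambda>\<xi>. q \<xi> * h \<xi>)"
proof (rule band_limited_mult [OF h])
  show "q \<in> borel_measurable borel" using q by (rule borel_measurable_continuous_onI)
  fix R
  have "bounded (q ` cball 0 R)"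
    by (intro compact_imp_bounded compact_continuous_image continuous_on_subset [OF q]) auto
  then obtain B where "\<forall>y\<in>q ` cball 0 R. norm y \<le> B" unfolding bounded_iff by blast
  then show "\<exists>B. \<forall>\<xi>. norm \<xi> \<le> R \<longrightarrow> norm (q \<xi>) \<le> B"
    by (intro exI [of _ B]) auto
qed

lemma synth_add:
  assumes "integrable lborel g" "integrable lborel h"
  shows "synth (\<lambda>\<xi>. g \<xi> + h \<xi>) x = synth g x + synth h x"
  using integrable_cis_mult [OF assms(1)] integrable_cis_mult [OF assms(2)]
  by (simp add: synth_def fourier_def distrib_left)

lemma synth_scale: "synth (\<lambda>\<xi>. of_real c * h \<xi>) x = c * synth h x"
proof -
  have "fourier (\<lambda>\<xi>. of_real c * h \<xi>) x = (LINT \<xi>|lborel. of_real c * (cis (x \<bullet> \<xi>) * h \<xi>))"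
    unfolding fourier_def by (simp only: mult.left_commute)
  then have "fourier (\<lambda>\<xi>. of_real c * h \<xi>) x = of_real c * fourier h x"
    by (simp only: integral_mult_right_zero fourier_def)
  then show ?thesis by (simp add: synth_def)
qed

lemma synth_minus: "synth (\<lambda>\<xi>. - h \<xi>) x = - synth h x"
  using synth_scale [of "-1" h x] by simp

lemma synth_sum:
  assumes "\<And>i. i \<in> I \<Longrightarrow> integrable lborel (h i)"
  shows "synth (\<lambda>\<xi>. \<Sum>i\<in>I. h i \<xi>) x = (\<Sum>i\<in>I. synth (h i) x)"
  using assms
proof (induction I rule: infinite_finite_induct)
  case (insert i I)
  then show ?case by (simp add: synth_add)
qed (simp_all add: synth_def fourier_def)

lemma synth_bound: "\<bar>synth h x\<bar> \<le> (LINT \<xi>|lborel. norm (h \<xi>))"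
  unfolding synth_def by (rule order_trans [OF abs_Re_le_cmod norm_fourier_le])

lemma
  fixes h :: "'a::euclidean_space \<Rightarrow> complex"
  assumes h: "integrable lborel h" and h2: "integrable lborel (\<lambda>\<xi>. (norm (h \<xi>))\<^sup>2)"
  shows synth_Lp2: "Lp 2 (synth h)"
    and synth_Lp2_bound: "Lp_norm 2 (synth h) \<le> sqrt (2 * pi) ^ DIM('a) * Lp_norm 2 h"
proof -
  have [measurable]: "h \<in> borel_measurable borel" using h borel_measurable_integrable by fastforce
  note [measurable] = fourier_measurable [of h]
  have m: "synth h \<in> borel_measurable borel" unfolding synth_def [abs_def] by measurable
  have le: "(synth h x)\<^sup>2 \<le> (norm (fourier h x))\<^sup>2" for x
    using power_mono [OF abs_Re_le_cmod [of "fourier h x"], of 2] unfolding synth_def by simp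
  have i: "integrable lborel (\<lambda>x. (synth h x)\<^sup>2)"
    by (rule Bochner_Integration.integrable_bound [OF fourier_L2_integrable [OF h h2]]) (use m le in auto)
  then show "Lp 2 (synth h)" using m by (simp add: Lp_2_lborel)
  have "(LINT x|lborel. (synth h x)\<^sup>2) \<le> (LINT x|lborel. (norm (fourier h x))\<^sup>2)"
    by (rule integral_mono [OF i fourier_L2_integrable [OF h h2]]) (rule le)
  also have "\<dots> \<le> (2 * pi) ^ DIM('a) * (LINT \<xi>|lborel. (norm (h \<xi>))\<^sup>2)"
    by (rule fourier_L2_bound [OF h h2])
  finally have "sqrt (LINT x|lborel. (synth h x)\<^sup>2) \<le>
      sqrt ((2 * pi) ^ DIM('a) * (LINT \<xi>|lborel. (norm (h \<xi>))\<^sup>2))"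
    by (rule real_sqrt_le_mono)
  then show "Lp_norm 2 (synth h) \<le> sqrt (2 * pi) ^ DIM('a) * Lp_norm 2 h"
    using m by (simp add: Lp_2_lborel real_sqrt_mult real_sqrt_power power_mult_distrib)
qed

lemma norm_cis_taylor: "norm (cis (a + d) - cis a - \<i> * of_real d * cis a) \<le> d\<^sup>2 / 2"
proof -
  have "norm (cis d - (1 + \<i> * of_real d)) \<le> \<bar>d\<bar>\<^sup>2 / 2"
    using iexp_approx1 [of d 1] by (simp add: cis_conv_exp power2_eq_square)
  moreover have "cis (a + d) - cis a - \<i> * of_real d * cis a = cis a * (cis d - (1 + \<i> * of_real d))"
    by (simp add: cis_mult [symmetric] algebra_simps)
  ultimately show ?thesis by (simp add: norm_mult)
qed

text \<open>Bounded frequencies make |\<xi>|^2 |h| integrable, so the second-order Taylor bound for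
  \<open>cis\<close> integrates to a remainder quadratic in y - x. The derivative is again
  \<open>synth\<close> of a band-limited function, whence smoothness by coinduction.\<close>

lemma synth_has_derivative:
  assumes h: "band_limited h"
  shows "(synth h has_derivative (\<lambda>v. synth (\<lambda>\<xi>. \<i> * of_real (v \<bullet> \<xi>) * h \<xi>) x)) (at x)"
proof -
  have [measurable]: "h \<in> borel_measurable borel" using h by (rule band_limited_measurable)
  define d where "d v \<xi> = \<i> * of_real (v \<bullet> \<xi>) * h \<xi>" for v \<xi>
  have bd: "band_limited (d v)" for v
    unfolding d_def [abs_def] by (rule band_limited_mult_continuous [OF h]) (intro continuous_intros)
  note int_d = band_limited_integrable [OF bd]
  note int_h = band_limited_integrable [OF h]
  have "band_limited (\<lambda>\<xi>. of_real (norm \<xi>) * h \<xi>)" "band_limited (\<lambda>\<xi>. of_real ((norm \<xi>)\<^sup>2) * h \<xi>)"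
    by (rule band_limited_mult_continuous [OF h], intro continuous_intros)+
  note this [THEN band_limited_integrable, THEN integrable_norm]
  then have int_1: "integrable lborel (\<lambda>\<xi>. norm \<xi> * norm (h \<xi>))"
    and int_2: "integrable lborel (\<lambda>\<xi>. (norm \<xi>)\<^sup>2 * norm (h \<xi>))"
    by (simp_all add: norm_mult norm_power)
  show ?thesis
    unfolding d_def [symmetric]
  proof (rule has_derivativeI_sandwich [of 1])
    show "bounded_linear (\<lambda>v. synth (d v) x)"
    proof (rule bounded_linear_intro)
      show "synth (d (v + w)) x = synth (d v) x + synth (d w) x" for v w
        unfolding synth_add [OF int_d int_d, symmetric] by (simp add: d_def [abs_def] inner_add_left algebra_simps)
      show "synth (d (r *\<^sub>R v)) x = r *\<^sub>R synth (d v) x" for r v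
        unfolding real_scaleR_def synth_scale [symmetric] by (simp add: d_def [abs_def] algebra_simps)
      show "norm (synth (d v) x) \<le> norm v * (LINT \<xi>|lborel. norm \<xi> * norm (h \<xi>))" for v
      proof -
        have "norm (synth (d v) x) \<le> (LINT \<xi>|lborel. norm (d v \<xi>))" using synth_bound by simp
        also have "\<dots> \<le> (LINT \<xi>|lborel. norm v * (norm \<xi> * norm (h \<xi>)))"
        proof (rule integral_mono)
          show "integrable lborel (\<lambda>\<xi>. norm (d v \<xi>))" using int_d by (rule integrable_norm)
          show "integrable lborel (\<lambda>\<xi>. norm v * (norm \<xi> * norm (h \<xi>)))" using int_1 by simp
          show "norm (d v \<xi>) \<le> norm v * (norm \<xi> * norm (h \<xi>))" for \<xi>
            using Cauchy_Schwarz_ineq2 [of v \<xi>]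
            by (auto simp: d_def norm_mult mult.assoc [symmetric] intro!: mult_right_mono)
        qed
        finally show ?thesis by simp
      qed
    qed
  next
    fix y :: 'a assume "y \<noteq> x"
    have "synth h y - synth h x - synth (d (y - x)) x =
        Re (LINT \<xi>|lborel. cis (y \<bullet> \<xi>) * h \<xi> - cis (x \<bullet> \<xi>) * h \<xi> - cis (x \<bullet> \<xi>) * d (y - x) \<xi>)"
      using integrable_cis_mult [OF int_h] integrable_cis_mult [OF int_d]
      by (simp add: synth_def fourier_def)
    also have "norm \<dots> \<le> (LINT \<xi>|lborel. norm (cis (y \<bullet> \<xi>) * h \<xi> - cis (x \<bullet> \<xi>) * h \<xi> - cis (x \<bullet> \<xi>) * d (y - x) \<xi>))"
      unfolding real_norm_def by (rule order_trans [OF abs_Re_le_cmod integral_norm_bound])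
    also have "\<dots> \<le> (LINT \<xi>|lborel. (norm (y - x))\<^sup>2 * ((norm \<xi>)\<^sup>2 * norm (h \<xi>)))"
    proof (rule integral_mono)
      show "integrable lborel (\<lambda>\<xi>. norm (cis (y \<bullet> \<xi>) * h \<xi> - cis (x \<bullet> \<xi>) * h \<xi> - cis (x \<bullet> \<xi>) * d (y - x) \<xi>))"
        using integrable_cis_mult [OF int_h] integrable_cis_mult [OF int_d] by simp
      show "integrable lborel (\<lambda>\<xi>. (norm (y - x))\<^sup>2 * ((norm \<xi>)\<^sup>2 * norm (h \<xi>)))" using int_2 by simp
      fix \<xi>
      let ?r = "(y - x) \<bullet> \<xi>"
      have "cis (y \<bullet> \<xi>) * h \<xi> - cis (x \<bullet> \<xi>) * h \<xi> - cis (x \<bullet> \<xi>) * d (y - x) \<xi> =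
          (cis (x \<bullet> \<xi> + ?r) - cis (x \<bullet> \<xi>) - \<i> * of_real ?r * cis (x \<bullet> \<xi>)) * h \<xi>"
        by (simp add: d_def inner_diff_left algebra_simps)
      moreover have "?r\<^sup>2 / 2 \<le> (norm (y - x))\<^sup>2 * (norm \<xi>)\<^sup>2"
      proof -
        have "?r\<^sup>2 \<le> (norm (y - x) * norm \<xi>)\<^sup>2"
          using power_mono [OF Cauchy_Schwarz_ineq2 [of "y - x" \<xi>], of 2] by simp
        moreover have "0 \<le> ?r\<^sup>2" by simp
        ultimately show ?thesis unfolding power_mult_distrib by linarith
      qed
      ultimately show "norm (cis (y \<bullet> \<xi>) * h \<xi> - cis (x \<bullet> \<xi>) * h \<xi> - cis (x \<bullet> \<xi>) * d (y - x) \<xi>)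
          \<le> (norm (y - x))\<^sup>2 * ((norm \<xi>)\<^sup>2 * norm (h \<xi>))"
        using norm_cis_taylor [of "x \<bullet> \<xi>" ?r]
        by (auto simp: norm_mult mult.assoc [symmetric] intro!: mult_right_mono)
    qed
    finally have "norm (synth h y - synth h x - synth (d (y - x)) x)
        \<le> (norm (y - x) * (LINT \<xi>|lborel. (norm \<xi>)\<^sup>2 * norm (h \<xi>))) * norm (y - x)"
      by (simp only: integral_mult_right_zero)
        (simp only: power2_eq_square [of "norm (y - x)"] mult_ac)
    then show "norm (synth h y - synth h x - synth (d (y - x)) x) / norm (y - x)
        \<le> norm (y - x) * (LINT \<xi>|lborel. (norm \<xi>)\<^sup>2 * norm (h \<xi>))"
      using \<open>y \<noteq> x\<close> by (subst pos_divide_le_eq) auto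
  next
    have "((\<lambda>y. norm (y - x) * (LINT \<xi>|lborel. (norm \<xi>)\<^sup>2 * norm (h \<xi>))) \<longlongrightarrow>
        norm (x - x) * (LINT \<xi>|lborel. (norm \<xi>)\<^sup>2 * norm (h \<xi>))) (at x)"
      by (intro tendsto_intros)
    then show "((\<lambda>y. norm (y - x) * (LINT \<xi>|lborel. (norm \<xi>)\<^sup>2 * norm (h \<xi>))) \<longlongrightarrow> 0) (at x)" by simp
  qed simp
qed

lemma dir_deriv_synth:
  "band_limited h \<Longrightarrow> dir_deriv v (synth h) = synth (\<lambda>\<xi>. \<i> * of_real (v \<bullet> \<xi>) * h \<xi>)"
  by (intro ext dir_deriv_eqI synth_has_derivative)

lemma band_limited_dir: "band_limited h \<Longrightarrow> band_limited (\<lambda>\<xi>. \<i> * of_real (v \<bullet> \<xi>) * h \<xi>)"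
  by (rule band_limited_mult_continuous) (assumption, intro continuous_intros)

lemma smooth_synth:
  assumes "band_limited h" shows "smooth (synth h)"
proof (rule smooth_coinduct [where S = "\<lambda>g. \<exists>h. band_limited h \<and> g = synth h"])
  show "\<exists>h'. band_limited h' \<and> synth h = synth h'" using assms by blast
next
  fix g :: "'a \<Rightarrow> real" and x v assume "\<exists>h. band_limited h \<and> g = synth h"
  then obtain h where h: "band_limited h" "g = synth h" by blast
  then show "g differentiable (at x)" using synth_has_derivative differentiableI by blast
  show "\<exists>h. band_limited h \<and> dir_deriv v g = synth h"
    using band_limited_dir [OF h(1)] dir_deriv_synth [OF h(1)] h(2) by blast
qed

section \<open>Gaussian mollification as an inverse Fourier integral\<close>

lemma lborel_integral_affine:
  fixes f :: "'a::euclidean_space \<Rightarrow> 'b::{banach, second_countable_topology}"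
  assumes [measurable]: "f \<in> borel_measurable borel" and c: "c \<noteq> 0"
  shows "(LINT y|lborel. f y) = \<bar>c\<bar> ^ DIM('a) *\<^sub>R (LINT w|lborel. f (x + c *\<^sub>R w))"
proof -
  have "(LINT y|lborel. f y) =
      (LINT y|density (distr lborel borel (\<lambda>w. x + c *\<^sub>R w)) (\<lambda>_. ennreal (\<bar>c\<bar> ^ DIM('a))). f y)"
    using lborel_affine [OF c, of x] by (simp add: ennreal_power)
  also have "\<dots> = (LINT w|lborel. \<bar>c\<bar> ^ DIM('a) *\<^sub>R f (x + c *\<^sub>R w))"
    by (subst integral_density) (auto simp: integral_distr)
  finally show ?thesis by simp
qed

definition mollified :: "('a::euclidean_space \<Rightarrow> real) \<Rightarrow> real \<Rightarrow> 'a \<Rightarrow> real" where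
  "mollified \<phi> \<delta> x = (LINT w|lborel. \<phi> (x - \<delta> *\<^sub>R w) * gauss 1 w) / sqrt (2 * pi) ^ DIM('a)"

text \<open>The Fourier transform of the mollification at scale \<delta>, including the factor (2
  \<pi>)^(-n) of the inversion formula. The argument - \<xi> turns \<open>fourier\<close> into the
  forward transform.\<close>

definition spectrum :: "('a::euclidean_space \<Rightarrow> real) \<Rightarrow> real \<Rightarrow> 'a \<Rightarrow> complex" where
  "spectrum \<phi> \<delta> \<xi> =
    of_real (gauss (\<delta>\<^sup>2) \<xi> / (2 * pi) ^ DIM('a)) * fourier (\<lambda>y. of_real (\<phi> y)) (- \<xi>)"

text \<open>Fourier inversion in a case where Fubini suffices: the Gaussian factor makes the double
  integral absolutely convergent, and the integral over frequencies is an explicit Gaussian in x -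
  y.\<close>

lemma synth_spectrum:
  fixes \<phi> :: "'a::euclidean_space \<Rightarrow> real"
  assumes \<phi>: "integrable lborel \<phi>" and \<delta>: "\<delta> > 0"
  shows "synth (spectrum \<phi> \<delta>) x = mollified \<phi> \<delta> x"
proof -
  have [measurable]: "\<phi> \<in> borel_measurable borel" using \<phi> borel_measurable_integrable by fastforce
  let ?n = "DIM('a)"
  have s: "\<delta>\<^sup>2 > 0" using \<delta> by simp
  have "fourier (spectrum \<phi> \<delta>) x = (LINT \<xi>|lborel. LINT y|lborel.
      of_real (gauss (\<delta>\<^sup>2) \<xi> / (2 * pi) ^ ?n) * cis (x \<bullet> \<xi>) * (cis (- \<xi> \<bullet> y) * of_real (\<phi> y)))"
    unfolding fourier_def spectrum_def integral_mult_right_zero by (simp only: mult_ac)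
  also have "\<dots> = (LINT y|lborel. LINT \<xi>|lborel.
      of_real (gauss (\<delta>\<^sup>2) \<xi> / (2 * pi) ^ ?n) * cis (x \<bullet> \<xi>) * (cis (- \<xi> \<bullet> y) * of_real (\<phi> y)))"
  proof (rule lborel_pair.Fubini_integral [symmetric])
    have "integrable (lborel \<Otimes>\<^sub>M lborel) (\<lambda>(\<xi>::'a, y). gauss (\<delta>\<^sup>2) \<xi> / (2 * pi) ^ ?n * norm (\<phi> y))"
      using s \<phi> by (intro integrable_lborel_pair_mult integrable_divide integrable_gauss) auto
    then show "integrable (lborel \<Otimes>\<^sub>M lborel) (\<lambda>(\<xi>, y).
        of_real (gauss (\<delta>\<^sup>2) \<xi> / (2 * pi) ^ ?n) * cis (x \<bullet> \<xi>) * (cis (- \<xi> \<bullet> y) * of_real (\<phi> y)))"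
      by (rule Bochner_Integration.integrable_bound)
        (auto simp: norm_mult norm_divide norm_power abs_mult)
  qed
  also have "\<dots> = (LINT y|lborel. of_real (\<phi> y * gauss (1 / \<delta>\<^sup>2) (x - y) / (sqrt (2 * pi) * \<delta>) ^ ?n))"
  proof (rule Bochner_Integration.integral_cong [OF refl])
    fix y
    have "of_real (gauss (\<delta>\<^sup>2) \<xi> / (2 * pi) ^ ?n) * cis (x \<bullet> \<xi>) * (cis (- \<xi> \<bullet> y) * of_real (\<phi> y)) =
        of_real (\<phi> y / (2 * pi) ^ ?n) * (cis (\<xi> \<bullet> (x - y)) * of_real (gauss (\<delta>\<^sup>2) \<xi>))" for \<xi>
    proof -
      have "cis (x \<bullet> \<xi>) * cis (- \<xi> \<bullet> y) = cis (\<xi> \<bullet> (x - y))"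
        by (simp add: cis_mult inner_diff_right inner_commute)
      moreover have "g * c * (d * p) = g * p * (c * d)" for g c d p :: complex by (simp only: mult_ac)
      ultimately have "of_real (gauss (\<delta>\<^sup>2) \<xi> / (2 * pi) ^ ?n) * cis (x \<bullet> \<xi>) * (cis (- \<xi> \<bullet> y) * of_real (\<phi> y)) =
          of_real (gauss (\<delta>\<^sup>2) \<xi> / (2 * pi) ^ ?n) * of_real (\<phi> y) * cis (\<xi> \<bullet> (x - y))"
        by metis
      then show ?thesis by simp
    qed
    then have "(LINT \<xi>|lborel. of_real (gauss (\<delta>\<^sup>2) \<xi> / (2 * pi) ^ ?n) * cis (x \<bullet> \<xi>) * (cis (- \<xi> \<bullet> y) * of_real (\<phi> y))) =
        of_real (\<phi> y / (2 * pi) ^ ?n) * of_real (sqrt (2 * pi / \<delta>\<^sup>2) ^ ?n * gauss (1 / \<delta>\<^sup>2) (x - y))"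
      by (simp only: integral_mult_right_zero gaussian_integral(2) [OF s])
    also have "\<dots> = of_real (\<phi> y * gauss (1 / \<delta>\<^sup>2) (x - y) * (sqrt (2 * pi / \<delta>\<^sup>2) / (2 * pi)) ^ ?n)"
      by (simp add: power_divide)
    also have "sqrt (2 * pi / \<delta>\<^sup>2) / (2 * pi) = 1 / (sqrt (2 * pi) * \<delta>)"
    proof -
      have "2 * pi = sqrt (2 * pi) * sqrt (2 * pi)" by simp
      then show ?thesis using \<delta> by (simp add: real_sqrt_divide field_simps del: real_sqrt_mult_self)
    qed
    finally show "(LINT \<xi>|lborel. of_real (gauss (\<delta>\<^sup>2) \<xi> / (2 * pi) ^ ?n) * cis (x \<bullet> \<xi>) * (cis (- \<xi> \<bullet> y) * of_real (\<phi> y))) =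
        of_real (\<phi> y * gauss (1 / \<delta>\<^sup>2) (x - y) / (sqrt (2 * pi) * \<delta>) ^ ?n)"
      by (simp add: power_divide)
  qed
  also have "\<dots> = of_real (LINT y|lborel. \<phi> y * gauss (1 / \<delta>\<^sup>2) (x - y) / (sqrt (2 * pi) * \<delta>) ^ ?n)"
    by (rule integral_complex_of_real)
  finally have "synth (spectrum \<phi> \<delta>) x = (LINT y|lborel. \<phi> y * gauss (1 / \<delta>\<^sup>2) (x - y) / (sqrt (2 * pi) * \<delta>) ^ ?n)"
    by (simp add: synth_def)
  also have "\<dots> = \<delta> ^ ?n * (LINT w|lborel. \<phi> (x - \<delta> *\<^sub>R w) * gauss (1 / \<delta>\<^sup>2) (\<delta> *\<^sub>R w) / (sqrt (2 * pi) * \<delta>) ^ ?n)"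
    using \<delta> by (subst lborel_integral_affine [of _ "- \<delta>" x]) auto
  also have "(\<lambda>w. gauss (1 / \<delta>\<^sup>2) (\<delta> *\<^sub>R w)) = (gauss 1 :: 'a \<Rightarrow> real)"
    using \<delta> by (auto simp: gauss_def power_mult_distrib)
  finally show ?thesis using \<delta> by (simp add: mollified_def power_mult_distrib) 
qed


lemma mollified_tendsto:
  fixes \<phi> :: "'a::euclidean_space \<Rightarrow> real"
  assumes cont: "continuous_on UNIV \<phi>" and M: "\<And>x. \<bar>\<phi> x\<bar> \<le> M" and \<delta>: "\<delta> \<longlonglongrightarrow> 0"
  shows "(\<lambda>k. mollified \<phi> (\<delta> k) x) \<longlonglongrightarrow> \<phi> x"
proof -
  have [measurable]: "\<phi> \<in> borel_measurable borel" using cont by (rule borel_measurable_continuous_onI)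
  have "(\<lambda>k. LINT w|lborel. \<phi> (x - \<delta> k *\<^sub>R w) * gauss 1 w) \<longlonglongrightarrow> (LINT w::'a|lborel. \<phi> x * gauss 1 w)"
  proof (rule integral_dominated_convergence)
    show "integrable lborel (\<lambda>w::'a. M * gauss 1 w)" by (simp add: integrable_gauss)
    show "AE w in lborel. (\<lambda>k. \<phi> (x - \<delta> k *\<^sub>R w) * gauss 1 w) \<longlonglongrightarrow> \<phi> x * gauss 1 w"
    proof (intro AE_I2 tendsto_mult tendsto_const)
      fix w
      have "(\<lambda>k. x - \<delta> k *\<^sub>R w) \<longlonglongrightarrow> x - 0 *\<^sub>R w" by (intro tendsto_intros \<delta>)
      then show "(\<lambda>k. \<phi> (x - \<delta> k *\<^sub>R w)) \<longlonglongrightarrow> \<phi> x"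
        using cont continuous_on_tendsto_compose [of UNIV \<phi>] by auto
    qed
    show "AE w in lborel. norm (\<phi> (x - \<delta> k *\<^sub>R w) * gauss 1 w) \<le> M * gauss 1 w" for k
      using M by (auto simp: abs_mult intro!: mult_right_mono)
  qed measurable
  then have "(\<lambda>k. (LINT w|lborel. \<phi> (x - \<delta> k *\<^sub>R w) * gauss 1 w) / sqrt (2 * pi) ^ DIM('a)) \<longlonglongrightarrow>
      (LINT w::'a|lborel. \<phi> x * gauss 1 w) / sqrt (2 * pi) ^ DIM('a)"
    by (intro tendsto_divide tendsto_const) auto
  then show ?thesis unfolding mollified_def by (simp add: integral_gauss)
qed

text \<open>A Gaussian majorant uniform in \<delta>. Where the integrand is not zero, |x| \<le> R +
  |w|, hence |x|^2 \<le> 2 R^2 + 2 |w|^2. Half of the exponent of \<open>gauss 1 w\<close> is spent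
  on decay in x through this inequality, and the other half keeps the integral over w
  finite.\<close>

lemma mollified_bound:
  fixes \<phi> :: "'a::euclidean_space \<Rightarrow> real"
  assumes [measurable]: "\<phi> \<in> borel_measurable borel"
    and M: "\<And>x. \<bar>\<phi> x\<bar> \<le> M" and R: "\<And>x. norm x > R \<Longrightarrow> \<phi> x = 0" and "R \<ge> 0"
    and \<delta>: "0 \<le> \<delta>" "\<delta> \<le> 1"
  shows "\<bar>mollified \<phi> \<delta> x\<bar> \<le> M * exp (R\<^sup>2 / 4) * (LINT w::'a|lborel. gauss (1/2) w) * gauss (1/4) x"
proof -
  have M0: "0 \<le> M" using M [of 0] by linarith
  have le: "\<bar>\<phi> (x - \<delta> *\<^sub>R w) * gauss 1 w\<bar> \<le> M * exp (R\<^sup>2 / 4) * gauss (1/4) x * gauss (1/2) w" for w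
  proof (cases "norm (x - \<delta> *\<^sub>R w) > R")
    case True
    then show ?thesis using R M0 by simp
  next
    case False
    have "norm x \<le> norm (x - \<delta> *\<^sub>R w) + norm (\<delta> *\<^sub>R w)" 
      using norm_triangle_sub [of x "\<delta> *\<^sub>R w"] by (simp add: add.commute)
    also have "\<dots> \<le> R + norm w" using False \<delta> by (intro add_mono) (auto simp: mult_left_le_one_le)
    finally have "(norm x)\<^sup>2 \<le> (R + norm w)\<^sup>2" by (rule power_mono) simp
    also have "\<dots> \<le> 2 * R\<^sup>2 + 2 * (norm w)\<^sup>2"
      using zero_le_power2 [of "R - norm w"] by (simp add: power2_sum power2_diff)
    finally have "gauss 1 w \<le> exp (R\<^sup>2 / 4 + - (1/4) * (norm x)\<^sup>2 / 2 + - (1/2) * (norm w)\<^sup>2 / 2)"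
      by (simp add: gauss_def)
    also have "\<dots> = exp (R\<^sup>2 / 4) * gauss (1/4) x * gauss (1/2) w"
      by (simp only: exp_add gauss_def)
    finally show ?thesis
      using M [of "x - \<delta> *\<^sub>R w"] M0 by (simp add: abs_mult mult.assoc mult_mono)
  qed
  have i: "integrable lborel (\<lambda>w::'a. M * exp (R\<^sup>2 / 4) * gauss (1/4) x * gauss (1/2) w)"
    by (simp add: integrable_gauss)
  have "\<bar>LINT w|lborel. \<phi> (x - \<delta> *\<^sub>R w) * gauss 1 w\<bar> \<le> (LINT w::'a|lborel. M * exp (R\<^sup>2 / 4) * gauss (1/4) x * gauss (1/2) w)"
  proof -
    have j: "integrable lborel (\<lambda>w. \<phi> (x - \<delta> *\<^sub>R w) * gauss 1 w)"
      by (rule Bochner_Integration.integrable_bound [OF i])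
        (use le in \<open>auto intro!: AE_I2 order_trans [OF _ abs_ge_self]\<close>)
    have "\<bar>LINT w|lborel. \<phi> (x - \<delta> *\<^sub>R w) * gauss 1 w\<bar> \<le> (LINT w|lborel. \<bar>\<phi> (x - \<delta> *\<^sub>R w) * gauss 1 w\<bar>)"
      by (rule integral_abs_bound)
    also have "\<dots> \<le> (LINT w::'a|lborel. M * exp (R\<^sup>2 / 4) * gauss (1/4) x * gauss (1/2) w)"
      by (rule integral_mono [OF integrable_abs [OF j] i le])
    finally show ?thesis .
  qed
  also have "\<dots> = M * exp (R\<^sup>2 / 4) * (LINT w::'a|lborel. gauss (1/2) w) * gauss (1/4) x" by simp
  finally have *: "\<bar>LINT w|lborel. \<phi> (x - \<delta> *\<^sub>R w) * gauss 1 w\<bar> \<le>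
    M * exp (R\<^sup>2 / 4) * (LINT w::'a|lborel. gauss (1/2) w) * gauss (1/4) x" .
  have "1 \<le> sqrt (2 * pi) ^ DIM('a)" using pi_gt3 by (intro one_le_power) simp
  then have "\<bar>mollified \<phi> \<delta> x\<bar> \<le> \<bar>LINT w|lborel. \<phi> (x - \<delta> *\<^sub>R w) * gauss 1 w\<bar>"
    unfolding mollified_def abs_divide by (simp add: divide_le_eq mult_left_le_one_le mult_le_cancel_left1)
  with * show ?thesis by linarith
qed

text \<open>For the L^2 bound the Gaussian factor is estimated by 1. The half of Plancherel's
  theorem costs (2 \<pi>)^n in the square, while the normalisation contributes (2 \<pi>)^(-2n); the
  surplus is discarded, so passing to the spectrum does not increase the norm.\<close>

lemma
  fixes \<phi> :: "'a::euclidean_space \<Rightarrow> real"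
  assumes \<phi>: "integrable lborel \<phi>" and \<phi>2: "integrable lborel (\<lambda>x. (\<phi> x)\<^sup>2)" and \<delta>: "\<delta> > 0"
  shows spectrum_measurable: "spectrum \<phi> \<delta> \<in> borel_measurable borel"
    and spectrum_bounded: "norm (spectrum \<phi> \<delta> \<xi>) \<le> (LINT y|lborel. \<bar>\<phi> y\<bar>)"
    and spectrum_integrable: "integrable lborel (spectrum \<phi> \<delta>)"
    and spectrum_L2_integrable: "integrable lborel (\<lambda>\<xi>. (norm (spectrum \<phi> \<delta> \<xi>))\<^sup>2)"
    and spectrum_L2_le: "(LINT \<xi>|lborel. (norm (spectrum \<phi> \<delta> \<xi>))\<^sup>2) \<le> (LINT x|lborel. (\<phi> x)\<^sup>2)"
proof -
  have [measurable]: "\<phi> \<in> borel_measurable borel" using \<phi> borel_measurable_integrable by fastforce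
  let ?F = "fourier (\<lambda>y. complex_of_real (\<phi> y))"
  let ?c = "(2 * pi) ^ DIM('a)"
  have c: "1 \<le> ?c" using pi_gt3 by (intro one_le_power) simp
  have s: "\<delta>\<^sup>2 > 0" using \<delta> by simp
  have [measurable]: "?F \<in> borel_measurable borel" by (rule fourier_measurable) measurable
  show m [measurable]: "spectrum \<phi> \<delta> \<in> borel_measurable borel"
    unfolding spectrum_def [abs_def] by measurable
  have F: "norm (?F \<xi>) \<le> (LINT y|lborel. \<bar>\<phi> y\<bar>)" for \<xi>
    using norm_fourier_le [of "\<lambda>y. complex_of_real (\<phi> y)" \<xi>] by simp
  have N: "norm (spectrum \<phi> \<delta> \<xi>) = gauss (\<delta>\<^sup>2) \<xi> / ?c * norm (?F (- \<xi>))" for \<xi>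
    by (simp add: spectrum_def norm_mult norm_divide norm_power)
  have g: "gauss (\<delta>\<^sup>2) \<xi> / ?c \<le> gauss (\<delta>\<^sup>2) \<xi>" "gauss (\<delta>\<^sup>2) \<xi> / ?c \<le> 1 / ?c" "0 \<le> gauss (\<delta>\<^sup>2) \<xi> / ?c" for \<xi> :: 'a
    using c gauss_le_1 [of "\<delta>\<^sup>2" \<xi>] divide_left_mono [of 1 ?c "gauss (\<delta>\<^sup>2) \<xi>"]
    by (simp_all add: divide_right_mono)
  have I0: "0 \<le> (LINT y|lborel. \<bar>\<phi> y\<bar>)" by simp
  have le: "norm (spectrum \<phi> \<delta> \<xi>) \<le> gauss (\<delta>\<^sup>2) \<xi> * (LINT y|lborel. \<bar>\<phi> y\<bar>)" for \<xi>
    unfolding N using g [of \<xi>] F by (intro mult_mono) auto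
  also have "gauss (\<delta>\<^sup>2) \<xi> * (LINT y|lborel. \<bar>\<phi> y\<bar>) \<le> 1 * (LINT y|lborel. \<bar>\<phi> y\<bar>)" for \<xi>
    using gauss_le_1 [of "\<delta>\<^sup>2" \<xi>] I0 by (intro mult_right_mono) auto
  finally show "norm (spectrum \<phi> \<delta> \<xi>) \<le> (LINT y|lborel. \<bar>\<phi> y\<bar>)" for \<xi> by simp
  have ig: "integrable lborel (\<lambda>\<xi>::'a. gauss (\<delta>\<^sup>2) \<xi> * (LINT y|lborel. \<bar>\<phi> y\<bar>))"
    using integrable_gauss [OF s] by (rule integrable_mult_left)
  show "integrable lborel (spectrum \<phi> \<delta>)"
    by (rule Bochner_Integration.integrable_bound [OF ig])
      (use le m in \<open>auto intro!: AE_I2 order_trans [OF _ abs_ge_self]\<close>)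
  have i1: "integrable lborel (\<lambda>y. complex_of_real (\<phi> y))" using \<phi> by simp
  have i2: "integrable lborel (\<lambda>y. (norm (complex_of_real (\<phi> y)))\<^sup>2)" using \<phi>2 by simp
  note FL = fourier_L2_integrable [OF i1 i2] fourier_L2_bound [OF i1 i2]
  have refl: "(LINT \<xi>|lborel. (norm (?F (- \<xi>)))\<^sup>2) = (LINT \<xi>|lborel. (norm (?F \<xi>))\<^sup>2)"
    using lborel_integral_affine [of "\<lambda>\<xi>. (norm (?F \<xi>))\<^sup>2" "-1" 0] by simp
  have irefl: "integrable lborel (\<lambda>\<xi>. (norm (?F (- \<xi>)))\<^sup>2)"
  proof (rule integrableI_bounded)
    have "(\<integral>\<^sup>+\<xi>. ennreal (norm ((norm (?F (- \<xi>)))\<^sup>2)) \<partial>lborel) = (\<integral>\<^sup>+\<xi>. ennreal (norm ((norm (?F \<xi>))\<^sup>2)) \<partial>lborel)"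
      using nn_integral_lborel_minus [of "\<lambda>\<xi>. ennreal (norm ((norm (?F \<xi>))\<^sup>2))" 0] by simp
    then show "(\<integral>\<^sup>+\<xi>. ennreal (norm ((norm (?F (- \<xi>)))\<^sup>2)) \<partial>lborel) < \<infinity>"
      using FL(1) by (simp add: integrable_iff_bounded)
  qed measurable
  have le2: "(norm (spectrum \<phi> \<delta> \<xi>))\<^sup>2 \<le> (1 / ?c)\<^sup>2 * (norm (?F (- \<xi>)))\<^sup>2" for \<xi>
    unfolding N power_mult_distrib using g [of \<xi>] by (intro mult_right_mono power_mono) auto
  have i3: "integrable lborel (\<lambda>\<xi>. (1 / ?c)\<^sup>2 * (norm (?F (- \<xi>)))\<^sup>2)" using irefl by (rule integrable_mult_right)
  show i4: "integrable lborel (\<lambda>\<xi>. (norm (spectrum \<phi> \<delta> \<xi>))\<^sup>2)"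
    by (rule Bochner_Integration.integrable_bound [OF i3])
      (use le2 in \<open>auto intro!: AE_I2 order_trans [OF _ abs_ge_self]\<close>)
  have "(LINT \<xi>|lborel. (norm (spectrum \<phi> \<delta> \<xi>))\<^sup>2) \<le> (LINT \<xi>|lborel. (1 / ?c)\<^sup>2 * (norm (?F (- \<xi>)))\<^sup>2)"
    by (rule integral_mono [OF i4 i3 le2])
  also have "\<dots> = (1 / ?c)\<^sup>2 * (LINT \<xi>|lborel. (norm (?F \<xi>))\<^sup>2)" using refl by simp
  also have "\<dots> \<le> (1 / ?c)\<^sup>2 * (?c * (LINT x|lborel. (\<phi> x)\<^sup>2))"
    using FL(2) by (intro mult_left_mono) auto
  also have "\<dots> = (1 / ?c) * (LINT x|lborel. (\<phi> x)\<^sup>2)" by (simp add: power2_eq_square)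
  also have "\<dots> \<le> 1 * (LINT x|lborel. (\<phi> x)\<^sup>2)"
    using c by (intro mult_right_mono) auto
  finally show "(LINT \<xi>|lborel. (norm (spectrum \<phi> \<delta> \<xi>))\<^sup>2) \<le> (LINT x|lborel. (\<phi> x)\<^sup>2)" by simp
qed

section \<open>Duality with band-limited functions\<close>

lemma Lp_2_gauss: "s > 0 \<Longrightarrow> Lp 2 (gauss s :: 'a::euclidean_space \<Rightarrow> real)"
proof -
  assume s: "s > 0"
  have "(gauss s x)\<^sup>2 = gauss (2 * s) x" for x :: 'a
    by (simp add: gauss_def flip: exp_double)
  then show ?thesis using integrable_gauss [of "2 * s"] s by (simp add: Lp_2_lborel)
qed

text \<open>The spectrum of a mollified function decays but is not compactly supported; it is truncated to
  balls of growing radius.\<close>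

lemma synth_spectrum_pairing:
  fixes f \<phi> :: "'a::euclidean_space \<Rightarrow> real"
  assumes f: "Lp 2 f" and A: "0 \<le> A"
    and bound: "\<And>h. band_limited h \<Longrightarrow> \<bar>LINT x|lebesgue. synth h x * f x\<bar> \<le> A * Lp_norm 2 h"
    and \<phi>: "integrable lborel \<phi>" and \<phi>2: "integrable lborel (\<lambda>x. (\<phi> x)\<^sup>2)" and \<delta>: "\<delta> > 0"
  shows "\<bar>LINT x|lebesgue. synth (spectrum \<phi> \<delta>) x * f x\<bar> \<le> A * Lp_norm 2 \<phi>"
proof -
  let ?h = "spectrum \<phi> \<delta>"
  note sp = spectrum_measurable [OF \<phi> \<phi>2 \<delta>] spectrum_bounded [OF \<phi> \<phi>2 \<delta>]
    spectrum_integrable [OF \<phi> \<phi>2 \<delta>] spectrum_L2_integrable [OF \<phi> \<phi>2 \<delta>] spectrum_L2_le [OF \<phi> \<phi>2 \<delta>]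
  have [measurable]: "\<phi> \<in> borel_measurable borel" using \<phi> borel_measurable_integrable by fastforce
  note [measurable] = sp(1)
  define h where "h N \<xi> = (if norm \<xi> \<le> real N then ?h \<xi> else 0)" for N \<xi>
  define g where "g N \<xi> = (if norm \<xi> \<le> real N then 0 else ?h \<xi>)" for N \<xi>
  have [measurable]: "h N \<in> borel_measurable borel" "g N \<in> borel_measurable borel" for N
    unfolding h_def [abs_def] g_def [abs_def] by measurable
  have split: "?h = (\<lambda>\<xi>. h N \<xi> + g N \<xi>)" for N by (auto simp: h_def g_def)
  have bl: "band_limited (h N)" for N
    unfolding band_limited_def
  proof (intro conjI exI allI impI)
    show "norm (h N \<xi>) \<le> (LINT y|lborel. \<bar>\<phi> y\<bar>)" for \<xi>
      using sp(2) by (simp add: h_def)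
    show "h N \<xi> = 0" if "norm \<xi> > real N" for \<xi> using that by (simp add: h_def)
  qed measurable
  have ig: "integrable lborel (g N)" for N
    by (rule Bochner_Integration.integrable_bound [OF sp(3)]) (auto simp: g_def)
  have ig2: "integrable lborel (\<lambda>\<xi>. (norm (g N \<xi>))\<^sup>2)" for N
    by (rule Bochner_Integration.integrable_bound [OF sp(4)]) (auto simp: g_def)
  have hN: "Lp_norm 2 (h N) \<le> Lp_norm 2 \<phi>" for N
  proof -
    have "(LINT \<xi>|lborel. (norm (h N \<xi>))\<^sup>2) \<le> (LINT \<xi>|lborel. (norm (?h \<xi>))\<^sup>2)"
      by (rule integral_mono [OF band_limited_square_integrable [OF bl] sp(4)]) (auto simp: h_def)
    also note sp(5)
    finally show ?thesis by (simp add: Lp_2_lborel)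
  qed
  have "(\<lambda>N. LINT \<xi>|lborel. (norm (g N \<xi>))\<^sup>2) \<longlonglongrightarrow> (LINT \<xi>::'a|lborel. 0)"
  proof (rule integral_dominated_convergence [OF _ _ sp(4)])
    show "AE \<xi> in lborel. (\<lambda>N. (norm (g N \<xi>))\<^sup>2) \<longlonglongrightarrow> 0"
    proof (intro AE_I2)
      fix \<xi> :: 'a
      obtain N0 where "norm \<xi> \<le> real N0" using real_arch_simple by blast
      then have "\<forall>N\<ge>N0. (norm (g N \<xi>))\<^sup>2 = 0" by (auto simp: g_def)
      then show "(\<lambda>N. (norm (g N \<xi>))\<^sup>2) \<longlonglongrightarrow> 0"
        by (intro tendsto_eventually) (auto simp: eventually_sequentially)
    qed
  qed (auto simp: g_def)
  then have "(\<lambda>N. sqrt (LINT \<xi>|lborel. (norm (g N \<xi>))\<^sup>2)) \<longlonglongrightarrow> sqrt 0"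
    by (intro tendsto_real_sqrt) simp
  then have g0: "(\<lambda>N. Lp_norm 2 (g N)) \<longlonglongrightarrow> 0" by (simp add: Lp_2_lborel)
  let ?I = "\<bar>LINT x|lebesgue. synth ?h x * f x\<bar>" and ?c = "sqrt (2 * pi) ^ DIM('a)"
  have le: "?I \<le> A * Lp_norm 2 \<phi> + ?c * Lp_norm 2 (g N) * Lp_norm 2 f" for N
  proof -
    have h2: "Lp 2 (synth (h N))"
      by (intro synth_Lp2 band_limited_integrable band_limited_square_integrable bl)
    have g2: "Lp 2 (synth (g N))" by (intro synth_Lp2 ig ig2)
    have "(LINT x|lebesgue. synth ?h x * f x) = (LINT x|lebesgue. synth (h N) x * f x + synth (g N) x * f x)"
      by (subst split [of N], subst synth_add [OF band_limited_integrable [OF bl] ig])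
        (simp add: distrib_right)
    also have "\<dots> = (LINT x|lebesgue. synth (h N) x * f x) + (LINT x|lebesgue. synth (g N) x * f x)"
      using Lp_2_Cauchy_Schwarz(1) [OF h2 f] Lp_2_Cauchy_Schwarz(1) [OF g2 f] by simp
    finally have "?I \<le> \<bar>LINT x|lebesgue. synth (h N) x * f x\<bar> + \<bar>LINT x|lebesgue. synth (g N) x * f x\<bar>"
      by simp
    moreover have "\<bar>LINT x|lebesgue. synth (h N) x * f x\<bar> \<le> A * Lp_norm 2 \<phi>"
      using bound [OF bl, of N] mult_left_mono [OF hN A, of N] by linarith
    moreover have "\<bar>LINT x|lebesgue. synth (g N) x * f x\<bar> \<le> ?c * Lp_norm 2 (g N) * Lp_norm 2 f"
      using Lp_2_Cauchy_Schwarz(3) [OF g2 f] mult_right_mono [OF synth_Lp2_bound [OF ig ig2, of N], of "Lp_norm 2 f"]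
      by simp
    ultimately show ?thesis by linarith
  qed
  have "(\<lambda>N. A * Lp_norm 2 \<phi> + ?c * Lp_norm 2 (g N) * Lp_norm 2 f) \<longlonglongrightarrow> A * Lp_norm 2 \<phi> + ?c * 0 * Lp_norm 2 f"
    by (intro tendsto_intros g0)
  from LIMSEQ_le_const [OF this, of ?I] le show ?thesis by simp
qed

text \<open>The mollifications of \<phi> are inverse Fourier integrals of spectra no larger than
  \<phi> in L^2. They converge pointwise to \<phi> under a Gaussian majorant, and a Gaussian times
  \<open>f\<close> is integrable, so the estimate passes to the limit.\<close>

lemma continuous_pairing:
  fixes f \<phi> :: "'a::euclidean_space \<Rightarrow> real"
  assumes f: "Lp 2 f" and A: "0 \<le> A"
    and bound: "\<And>h. band_limited h \<Longrightarrow> \<bar>LINT x|lebesgue. synth h x * f x\<bar> \<le> A * Lp_norm 2 h"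
    and cont: "continuous_on UNIV \<phi>" and R: "\<And>x. norm x > R \<Longrightarrow> \<phi> x = 0" "0 \<le> R"
    and M: "\<And>x. \<bar>\<phi> x\<bar> \<le> M"
  shows "\<bar>LINT x|lebesgue. \<phi> x * f x\<bar> \<le> A * Lp_norm 2 \<phi>"
proof -
  have \<phi>m [measurable]: "\<phi> \<in> borel_measurable borel" using cont by (rule borel_measurable_continuous_onI)
  have [measurable]: "f \<in> borel_measurable lebesgue" using f by (simp add: Lp_2_iff)
  have \<phi>ml: "\<phi> \<in> borel_measurable lebesgue" by (rule measurable_completion) (use \<phi>m in simp)
  have \<phi>: "integrable lborel \<phi>"
    using R M by (intro integrable_bounded_support) auto
  have "(\<phi> x)\<^sup>2 \<le> M\<^sup>2" for x using power_mono [OF M [of x], of 2] by simp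
  then have \<phi>2: "integrable lborel (\<lambda>x. (\<phi> x)\<^sup>2)"
    using R by (intro integrable_bounded_support [where R = R and B = "M\<^sup>2"]) auto
  define \<delta> where "\<delta> k = 1 / real (Suc k)" for k
  have \<delta>: "\<delta> k > 0" "0 \<le> \<delta> k" "\<delta> k \<le> 1" for k by (simp_all add: \<delta>_def)
  have \<delta>0: "\<delta> \<longlonglongrightarrow> 0" unfolding \<delta>_def by (rule LIMSEQ_Suc [OF lim_1_over_n])
  note eq = synth_spectrum [OF \<phi> \<delta>(1)]
  have m: "mollified \<phi> (\<delta> k) \<in> borel_measurable lebesgue" for k
    unfolding mollified_def [abs_def] by (rule measurable_completion) measurable
  define C where "C = M * exp (R\<^sup>2 / 4) * (LINT w::'a|lborel. gauss (1/2) w)"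
  have "(\<lambda>k. LINT x|lebesgue. mollified \<phi> (\<delta> k) x * f x) \<longlonglongrightarrow> (LINT x|lebesgue. \<phi> x * f x)"
  proof (rule integral_dominated_convergence)
    have "integrable lebesgue (\<lambda>x. gauss (1/4) x *\<^sub>R f x)"
      by (intro Lp_2_Cauchy_Schwarz(1) Lp_2_gauss f) simp
    then have "integrable lebesgue (\<lambda>x. C * \<bar>gauss (1/4) x * f x\<bar>)" by simp
    then show "integrable lebesgue (\<lambda>x. C * gauss (1/4) x * \<bar>f x\<bar>)" by (simp add: abs_mult mult.assoc)
    show "AE x in lebesgue. (\<lambda>k. mollified \<phi> (\<delta> k) x * f x) \<longlonglongrightarrow> \<phi> x * f x"
      by (intro AE_I2 tendsto_mult tendsto_const mollified_tendsto [OF cont M \<delta>0])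
    show "AE x in lebesgue. norm (mollified \<phi> (\<delta> k) x * f x) \<le> C * gauss (1/4) x * \<bar>f x\<bar>" for k
      using mollified_bound [OF \<phi>m M R \<delta>(2,3)] unfolding C_def
      by (auto simp: abs_mult intro!: mult_right_mono)
    show "(\<lambda>x. \<phi> x * f x) \<in> borel_measurable lebesgue"
      using \<phi>ml by (rule borel_measurable_times) measurable
  qed (use m in measurable)
  then have lim: "(\<lambda>k. \<bar>LINT x|lebesgue. mollified \<phi> (\<delta> k) x * f x\<bar>) \<longlonglongrightarrow> \<bar>LINT x|lebesgue. \<phi> x * f x\<bar>"
    by (rule tendsto_rabs)
  have "\<bar>LINT x|lebesgue. mollified \<phi> (\<delta> k) x * f x\<bar> \<le> A * Lp_norm 2 \<phi>" for k
    using synth_spectrum_pairing [OF f A bound \<phi> \<phi>2 \<delta>(1), of k] by (simp add: eq)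
  then show ?thesis by (intro LIMSEQ_le_const2 [OF lim]) simp
qed

text \<open>The function tests itself. Its truncation \<open>F T\<close> in space and size is an
  almost everywhere limit of continuous functions with bounded support, and its pairing with
  \<open>f\<close> is the square of its own norm. Cancelling one factor gives a bound independent of
  \<open>T\<close>.\<close>

lemma band_limited_duality:
  fixes f :: "'a::euclidean_space \<Rightarrow> real"
  assumes f: "Lp 2 f" and A: "0 \<le> A"
    and bound: "\<And>h. band_limited h \<Longrightarrow> \<bar>LINT x|lebesgue. synth h x * f x\<bar> \<le> A * Lp_norm 2 h"
  shows "Lp_norm 2 f \<le> A"
proof -
  have [measurable]: "f \<in> borel_measurable lebesgue" and f2: "integrable lebesgue (\<lambda>x. (f x)\<^sup>2)"
    using f by (simp_all add: Lp_2_iff)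
  define F where "F T x = (if norm x \<le> real T \<and> \<bar>f x\<bar> \<le> real T then f x else 0)" for T x
  have [measurable]: "F T \<in> borel_measurable lebesgue" for T
  proof -
    have [measurable]: "(\<lambda>x. norm x) \<in> borel_measurable (lebesgue :: 'a measure)"
      by (rule measurable_completion) measurable
    show ?thesis unfolding F_def [abs_def] by measurable
  qed
  have F_sq: "F T x * f x = (F T x)\<^sup>2" "(F T x)\<^sup>2 \<le> (f x)\<^sup>2" for T x
    by (auto simp: F_def power2_eq_square)
  have F2: "integrable lebesgue (\<lambda>x. (F T x)\<^sup>2)" for T
    by (rule Bochner_Integration.integrable_bound [OF f2]) (use F_sq in auto)
  have trunc: "(LINT x|lebesgue. (F T x)\<^sup>2) \<le> A\<^sup>2" for T
  proof -
    \<comment> \<open>This supplies continuous functions converging to \<open>F T\<close> off a null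
      set, but with no control of size or support.\<close>
    have "F T measurable_on UNIV"
      using measurable_on_iff_borel_measurable [of UNIV "F T"] by (simp add: lebesgue_on_UNIV_eq)
    then obtain N g where N: "negligible N" and g: "\<And>n. continuous_on UNIV (g n)"
      and lim: "\<And>x. x \<notin> N \<Longrightarrow> (\<lambda>n. g n x) \<longlonglongrightarrow> F T x"
      unfolding measurable_on_def by auto
    have AE: "AE x in lebesgue. x \<notin> N"
      using N by (simp add: AE_iff_null_sets negligible_iff_null_sets AE_not_in)
    define T' where "T' = real T"
    \<comment> \<open>The clamp and the tent-shaped factor give the approximants a common integrable
      majorant. Neither changes the limit, since \<open>F T\<close> is bounded by \<open>T'\<close>
      and vanishes outside the ball of radius \<open>T'\<close>.\<close>
    define \<phi> where "\<phi> n x = max (- T') (min T' (g n x)) * max 0 (min 1 (T' + 1 - norm x))" for n x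
    have cont: "continuous_on UNIV (\<phi> n)" for n
      unfolding \<phi>_def by (intro continuous_intros g)
    have \<phi>M: "\<bar>\<phi> n x\<bar> \<le> T'" for n x
    proof -
      have "\<bar>max (- T') (min T' (g n x))\<bar> \<le> T'" unfolding T'_def by auto
      moreover have "\<bar>max 0 (min 1 (T' + 1 - norm x))\<bar> \<le> 1" by auto
      ultimately have "\<bar>\<phi> n x\<bar> \<le> T' * 1" unfolding \<phi>_def abs_mult by (intro mult_mono) auto
      then show ?thesis by simp
    qed
    have \<phi>R: "norm x > T' + 1 \<Longrightarrow> \<phi> n x = 0" for n x unfolding \<phi>_def by auto
    have \<phi>lim: "(\<lambda>n. \<phi> n x) \<longlonglongrightarrow> F T x" if "x \<notin> N" for x
    proof -
      have "(\<lambda>n. \<phi> n x) \<longlonglongrightarrow> max (- T') (min T' (F T x)) * max 0 (min 1 (T' + 1 - norm x))"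
        unfolding \<phi>_def by (intro tendsto_intros lim that)
      also have "max (- T') (min T' (F T x)) * max 0 (min 1 (T' + 1 - norm x)) = F T x"
        by (auto simp: F_def T'_def abs_le_iff)
      finally show ?thesis .
    qed
    have \<phi>m: "\<phi> n \<in> borel_measurable borel" for n
      using cont by (rule borel_measurable_continuous_onI)
    have [measurable]: "\<phi> n \<in> borel_measurable lebesgue" for n
      by (rule measurable_completion) (use \<phi>m in simp)
    let ?B = "indicator (cball 0 (T' + 1)) :: 'a \<Rightarrow> real"
    have Bm [measurable]: "?B \<in> borel_measurable borel" by (rule borel_measurable_indicator) simp
    have \<phi>B: "\<bar>\<phi> n x\<bar> \<le> T' * ?B x" for n x
      using \<phi>M \<phi>R [of x n] by (auto simp: indicator_def not_le)
    have iB: "integrable lebesgue (\<lambda>x. T'\<^sup>2 * ?B x)"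
    proof -
      have "integrable lborel (\<lambda>x. indicator (cball (0::'a) (T' + 1)) x *\<^sub>R T'\<^sup>2)"
        by (rule borel_integrable_compact) auto
      then have "integrable lborel (\<lambda>x. T'\<^sup>2 * ?B x)" by (simp add: mult.commute)
      then show ?thesis by (subst integrable_completion) auto
    qed
    have l1: "(\<lambda>n. LINT x|lebesgue. \<phi> n x * f x) \<longlonglongrightarrow> (LINT x|lebesgue. F T x * f x)"
    proof (rule integral_dominated_convergence)
      have "Lp 2 (\<lambda>x. T' * ?B x)"
      proof -
        have "(norm (T' * ?B x))\<^sup>2 = T'\<^sup>2 * ?B x" for x by (simp add: indicator_def)
        moreover have "(\<lambda>x. T' * ?B x) \<in> borel_measurable lebesgue"
          by (rule measurable_completion) measurable
        ultimately show ?thesis using iB by (simp only: Lp_2_iff)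
      qed
      then have "integrable lebesgue (\<lambda>x. \<bar>(T' * ?B x) *\<^sub>R f x\<bar>)"
        using Lp_2_Cauchy_Schwarz(1) [OF _ f] by (intro integrable_abs) auto
      then show "integrable lebesgue (\<lambda>x. T' * ?B x * \<bar>f x\<bar>)"
        by (simp add: abs_mult T'_def)
      show "AE x in lebesgue. (\<lambda>n. \<phi> n x * f x) \<longlonglongrightarrow> F T x * f x"
        using AE by eventually_elim (intro tendsto_mult \<phi>lim tendsto_const)
      show "AE x in lebesgue. norm (\<phi> n x * f x) \<le> T' * ?B x * \<bar>f x\<bar>" for n
        unfolding real_norm_def abs_mult by (intro AE_I2 mult_right_mono \<phi>B) simp
    qed measurable
    have l2: "(\<lambda>n. LINT x|lebesgue. (\<phi> n x)\<^sup>2) \<longlonglongrightarrow> (LINT x|lebesgue. (F T x)\<^sup>2)"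
    proof (rule integral_dominated_convergence [OF _ _ iB])
      show "AE x in lebesgue. (\<lambda>n. (\<phi> n x)\<^sup>2) \<longlonglongrightarrow> (F T x)\<^sup>2"
        using AE by eventually_elim (intro tendsto_power \<phi>lim)
      show "AE x in lebesgue. norm ((\<phi> n x)\<^sup>2) \<le> T'\<^sup>2 * ?B x" for n
      proof (intro AE_I2)
        fix x
        have "\<bar>\<phi> n x\<bar>\<^sup>2 \<le> (T' * ?B x)\<^sup>2" by (rule power_mono [OF \<phi>B]) simp
        then show "norm ((\<phi> n x)\<^sup>2) \<le> T'\<^sup>2 * ?B x" by (auto simp: indicator_def split: if_splits)
      qed
    qed measurable
    have r: "(\<lambda>n. A * Lp_norm 2 (\<phi> n)) \<longlonglongrightarrow> A * Lp_norm 2 (F T)"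
      unfolding Lp_norm_2_eq using l2 by (intro tendsto_mult tendsto_real_sqrt tendsto_const) simp
    have l: "(\<lambda>n. \<bar>LINT x|lebesgue. \<phi> n x * f x\<bar>) \<longlonglongrightarrow> \<bar>LINT x|lebesgue. F T x * f x\<bar>"
      using l1 by (rule tendsto_rabs)
    have "0 \<le> T' + 1" by (simp add: T'_def)
    then have le: "\<bar>LINT x|lebesgue. \<phi> n x * f x\<bar> \<le> A * Lp_norm 2 (\<phi> n)" for n
      using continuous_pairing [OF f A bound cont \<phi>R _ \<phi>M] by blast
    have "\<bar>LINT x|lebesgue. F T x * f x\<bar> \<le> A * Lp_norm 2 (F T)"
      using LIMSEQ_le [OF l r] le by blast
    then have "(Lp_norm 2 (F T))\<^sup>2 \<le> A * Lp_norm 2 (F T)"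
      unfolding F_sq by (simp add: Lp_norm_2_sq)
    then have "Lp_norm 2 (F T) \<le> A"
    proof (cases "Lp_norm 2 (F T) = 0")
      case False
      then have "0 < Lp_norm 2 (F T)" using Lp_norm_nonneg [of 2 "F T"] by linarith
      with \<open>(Lp_norm 2 (F T))\<^sup>2 \<le> A * Lp_norm 2 (F T)\<close> show ?thesis by (simp add: power2_eq_square)
    qed (use A in simp)
    then have "(Lp_norm 2 (F T))\<^sup>2 \<le> A\<^sup>2" by (rule power_mono) simp
    then show ?thesis by (simp add: Lp_norm_2_sq)
  qed
  have "(\<lambda>T. LINT x|lebesgue. (F T x)\<^sup>2) \<longlonglongrightarrow> (LINT x|lebesgue. (f x)\<^sup>2)"
  proof (rule integral_dominated_convergence [OF _ _ f2])
    show "AE x in lebesgue. (\<lambda>T. (F T x)\<^sup>2) \<longlonglongrightarrow> (f x)\<^sup>2"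
    proof (intro AE_I2)
      fix x :: 'a
      obtain T0 where "max (norm x) \<bar>f x\<bar> \<le> real T0" using real_arch_simple by blast
      then have "(F T x)\<^sup>2 = (f x)\<^sup>2" if "T \<ge> T0" for T
        using that of_nat_mono [OF that, where 'a = real] unfolding F_def by simp
      then show "(\<lambda>T. (F T x)\<^sup>2) \<longlonglongrightarrow> (f x)\<^sup>2"
        by (intro tendsto_eventually) (auto simp: eventually_sequentially)
    qed
    show "AE x in lebesgue. norm ((F T x)\<^sup>2) \<le> (f x)\<^sup>2" for T using F_sq by simp
  qed measurable
  then have "(LINT x|lebesgue. (f x)\<^sup>2) \<le> A\<^sup>2"
    by (rule LIMSEQ_le_const2) (use trunc in simp)
  then have "(Lp_norm 2 f)\<^sup>2 \<le> A\<^sup>2" by (simp add: Lp_norm_2_sq)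
  then show ?thesis using A by (rule power2_le_imp_le)
qed

text \<open>Solutions are complex while \<open>synth h\<close> is real, so real and imaginary parts
  are estimated separately; the resulting factor sqrt 2 is rounded up to 2.\<close>

lemma band_limited_duality_complex:
  fixes f :: "'a::euclidean_space \<Rightarrow> complex"
  assumes f: "Lp 2 f" and A: "0 \<le> A"
    and bound: "\<And>h. band_limited h \<Longrightarrow> norm (LINT x|lebesgue. synth h x *\<^sub>R f x) \<le> A * Lp_norm 2 h"
  shows "Lp_norm 2 f \<le> 2 * A"
proof -
  have [measurable]: "f \<in> borel_measurable lebesgue" and f2: "integrable lebesgue (\<lambda>x. (norm (f x))\<^sup>2)"
    using f by (simp_all add: Lp_2_iff)
  have sq: "(Re z)\<^sup>2 \<le> (norm z)\<^sup>2" "(Im z)\<^sup>2 \<le> (norm z)\<^sup>2" for z :: complex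
    unfolding cmod_power2 by simp_all
  have i: "integrable lebesgue (\<lambda>x. (Re (f x))\<^sup>2)" "integrable lebesgue (\<lambda>x. (Im (f x))\<^sup>2)"
    by (rule Bochner_Integration.integrable_bound [OF f2]; simp add: sq)+
  then have L: "Lp 2 (\<lambda>x. Re (f x))" "Lp 2 (\<lambda>x. Im (f x))" by (auto simp: Lp_2_iff)
  have re: "Lp_norm 2 (\<lambda>x. Re (f x)) \<le> A"
  proof (rule band_limited_duality [OF L(1) A])
    fix h :: "'a \<Rightarrow> complex" assume h: "band_limited h"
    have int: "integrable lebesgue (\<lambda>x. synth h x *\<^sub>R f x)"
      by (intro Lp_2_Cauchy_Schwarz(1) f synth_Lp2 band_limited_integrable band_limited_square_integrable h)
    have "(LINT x|lebesgue. synth h x * Re (f x)) = Re (LINT x|lebesgue. synth h x *\<^sub>R f x)"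
      using integral_Re [OF int] by simp
    then show "\<bar>LINT x|lebesgue. synth h x * Re (f x)\<bar> \<le> A * Lp_norm 2 h"
      using order_trans [OF abs_Re_le_cmod bound [OF h]] by simp
  qed
  have im: "Lp_norm 2 (\<lambda>x. Im (f x)) \<le> A"
  proof (rule band_limited_duality [OF L(2) A])
    fix h :: "'a \<Rightarrow> complex" assume h: "band_limited h"
    have int: "integrable lebesgue (\<lambda>x. synth h x *\<^sub>R f x)"
      by (intro Lp_2_Cauchy_Schwarz(1) f synth_Lp2 band_limited_integrable band_limited_square_integrable h)
    have "(LINT x|lebesgue. synth h x * Im (f x)) = Im (LINT x|lebesgue. synth h x *\<^sub>R f x)"
      using integral_Im [OF int] by simp
    then show "\<bar>LINT x|lebesgue. synth h x * Im (f x)\<bar> \<le> A * Lp_norm 2 h"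
      using order_trans [OF abs_Im_le_cmod bound [OF h]] by simp
  qed
  have "(Lp_norm 2 f)\<^sup>2 = (Lp_norm 2 (\<lambda>x. Re (f x)))\<^sup>2 + (Lp_norm 2 (\<lambda>x. Im (f x)))\<^sup>2"
    unfolding Lp_norm_2_sq real_norm_def power2_abs cmod_power2 by (rule Bochner_Integration.integral_add [OF i])
  also have "\<dots> \<le> A\<^sup>2 + A\<^sup>2"
    by (intro add_mono power_mono re im Lp_norm_nonneg)
  also have "\<dots> \<le> (2 * A)\<^sup>2" by (simp add: power_mult_distrib)
  finally show ?thesis by (rule power2_le_imp_le) (use A in simp)
qed

section \<open>The equation in time\<close>

lemma dir_deriv_step_scaled:
  assumes "\<delta> > 0"
  shows "dir_deriv 1 (\<lambda>t. step ((t - s) / \<delta>)) t = dir_deriv 1 step ((t - s) / \<delta>) / \<delta>"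
proof -
  have "((\<lambda>t. step ((t - s) / \<delta>)) has_real_derivative dir_deriv 1 step ((t - s) / \<delta>) * (1 / \<delta>)) (at t)"
    by (rule DERIV_chain2 [OF smooth_has_real_derivative [OF smooth_step]])
      (use assms in \<open>auto intro!: derivative_eq_intros\<close>)
  from dir_deriv_eqI [OF this [unfolded has_field_derivative_def], of 1] show ?thesis by simp
qed

lemma smooth_step_scaled: "smooth (\<lambda>t. step ((t - s) / \<delta>))"
  using smooth_affine_real [OF smooth_step, of "1 / \<delta>" "- s / \<delta>"] by (simp add: diff_divide_distrib)

lemma dir_deriv_step_eq_0: "y < 0 \<or> 1 < y \<Longrightarrow> dir_deriv 1 step y = 0"
proof (elim disjE)
  assume "y < 0"
  have "(step has_derivative (\<lambda>v. 0)) (at y)"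
    by (rule has_derivative_transform_within_open [OF has_derivative_const [of 0], of "{..<0}"])
      (use \<open>y < 0\<close> in \<open>auto simp: step_eq_0\<close>)
  then show ?thesis by (simp add: dir_deriv_eqI)
next
  assume "1 < y"
  have "(step has_derivative (\<lambda>v. 0)) (at y)"
    by (rule has_derivative_transform_within_open [OF has_derivative_const [of 1], of "{1<..}"])
      (use \<open>1 < y\<close> in \<open>auto simp: step_eq_1\<close>)
  then show ?thesis by (simp add: dir_deriv_eqI)
qed

lemma bounded_dir_deriv_step: "\<exists>B>0. \<forall>y. \<bar>dir_deriv 1 step y\<bar> \<le> B"
proof -
  have "bounded (dir_deriv 1 step ` {0..1})"
    by (intro compact_imp_bounded compact_continuous_image continuous_on_subset [OF smooth_continuous]
        smooth_dir_deriv smooth_step) auto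
  then obtain B where B: "\<forall>z\<in>dir_deriv 1 step ` {0..1}. norm z \<le> B" unfolding bounded_iff by blast
  have "\<bar>dir_deriv 1 step y\<bar> \<le> \<bar>B\<bar> + 1" for y
  proof (cases "0 \<le> y \<and> y \<le> 1")
    case True
    then show ?thesis using B by force
  qed (use dir_deriv_step_eq_0 [of y] in auto)
  then show ?thesis by (intro exI [of _ "\<bar>B\<bar> + 1"]) auto
qed

text \<open>Differences of smoothed Heaviside functions as test functions show that \<open>w\<close> is constant.\<close>

lemma du_Bois_Reymond:
  fixes w :: "real \<Rightarrow> complex"
  assumes w: "continuous_on {0..} w"
    and weak: "\<And>\<eta> \<alpha> \<beta> T. smooth \<eta> \<Longrightarrow> 0 < \<alpha> \<Longrightarrow> \<beta> < T \<Longrightarrow> (\<And>t. t \<notin> {\<alpha>..\<beta>} \<Longrightarrow> \<eta> t = 0) \<Longrightarrow>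
      ((\<lambda>t. dir_deriv 1 \<eta> t *\<^sub>R w t) has_integral 0) {0..T}"
    and t: "0 \<le> t"
  shows "w t = w 0"
proof -
  obtain B where B: "B > 0" "\<And>y. \<bar>dir_deriv 1 step y\<bar> \<le> B" using bounded_dir_deriv_step by blast
  have pos: "w s1 = w s2" if s: "0 < s1" "s1 < s2" for s1 s2
  proof (rule ccontr)
    assume neq: "w s1 \<noteq> w s2"
    \<comment> \<open>Chosen so that the two errors B * \<epsilon> add up to half of the supposed
      jump.\<close>
    define \<epsilon> where "\<epsilon> = norm (w s1 - w s2) / (4 * B)"
    have \<epsilon>: "\<epsilon> > 0" using neq B by (simp add: \<epsilon>_def)
    have cont: "\<exists>d>0. \<forall>t\<in>{0..}. dist t s < d \<longrightarrow> dist (w t) (w s) < \<epsilon>" if "s > 0" for s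
      using w \<epsilon> that unfolding continuous_on_iff by auto
    obtain d1 where d1: "d1 > 0" "\<And>t. t \<ge> 0 \<Longrightarrow> dist t s1 < d1 \<Longrightarrow> dist (w t) (w s1) < \<epsilon>"
      using cont [of s1] s by auto
    obtain d2 where d2: "d2 > 0" "\<And>t. t \<ge> 0 \<Longrightarrow> dist t s2 < d2 \<Longrightarrow> dist (w t) (w s2) < \<epsilon>"
      using cont [of s2] s by auto
    define \<delta> where "\<delta> = min d1 d2 / 2"
    have \<delta>: "\<delta> > 0" "\<delta> < d1" "\<delta> < d2" using d1 d2 by (auto simp: \<delta>_def)
    \<comment> \<open>Strictly beyond s2 + \<delta>, the right end of the support of the test
      function, as \<open>weak\<close> demands.\<close>
    define T where "T = s2 + 2 * \<delta>"
    define \<eta> where "\<eta> s t = step ((t - s) / \<delta>)" for s t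
    have sm: "smooth (\<eta> s)" for s unfolding \<eta>_def by (rule smooth_step_scaled)
    have d\<eta>: "dir_deriv 1 (\<eta> s) t = dir_deriv 1 step ((t - s) / \<delta>) / \<delta>" for s t
      unfolding \<eta>_def using \<delta>(1) by (rule dir_deriv_step_scaled)
    have d\<eta>0: "dir_deriv 1 (\<eta> s) t = 0" if "t \<notin> {s..s + \<delta>}" for s t
      unfolding d\<eta> using that \<delta> by (subst dir_deriv_step_eq_0) (auto simp: field_simps)
    have cont\<eta>: "continuous_on A (dir_deriv 1 (\<eta> s))" for A s
      by (intro continuous_on_subset [OF smooth_continuous] smooth_dir_deriv sm) auto
    have mass: "((\<lambda>t. dir_deriv 1 (\<eta> s) t) has_integral 1) {0..T}" if "0 < s" "s \<le> s2" for s
    proof -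
      have "(dir_deriv 1 (\<eta> s) has_integral \<eta> s T - \<eta> s 0) {0..T}"
        using s \<delta> by (intro fundamental_theorem_of_calculus)
          (auto simp: T_def simp flip: has_real_derivative_iff_has_vector_derivative
            intro: has_field_derivative_at_within smooth_has_real_derivative sm)
      moreover have "\<eta> s T = 1" "\<eta> s 0 = 0"
        using that \<delta> by (auto simp: \<eta>_def T_def field_simps intro!: step_eq_1 step_eq_0)
      ultimately show ?thesis by simp
    qed
    \<comment> \<open>The derivative of the scaled step has mass one and is at most B / \<delta> on
      an interval of length \<delta>, so averaging \<open>w\<close> against it errs by at most B *
      \<epsilon>. No sign of the kernel is used.\<close>
    have approx: "norm (integral {0..T} (\<lambda>t. dir_deriv 1 (\<eta> s) t *\<^sub>R w t) - w s) \<le> B * \<epsilon>"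
      if "0 < s" "s \<le> s2" and ws: "\<And>t. t \<in> {s..s + \<delta>} \<Longrightarrow> dist (w t) (w s) < \<epsilon>" for s
    proof -
      have int: "((\<lambda>t. dir_deriv 1 (\<eta> s) t *\<^sub>R w t) has_integral integral {0..T} (\<lambda>t. dir_deriv 1 (\<eta> s) t *\<^sub>R w t)) {0..T}"
        by (intro integrable_integral integrable_continuous_real continuous_intros cont\<eta>
            continuous_on_subset [OF w]) auto
      let ?f = "\<lambda>t. dir_deriv 1 (\<eta> s) t *\<^sub>R (w t - w s)"
      have i1: "(?f has_integral (integral {0..T} (\<lambda>t. dir_deriv 1 (\<eta> s) t *\<^sub>R w t) - 1 *\<^sub>R w s)) {0..T}"
        unfolding scaleR_diff_right
        by (intro has_integral_diff int has_integral_scaleR_left mass that)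
      have i2: "(?f has_integral integral {s..s + \<delta>} ?f) {0..T}"
      proof (rule has_integral_on_superset)
        show "(?f has_integral integral {s..s + \<delta>} ?f) {s..s + \<delta>}"
          using that by (intro integrable_integral integrable_continuous_real continuous_intros cont\<eta>
              continuous_on_subset [OF w]) auto
      qed (use d\<eta>0 that \<delta> in \<open>auto simp: T_def\<close>)
      have "integral {0..T} (\<lambda>t. dir_deriv 1 (\<eta> s) t *\<^sub>R w t) - w s = integral {s..s + \<delta>} ?f"
        using has_integral_unique [OF i1 i2] by (simp only: scaleR_one)
      moreover have "norm (integral {s..s + \<delta>} ?f) \<le> B / \<delta> * \<epsilon> * (s + \<delta> - s)"
      proof (rule integral_bound)
        show "continuous_on {s..s + \<delta>} ?f"
          using that by (intro continuous_intros cont\<eta> continuous_on_subset [OF w]) auto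
        show "norm (?f t) \<le> B / \<delta> * \<epsilon>" if "t \<in> {s..s + \<delta>}" for t
          unfolding norm_scaleR d\<eta> real_norm_def abs_divide
          using B \<delta> ws [OF that] \<epsilon> by (intro mult_mono) (auto simp: dist_norm divide_right_mono)
      qed (use \<delta> in auto)
      ultimately show ?thesis using \<delta> by simp
    qed
    have same: "integral {0..T} (\<lambda>t. dir_deriv 1 (\<eta> s1) t *\<^sub>R w t) = integral {0..T} (\<lambda>t. dir_deriv 1 (\<eta> s2) t *\<^sub>R w t)"
    proof -
      have "((\<lambda>t. dir_deriv 1 (\<lambda>t. \<eta> s1 t - \<eta> s2 t) t *\<^sub>R w t) has_integral 0) {0..T}"
      proof (rule weak [of _ s1 "s2 + \<delta>"])
        show "smooth (\<lambda>t. \<eta> s1 t - \<eta> s2 t)" by (intro smooth_diff sm)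
        fix t assume "t \<notin> {s1..s2 + \<delta>}"
        then have "t < s1 \<or> s2 + \<delta> < t" by auto
        then show "\<eta> s1 t - \<eta> s2 t = 0"
          using \<delta> s by (auto simp: \<eta>_def step_eq_0 step_eq_1 field_simps)
      qed (use s \<delta> in \<open>auto simp: T_def\<close>)
      moreover have "dir_deriv 1 (\<lambda>t. \<eta> s1 t - \<eta> s2 t) t = dir_deriv 1 (\<eta> s1) t - dir_deriv 1 (\<eta> s2) t" for t
        using dir_deriv_eqI [OF has_derivative_diff [OF smooth_has_derivative [OF sm] smooth_has_derivative [OF sm]]]
        by blast
      ultimately have "((\<lambda>t. dir_deriv 1 (\<eta> s1) t *\<^sub>R w t - dir_deriv 1 (\<eta> s2) t *\<^sub>R w t) has_integral 0) {0..T}"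
        by (simp add: scaleR_diff_left)
      then have "integral {0..T} (\<lambda>t. dir_deriv 1 (\<eta> s1) t *\<^sub>R w t - dir_deriv 1 (\<eta> s2) t *\<^sub>R w t) = 0"
        by (rule integral_unique)
      then show ?thesis
        by (subst (asm) Henstock_Kurzweil_Integration.integral_diff)
          (auto intro!: integrable_continuous_real continuous_intros cont\<eta> continuous_on_subset [OF w])
    qed
    let ?I = "integral {0..T} (\<lambda>t. dir_deriv 1 (\<eta> s1) t *\<^sub>R w t)"
    have "norm (?I - w s1) \<le> B * \<epsilon>"
      using s \<delta> by (intro approx d1) (auto simp: dist_real_def)
    moreover have "norm (?I - w s2) \<le> B * \<epsilon>"
      unfolding same using s \<delta> by (intro approx d2) (auto simp: dist_real_def)
    moreover have "norm (w s1 - w s2) \<le> norm (?I - w s2) + norm (?I - w s1)"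
      using norm_triangle_ineq4 [of "?I - w s2" "?I - w s1"] by simp
    ultimately have "norm (w s1 - w s2) \<le> 2 * (B * \<epsilon>)" by linarith
    moreover have "B * \<epsilon> = norm (w s1 - w s2) / 4" using B by (simp add: \<epsilon>_def)
    ultimately show False using neq by simp
  qed
  show ?thesis
  proof (cases "t = 0")
    case False
    with t have t: "t > 0" by simp
    \<comment> \<open>Test functions only see positive times; the value at 0 is reached by
      continuity.\<close>
    have "(\<lambda>n. w (t / real (Suc n))) \<longlonglongrightarrow> w 0"
    proof (rule continuous_on_tendsto_compose [OF w])
      show "(\<lambda>n. t / real (Suc n)) \<longlonglongrightarrow> 0"
        using tendsto_mult [OF tendsto_const LIMSEQ_Suc [OF lim_1_over_n], of t] by simp
    qed (use t in auto)
    moreover have "w (t / real (Suc n)) = w t" for n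
    proof (cases n)
      case (Suc k)
      then have "t / real (Suc n) < t" using t by (simp add: divide_less_eq)
      then show ?thesis using t by (intro pos) auto
    qed simp
    ultimately show ?thesis by (simp add: LIMSEQ_const_iff)
  qed simp
qed

text \<open>With C the primitive of \<open>c\<close>, the derivative of \<eta>' a + \<eta> C has
  integral zero. Subtracting the weak equation leaves the integral of \<eta>' (a1 + d + C), so a1 +
  d + C is constant. As \<open>a1\<close> and \<open>d\<close> are only assumed continuous, it is
  their sum that is differentiated.\<close>

lemma weak_ode:
  fixes a a1 c d :: "real \<Rightarrow> complex"
  assumes a: "\<And>t. t \<ge> 0 \<Longrightarrow> (a has_vector_derivative a1 t) (at t within {0..})"
    and cont: "continuous_on {0..} a1" "continuous_on {0..} c" "continuous_on {0..} d"
    and weak: "\<And>\<eta> \<alpha> \<beta> T. smooth \<eta> \<Longrightarrow> 0 < \<alpha> \<Longrightarrow> \<beta> < T \<Longrightarrow> (\<And>t. t \<notin> {\<alpha>..\<beta>} \<Longrightarrow> \<eta> t = 0) \<Longrightarrow>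
      ((\<lambda>t. dir_deriv 1 (dir_deriv 1 \<eta>) t *\<^sub>R a t + \<eta> t *\<^sub>R c t - dir_deriv 1 \<eta> t *\<^sub>R d t) has_integral 0) {0..T}"
    and t: "0 \<le> t"
  shows "((\<lambda>t. a1 t + d t) has_vector_derivative - c t) (at t within {0..})"
proof -
  define C where "C t = integral {0..t} c" for t
  have C': "(C has_vector_derivative c t) (at t within {0..T})" if "0 \<le> t" "t \<le> T" for t T
    unfolding C_def using that cont by (intro integral_has_vector_derivative continuous_on_subset [OF cont(2)]) auto
  have C0: "(C has_vector_derivative c t) (at t within {0..})" if "0 \<le> t" for t
  proof -
    have "at t within {0..} = at t within {0..t + 1}"
      by (rule at_within_nhd [of _ "{..<t+1}"]) (use that in auto)
    then show ?thesis using C' [of t "t + 1"] that by simp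
  qed
  define w where "w t = a1 t + d t + C t" for t
  have cC: "continuous_on {0..} C"
    by (rule continuous_on_vector_derivative) (use C0 in auto)
  have "w t = w 0" if "0 \<le> t" for t
  proof (rule du_Bois_Reymond [OF _ _ that])
    show "continuous_on {0..} w" unfolding w_def by (intro continuous_intros cont cC)
    fix \<eta> :: "real \<Rightarrow> real" and \<alpha> \<beta> T :: real
    assume \<eta>: "smooth \<eta>" "0 < \<alpha>" "\<beta> < T" "\<And>t. t \<notin> {\<alpha>..\<beta>} \<Longrightarrow> \<eta> t = 0"
    show "((\<lambda>t. dir_deriv 1 \<eta> t *\<^sub>R w t) has_integral 0) {0..T}"
    proof (cases "0 \<le> T")
      case True
      let ?d1 = "dir_deriv 1 \<eta>" and ?d2 = "dir_deriv 1 (dir_deriv 1 \<eta>)"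
      define G where "G t = ?d1 t *\<^sub>R a t + \<eta> t *\<^sub>R C t" for t
      have D: "(\<eta> has_real_derivative ?d1 t) (at t within S)" "(?d1 has_real_derivative ?d2 t) (at t within S)" for t S
        using has_field_derivative_at_within [OF smooth_has_real_derivative [OF \<eta>(1)]]
          has_field_derivative_at_within [OF smooth_has_real_derivative [OF smooth_dir_deriv [OF \<eta>(1)]]]
        by auto
      have "?d1 t = 0" if "t \<notin> {\<alpha>..\<beta>}" for t
        by (rule dir_deriv_eq_0_outside_closed [OF _ \<eta>(4) that]) auto
      then have "G 0 = 0" "G T = 0" using \<eta> by (auto simp: G_def)
      moreover have "((\<lambda>t. (?d1 t *\<^sub>R a1 t + ?d2 t *\<^sub>R a t) + (\<eta> t *\<^sub>R c t + ?d1 t *\<^sub>R C t)) has_integral G T - G 0) {0..T}"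
        unfolding G_def
      proof (rule fundamental_theorem_of_calculus [OF True])
        fix t assume "t \<in> {0..T}"
        then show "((\<lambda>t. ?d1 t *\<^sub>R a t + \<eta> t *\<^sub>R C t) has_vector_derivative
            (?d1 t *\<^sub>R a1 t + ?d2 t *\<^sub>R a t) + (\<eta> t *\<^sub>R c t + ?d1 t *\<^sub>R C t)) (at t within {0..T})"
          using has_vector_derivative_within_subset [OF a [of t], of "{0..T}"] C' [of t T]
          by (intro has_vector_derivative_add has_vector_derivative_scaleR D) auto
      qed
      ultimately have e: "((\<lambda>t. (?d1 t *\<^sub>R a1 t + ?d2 t *\<^sub>R a t) + (\<eta> t *\<^sub>R c t + ?d1 t *\<^sub>R C t)) has_integral 0) {0..T}"
        by simp
      have "((\<lambda>t. (?d1 t *\<^sub>R a1 t + ?d2 t *\<^sub>R a t) + (\<eta> t *\<^sub>R c t + ?d1 t *\<^sub>R C t)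
          - (?d2 t *\<^sub>R a t + \<eta> t *\<^sub>R c t - ?d1 t *\<^sub>R d t)) has_integral 0 - 0) {0..T}"
        by (rule has_integral_diff [OF e weak [OF \<eta>]])
      moreover have "(?d1 t *\<^sub>R a1 t + ?d2 t *\<^sub>R a t) + (\<eta> t *\<^sub>R c t + ?d1 t *\<^sub>R C t)
          - (?d2 t *\<^sub>R a t + \<eta> t *\<^sub>R c t - ?d1 t *\<^sub>R d t) = ?d1 t *\<^sub>R w t" for t
        by (simp add: w_def scaleR_add_right)
      ultimately show ?thesis by simp
    qed simp
  qed
  then have eq: "a1 t + d t = w 0 - C t" if "0 \<le> t" for t 
  proof -
    have "a1 t + d t + C t = w 0" using \<open>\<And>t. 0 \<le> t \<Longrightarrow> w t = w 0\<close> [OF that] by (simp only: w_def)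
    then show ?thesis by (simp only: eq_diff_eq)
  qed
  have "((\<lambda>t. w 0 - C t) has_vector_derivative 0 - c t) (at t within {0..})"
    by (intro has_vector_derivative_diff C0 t has_vector_derivative_const)
  then have "((\<lambda>t. a1 t + d t) has_vector_derivative 0 - c t) (at t within {0..})"
    by (rule has_vector_derivative_transform [rotated 2]) (use t eq in auto)
  then show ?thesis by simp
qed

section \<open>Removing spatial cutoffs\<close>

text \<open>N + 1 instead of N avoids division by zero; each derivative gains a factor 1 / (N +
  1).\<close>

definition scaled_cutoff :: "nat \<Rightarrow> 'a::euclidean_space \<Rightarrow> real" where
  "scaled_cutoff N x = cutoff ((1 / real (Suc N)) *\<^sub>R x)"

lemma dir_deriv_scaleR: "smooth f \<Longrightarrow> dir_deriv (c *\<^sub>R v) f x = c * dir_deriv v f x"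
  using linear.scaleR [OF has_derivative_linear [OF smooth_has_derivative]] by fastforce

lemma dir_deriv_0: "smooth f \<Longrightarrow> dir_deriv 0 f x = 0"
  using dir_deriv_scaleR [of f 0 0 x] by simp

lemma smooth_scaled_cutoff: "smooth (scaled_cutoff N)"
  unfolding scaled_cutoff_def [abs_def] by (rule smooth_compose_linear [OF bounded_linear_scaleR_right smooth_cutoff])

lemma dir_deriv_compose_scaleR:
  assumes "smooth f"
  shows "dir_deriv v (\<lambda>x. f (e *\<^sub>R x)) = (\<lambda>x. e * dir_deriv v f (e *\<^sub>R x))"
  using dir_deriv_compose_linear(1) [OF bounded_linear_scaleR_right assms, of v e]
  by (simp add: dir_deriv_scaleR [OF assms])

lemma dir_deriv_scaled_cutoff:
  "dir_deriv v (scaled_cutoff N) = (\<lambda>x. (1 / real (Suc N)) * dir_deriv v cutoff ((1 / real (Suc N)) *\<^sub>R x))"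
  unfolding scaled_cutoff_def [abs_def] by (rule dir_deriv_compose_scaleR [OF smooth_cutoff])

lemma dir_deriv2_scaled_cutoff:
  "dir_deriv v (dir_deriv v (scaled_cutoff N)) =
    (\<lambda>x. (1 / real (Suc N)) * ((1 / real (Suc N)) * dir_deriv v (dir_deriv v cutoff) ((1 / real (Suc N)) *\<^sub>R x)))"
  unfolding dir_deriv_scaled_cutoff
  by (subst dir_deriv_cmult)
    (auto simp: dir_deriv_compose_scaleR [OF smooth_dir_deriv [OF smooth_cutoff]]
      intro!: smooth_differentiable smooth_compose_linear [OF bounded_linear_scaleR_right] smooth_dir_deriv smooth_cutoff)

lemma test_function_scaled_cutoff_mult:
  assumes "smooth \<psi>" shows "test_function UNIV (\<lambda>x. scaled_cutoff N x * \<psi> x)"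
  unfolding test_function_def
proof (intro conjI exI allI impI)
  show "smooth (\<lambda>x. scaled_cutoff N x * \<psi> x)" by (intro smooth_mult smooth_scaled_cutoff assms)
  let ?K = "(\<lambda>x. real (Suc N) *\<^sub>R x) ` cbox (- 2 *\<^sub>R One) (2 *\<^sub>R One :: 'a)"
  show "compact ?K" by (intro compact_continuous_image continuous_intros compact_cbox)
  fix x :: 'a assume "x \<notin> ?K"
  then have "(1 / real (Suc N)) *\<^sub>R x \<notin> cbox (- 2 *\<^sub>R One) (2 *\<^sub>R One)"
    by (auto simp: image_iff)
  from cutoff_eq_0 [OF this] show "scaled_cutoff N x * \<psi> x = 0" by (simp only: scaled_cutoff_def mult_zero_left)
qed simp

lemma dir_deriv_scaled_cutoff_mult:
  assumes "smooth \<psi>"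
  shows "dir_deriv v (\<lambda>x. scaled_cutoff N x * \<psi> x) = (\<lambda>x. scaled_cutoff N x * dir_deriv v \<psi> x + dir_deriv v (scaled_cutoff N) x * \<psi> x)"
  by (rule dir_deriv_mult) (intro smooth_differentiable smooth_scaled_cutoff assms)+

lemma dir_deriv2_scaled_cutoff_mult:
  assumes "smooth \<psi>"
  shows "dir_deriv v (dir_deriv v (\<lambda>x. scaled_cutoff N x * \<psi> x)) x =
    scaled_cutoff N x * dir_deriv v (dir_deriv v \<psi>) x + (2 * dir_deriv v (scaled_cutoff N) x) * dir_deriv v \<psi> x
      + dir_deriv v (dir_deriv v (scaled_cutoff N)) x * \<psi> x"
  unfolding dir_deriv_scaled_cutoff_mult [OF assms]
  by (subst dir_deriv_add;
      simp add: dir_deriv_mult smooth_differentiable smooth_mult smooth_dir_deriv smooth_scaled_cutoff assms)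

text \<open>The weights are the scaled cutoffs and their derivatives.\<close>

definition weight_limit :: "(nat \<Rightarrow> 'a::euclidean_space \<Rightarrow> real) \<Rightarrow> real \<Rightarrow> real \<Rightarrow> bool" where
  "weight_limit w L C \<longleftrightarrow> (\<forall>N. w N \<in> borel_measurable borel) \<and> (\<forall>N x. \<bar>w N x\<bar> \<le> C) \<and>
    (\<forall>x. (\<lambda>N. w N x) \<longlonglongrightarrow> L)"

text \<open>Dominated convergence with majorant C |\<psi>| |f|. The norm bound, uniform in N, will
  later dominate the integral over time.\<close>

lemma weight_limit_pairing:
  fixes f :: "'a::euclidean_space \<Rightarrow> complex"
  assumes w: "weight_limit w L C" and \<psi>: "Lp 2 \<psi>" and f: "Lp 2 f"
  shows "integrable lebesgue (\<lambda>x. (w N x * \<psi> x) *\<^sub>R f x)"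
    and "norm (LINT x|lebesgue. (w N x * \<psi> x) *\<^sub>R f x) \<le> C * Lp_norm 2 \<psi> * Lp_norm 2 f"
    and "(\<lambda>N. LINT x|lebesgue. (w N x * \<psi> x) *\<^sub>R f x) \<longlonglongrightarrow> L *\<^sub>R (LINT x|lebesgue. \<psi> x *\<^sub>R f x)"
proof -
  have [measurable]: "f \<in> borel_measurable lebesgue" "\<psi> \<in> borel_measurable lebesgue"
    using f \<psi> by (simp_all add: Lp_2_iff)
  have wm [measurable]: "w N \<in> borel_measurable lebesgue" for N
    by (rule measurable_completion) (use w in \<open>simp add: weight_limit_def\<close>)
  have C: "\<bar>w N x\<bar> \<le> C" and lim: "(\<lambda>N. w N x) \<longlonglongrightarrow> L" for N x using w by (auto simp: weight_limit_def)
  note CS = Lp_2_Cauchy_Schwarz [OF \<psi> f]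
  have i0: "integrable lebesgue (\<lambda>x. C * (\<bar>\<psi> x\<bar> * norm (f x)))"
    using integrable_norm [OF CS(1)] by simp
  have le: "norm ((w N x * \<psi> x) *\<^sub>R f x) \<le> C * (\<bar>\<psi> x\<bar> * norm (f x))" for N x
    using mult_right_mono [OF C, of "\<bar>\<psi> x\<bar> * norm (f x)" N x] by (simp add: abs_mult mult.assoc)
  show i: "integrable lebesgue (\<lambda>x. (w N x * \<psi> x) *\<^sub>R f x)" for N
  proof (rule Bochner_Integration.integrable_bound [OF i0 _ AE_I2])
    show "norm ((w N x * \<psi> x) *\<^sub>R f x) \<le> norm (C * (\<bar>\<psi> x\<bar> * norm (f x)))" for x
      using order_trans [OF le abs_ge_self] unfolding real_norm_def .
  qed measurable
  have C0: "0 \<le> C" using C [of 0 0] by linarith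
  have "norm (LINT x|lebesgue. (w N x * \<psi> x) *\<^sub>R f x) \<le> (LINT x|lebesgue. norm ((w N x * \<psi> x) *\<^sub>R f x))"
    by (rule integral_norm_bound)
  also have "\<dots> \<le> (LINT x|lebesgue. C * (\<bar>\<psi> x\<bar> * norm (f x)))"
    by (rule integral_mono [OF integrable_norm [OF i] i0 le])
  also have "\<dots> = C * (LINT x|lebesgue. \<bar>\<psi> x\<bar> * norm (f x))" by simp
  also have "\<dots> \<le> C * (Lp_norm 2 \<psi> * Lp_norm 2 f)" by (rule mult_left_mono [OF CS(2) C0])
  finally show "norm (LINT x|lebesgue. (w N x * \<psi> x) *\<^sub>R f x) \<le> C * Lp_norm 2 \<psi> * Lp_norm 2 f"
    by (simp add: mult.assoc)
  have "(\<lambda>N. LINT x|lebesgue. (w N x * \<psi> x) *\<^sub>R f x) \<longlonglongrightarrow> (LINT x|lebesgue. (L * \<psi> x) *\<^sub>R f x)"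
    by (rule integral_dominated_convergence [OF _ _ i0 AE_I2 AE_I2 [OF le]])
      (auto intro!: tendsto_intros lim)
  also have "(LINT x|lebesgue. (L * \<psi> x) *\<^sub>R f x) = L *\<^sub>R (LINT x|lebesgue. \<psi> x *\<^sub>R f x)"
    by (simp flip: scaleR_scaleR)
  finally show "(\<lambda>N. LINT x|lebesgue. (w N x * \<psi> x) *\<^sub>R f x) \<longlonglongrightarrow> L *\<^sub>R (LINT x|lebesgue. \<psi> x *\<^sub>R f x)" .
qed

lemma weight_limit_scaled_cutoff: "\<exists>C. weight_limit (scaled_cutoff :: nat \<Rightarrow> 'a::euclidean_space \<Rightarrow> real) 1 C"
proof -
  obtain C where C: "\<And>x::'a. \<bar>cutoff x\<bar> \<le> C" using bounded_iter_dir_deriv_cutoff [of "[]"] by auto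
  have "(\<lambda>N. scaled_cutoff N x) \<longlonglongrightarrow> 1" for x :: 'a
  proof (rule tendsto_eventually)
    obtain N0 where N0: "norm x \<le> real N0" using real_arch_simple by blast
    have "scaled_cutoff N x = 1" if "N0 \<le> N" for N
      unfolding scaled_cutoff_def using N0 that by (intro cutoff_eq_1) (simp add: field_simps)
    then show "\<forall>\<^sub>F N in sequentially. scaled_cutoff N x = 1" by (auto simp: eventually_sequentially)
  qed
  moreover have "\<bar>scaled_cutoff N x\<bar> \<le> C" for N and x :: 'a unfolding scaled_cutoff_def by (rule C)
  ultimately have "weight_limit (scaled_cutoff :: nat \<Rightarrow> 'a \<Rightarrow> real) 1 C"
    unfolding weight_limit_def by (auto intro!: smooth_measurable smooth_scaled_cutoff)
  then show ?thesis ..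
qed

lemma weight_limit_scaled:
  fixes \<theta> :: "'a::euclidean_space \<Rightarrow> real"
  assumes \<theta>: "continuous_on UNIV \<theta>" "\<And>x. \<bar>\<theta> x\<bar> \<le> C" and k: "k \<longlonglongrightarrow> 0" "\<And>N. \<bar>k N\<bar> \<le> B"
  shows "weight_limit (\<lambda>N x. k N * \<theta> ((1 / real (Suc N)) *\<^sub>R x)) 0 (B * C)"
  unfolding weight_limit_def
proof (intro conjI allI)
  show "(\<lambda>x. k N * \<theta> ((1 / real (Suc N)) *\<^sub>R x)) \<in> borel_measurable borel" for N
    by (intro borel_measurable_continuous_onI continuous_intros continuous_on_compose2 [OF \<theta>(1)]) auto
  show le: "\<bar>k N * \<theta> ((1 / real (Suc N)) *\<^sub>R x)\<bar> \<le> B * C" for N x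
    unfolding abs_mult by (intro mult_mono \<theta> k) (use k(2) [of N] in auto)
  fix x
  have "(\<lambda>N. C * \<bar>k N\<bar>) \<longlonglongrightarrow> C * \<bar>0\<bar>" by (intro tendsto_intros k)
  then have l: "(\<lambda>N. C * \<bar>k N\<bar>) \<longlonglongrightarrow> 0" by simp
  have n: "norm (k N * \<theta> ((1 / real (Suc N)) *\<^sub>R x)) \<le> C * \<bar>k N\<bar>" for N
    unfolding real_norm_def abs_mult mult.commute [of C] by (intro mult_left_mono \<theta>) simp
  show "(\<lambda>N. k N * \<theta> ((1 / real (Suc N)) *\<^sub>R x)) \<longlonglongrightarrow> 0"
    by (intro Lim_null_comparison [OF always_eventually l] allI n)
qed

lemma weight_limit_dir_deriv_scaled_cutoff:
  "\<exists>C. weight_limit (\<lambda>N. dir_deriv v (scaled_cutoff N) :: 'a::euclidean_space \<Rightarrow> real) 0 C"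
  "\<exists>C. weight_limit (\<lambda>N x::'a::euclidean_space. 2 * dir_deriv v (scaled_cutoff N) x) 0 C"
  "\<exists>C. weight_limit (\<lambda>N. dir_deriv v (dir_deriv v (scaled_cutoff N)) :: 'a \<Rightarrow> real) 0 C"
proof -
  obtain C1 where C1: "\<And>x::'a. \<bar>dir_deriv v cutoff x\<bar> \<le> C1"
    using bounded_iter_dir_deriv_cutoff [of "[v]"] by auto
  obtain C2 where C2: "\<And>x::'a. \<bar>dir_deriv v (dir_deriv v cutoff) x\<bar> \<le> C2"
    using bounded_iter_dir_deriv_cutoff [of "[v, v]"] by auto
  have k: "(\<lambda>N. 1 / real (Suc N)) \<longlonglongrightarrow> 0" by (rule LIMSEQ_Suc [OF lim_1_over_n])
  have k2: "(\<lambda>N. 2 * (1 / real (Suc N))) \<longlonglongrightarrow> 0" using tendsto_mult [OF tendsto_const k, of 2] by simp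
  have k3: "(\<lambda>N. (1 / real (Suc N)) * (1 / real (Suc N))) \<longlonglongrightarrow> 0" using tendsto_mult [OF k k] by simp
  have b: "\<bar>1 / real (Suc N)\<bar> \<le> 1" "\<bar>2 * (1 / real (Suc N))\<bar> \<le> 2"
    "\<bar>(1 / real (Suc N)) * (1 / real (Suc N))\<bar> \<le> 1" for N
  proof -
    have r: "0 \<le> 1 / real (Suc N)" "1 / real (Suc N) \<le> 1" by simp_all
    then show "\<bar>1 / real (Suc N)\<bar> \<le> 1" "\<bar>2 * (1 / real (Suc N))\<bar> \<le> 2" by linarith+
    show "\<bar>(1 / real (Suc N)) * (1 / real (Suc N))\<bar> \<le> 1"
      unfolding abs_mult using r by (intro mult_le_one) linarith+
  qed
  note c = smooth_continuous [OF smooth_dir_deriv [OF smooth_cutoff]]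
    smooth_continuous [OF smooth_dir_deriv [OF smooth_dir_deriv [OF smooth_cutoff]]]
  show "\<exists>C. weight_limit (\<lambda>N. dir_deriv v (scaled_cutoff N) :: 'a \<Rightarrow> real) 0 C"
    unfolding dir_deriv_scaled_cutoff by (rule exI, rule weight_limit_scaled [OF c(1) C1 k b(1)])
  show "\<exists>C. weight_limit (\<lambda>N x::'a. 2 * dir_deriv v (scaled_cutoff N) x) 0 C"
    unfolding dir_deriv_scaled_cutoff mult.assoc [symmetric]
    by (rule exI, rule weight_limit_scaled [OF c(1) C1 k2 b(2)])
  show "\<exists>C. weight_limit (\<lambda>N. dir_deriv v (dir_deriv v (scaled_cutoff N)) :: 'a \<Rightarrow> real) 0 C"
    unfolding dir_deriv2_scaled_cutoff mult.assoc [symmetric]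
    by (rule exI, rule weight_limit_scaled [OF c(2) C2 k3 b(3)])
qed

section \<open>Integration by parts against band-limited functions\<close>

lemma Lp_2_synth: "band_limited h \<Longrightarrow> Lp 2 (synth h)"
  by (intro synth_Lp2 band_limited_integrable band_limited_square_integrable)

lemma Lp_2_component:
  fixes g :: "'a::euclidean_space \<Rightarrow> complex^'n::finite"
  assumes "Lp 2 g" shows "Lp 2 (\<lambda>x. g x $ j)"
proof -
  have g [measurable]: "g \<in> borel_measurable lebesgue" and i: "integrable lebesgue (\<lambda>x. (norm (g x))\<^sup>2)"
    using assms by (simp_all add: Lp_2_iff)
  have "(\<lambda>y::complex^'n. y $ j) \<in> borel_measurable borel"
    by (intro borel_measurable_continuous_onI continuous_intros)
  then have m [measurable]: "(\<lambda>x. g x $ j) \<in> borel_measurable lebesgue" using g by measurable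
  have "integrable lebesgue (\<lambda>x. (norm (g x $ j))\<^sup>2)"
    by (rule Bochner_Integration.integrable_bound [OF i])
      (auto intro!: power_mono Finite_Cartesian_Product.norm_nth_le)
  then show ?thesis using m by (simp add: Lp_2_iff)
qed

text \<open>A weak gradient is defined by compactly supported functions, which
  \<open>synth h\<close> is not. Cutoff times \<open>synth h\<close> is admissible, and the term in
  which the derivative falls on the cutoff tends to zero.\<close>

lemma weak_gradient_synth:
  fixes f :: "real^'n::finite \<Rightarrow> complex"
  assumes f: "Lp 2 f" and g: "Lp 2 g" and wg: "weak_gradient f g" and h: "band_limited h"
  shows "(LINT x|lebesgue. synth (\<lambda>\<xi>. \<i> * of_real (\<xi> $ j) * h \<xi>) x *\<^sub>R f x) =
    - (LINT x|lebesgue. synth h x *\<^sub>R (g x $ j))"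
proof -
  let ?e = "axis j 1 :: real^'n" and ?\<psi> = "synth h"
  have e: "?e \<bullet> \<xi> = \<xi> $ j" for \<xi> :: "real^'n" by (simp add: inner_axis')
  have d: "dir_deriv ?e ?\<psi> = synth (\<lambda>\<xi>. \<i> * of_real (\<xi> $ j) * h \<xi>)"
    unfolding dir_deriv_synth [OF h] e ..
  have bd: "band_limited (\<lambda>\<xi>. \<i> * of_real (\<xi> $ j) * h \<xi>)" using band_limited_dir [OF h, of ?e] by (simp add: e)
  obtain C1 where C1: "weight_limit (scaled_cutoff :: nat \<Rightarrow> real^'n \<Rightarrow> real) 1 C1" using weight_limit_scaled_cutoff by blast
  obtain C2 where C2: "weight_limit (\<lambda>N. dir_deriv ?e (scaled_cutoff N)) 0 C2" using weight_limit_dir_deriv_scaled_cutoff(1) by blast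
  note W1 = weight_limit_pairing [OF C1 Lp_2_synth [OF bd] f]
  note W2 = weight_limit_pairing [OF C2 Lp_2_synth [OF h] f]
  note W3 = weight_limit_pairing [OF C1 Lp_2_synth [OF h] Lp_2_component [OF g, of j]]
  have "(LINT x|lebesgue. (scaled_cutoff N x * synth (\<lambda>\<xi>. \<i> * of_real (\<xi> $ j) * h \<xi>) x) *\<^sub>R f x)
      + (LINT x|lebesgue. (dir_deriv ?e (scaled_cutoff N) x * ?\<psi> x) *\<^sub>R f x)
      = - (LINT x|lebesgue. (scaled_cutoff N x * ?\<psi> x) *\<^sub>R (g x $ j))" for N
  proof -
    have "(LINT x|lebesgue. dir_deriv ?e (\<lambda>x. scaled_cutoff N x * ?\<psi> x) x *\<^sub>R f x) =
        - (LINT x|lebesgue. (scaled_cutoff N x * ?\<psi> x) *\<^sub>R (g x $ j))"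
      using wg test_function_scaled_cutoff_mult [OF smooth_synth [OF h]] unfolding weak_gradient_def by blast
    then show ?thesis
      unfolding dir_deriv_scaled_cutoff_mult [OF smooth_synth [OF h]] d scaleR_add_left
      using Bochner_Integration.integral_add [OF W1(1) W2(1), of N] by simp
  qed
  then have "(\<lambda>N. - (LINT x|lebesgue. (scaled_cutoff N x * ?\<psi> x) *\<^sub>R (g x $ j))) \<longlonglongrightarrow>
      1 *\<^sub>R (LINT x|lebesgue. synth (\<lambda>\<xi>. \<i> * of_real (\<xi> $ j) * h \<xi>) x *\<^sub>R f x)
      + 0 *\<^sub>R (LINT x|lebesgue. ?\<psi> x *\<^sub>R f x)"
    using tendsto_add [OF W1(3) W2(3)] by simp
  moreover have "(\<lambda>N. - (LINT x|lebesgue. (scaled_cutoff N x * ?\<psi> x) *\<^sub>R (g x $ j))) \<longlonglongrightarrow>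
      - (1 *\<^sub>R (LINT x|lebesgue. ?\<psi> x *\<^sub>R (g x $ j)))"
    by (intro tendsto_minus W3)
  ultimately show ?thesis using LIMSEQ_unique by fastforce
qed

text \<open>In Leibniz's rule only the term without derivatives of the cutoff survives the limit; it
  is the Laplacian of \<open>synth h\<close>, with multiplier - |\<xi>|^2. The constant is chosen
  before \<open>f\<close> and N so that one bound serves all times along a solution.\<close>

lemma laplacian_scaled_cutoff_synth:
  fixes h :: "real^'n::finite \<Rightarrow> complex"
  assumes h: "band_limited h"
  defines "K \<equiv> \<lambda>N x. \<Sum>j\<in>UNIV. dir_deriv (axis j 1) (dir_deriv (axis j 1) (\<lambda>x. scaled_cutoff N x * synth h x)) x"
  shows "\<exists>C. \<forall>f::real^'n \<Rightarrow> complex. Lp 2 f \<longrightarrow> (\<forall>N. integrable lebesgue (\<lambda>x. K N x *\<^sub>R f x)) \<and>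
      (\<forall>N. norm (LINT x|lebesgue. K N x *\<^sub>R f x) \<le> C * Lp_norm 2 f) \<and>
      (\<lambda>N. LINT x|lebesgue. K N x *\<^sub>R f x) \<longlonglongrightarrow>
        - (LINT x|lebesgue. synth (\<lambda>\<xi>. of_real ((norm \<xi>)\<^sup>2) * h \<xi>) x *\<^sub>R f x)"
proof -
  let ?e = "\<lambda>j. axis j 1 :: real^'n" and ?\<psi> = "synth h"
  have e: "?e j \<bullet> \<xi> = \<xi> $ j" for \<xi> j by (simp add: inner_axis')
  define h1 where "h1 j \<xi> = \<i> * of_real (\<xi> $ j) * h \<xi>" for j \<xi>
  define h2 where "h2 j \<xi> = \<i> * of_real (\<xi> $ j) * h1 j \<xi>" for j \<xi>
  have b1: "band_limited (h1 j)" for j unfolding h1_def [abs_def] using band_limited_dir [OF h, of "?e j"] by (simp add: e)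
  have b2: "band_limited (h2 j)" for j unfolding h2_def [abs_def] using band_limited_dir [OF b1, of "?e j"] by (simp add: e)
  have d1: "dir_deriv (?e j) ?\<psi> = synth (h1 j)" for j
    unfolding dir_deriv_synth [OF h] h1_def [abs_def] e ..
  have d2: "dir_deriv (?e j) (synth (h1 j)) = synth (h2 j)" for j
    unfolding dir_deriv_synth [OF b1] h2_def [abs_def] e ..
  obtain A where A: "weight_limit (scaled_cutoff :: nat \<Rightarrow> real^'n \<Rightarrow> real) 1 A" using weight_limit_scaled_cutoff by blast
  have "\<forall>j. \<exists>C. weight_limit (\<lambda>N x. 2 * dir_deriv (?e j) (scaled_cutoff N) x) 0 C"
    using weight_limit_dir_deriv_scaled_cutoff(2) by blast
  then obtain B where B: "\<And>j. weight_limit (\<lambda>N x. 2 * dir_deriv (?e j) (scaled_cutoff N) x) 0 (B j)" by metis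
  have "\<forall>j. \<exists>C. weight_limit (\<lambda>N. dir_deriv (?e j) (dir_deriv (?e j) (scaled_cutoff N))) 0 C"
    using weight_limit_dir_deriv_scaled_cutoff(3) by blast
  then obtain D where D: "\<And>j. weight_limit (\<lambda>N. dir_deriv (?e j) (dir_deriv (?e j) (scaled_cutoff N))) 0 (D j)" by metis
  have K_eq: "K N x *\<^sub>R f x = (\<Sum>j\<in>UNIV. (scaled_cutoff N x * synth (h2 j) x) *\<^sub>R f x
      + ((2 * dir_deriv (?e j) (scaled_cutoff N) x) * synth (h1 j) x) *\<^sub>R f x
      + (dir_deriv (?e j) (dir_deriv (?e j) (scaled_cutoff N)) x * ?\<psi> x) *\<^sub>R f x)" for N x and f :: "real^'n \<Rightarrow> complex"
    unfolding K_def dir_deriv2_scaled_cutoff_mult [OF smooth_synth [OF h]] d1 d2 scaleR_sum_left scaleR_add_left ..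
  define C where "C = (\<Sum>j\<in>UNIV. A * Lp_norm 2 (synth (h2 j)) + B j * Lp_norm 2 (synth (h1 j)) + D j * Lp_norm 2 ?\<psi>)"
  show ?thesis
  proof (intro exI [of _ C] conjI allI impI)
    fix f :: "real^'n \<Rightarrow> complex" assume f: "Lp 2 f"
    note W1 = weight_limit_pairing [OF A Lp_2_synth [OF b2] f]
    note W2 = weight_limit_pairing [OF B Lp_2_synth [OF b1] f]
    note W3 = weight_limit_pairing [OF D Lp_2_synth [OF h] f]
    show "integrable lebesgue (\<lambda>x. K N x *\<^sub>R f x)" for N
      unfolding K_eq
      by (intro Bochner_Integration.integrable_sum Bochner_Integration.integrable_add W1 W2 W3)
    have I: "(LINT x|lebesgue. K N x *\<^sub>R f x) = (\<Sum>j\<in>UNIV. (LINT x|lebesgue. (scaled_cutoff N x * synth (h2 j) x) *\<^sub>R f x)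
      + (LINT x|lebesgue. ((2 * dir_deriv (?e j) (scaled_cutoff N) x) * synth (h1 j) x) *\<^sub>R f x)
      + (LINT x|lebesgue. (dir_deriv (?e j) (dir_deriv (?e j) (scaled_cutoff N)) x * ?\<psi> x) *\<^sub>R f x))" for N
      unfolding K_eq
      by (subst Bochner_Integration.integral_sum)
        (intro Bochner_Integration.integrable_add W1 W2 W3 sum.cong refl, 
         simp only: Bochner_Integration.integral_add Bochner_Integration.integrable_add W1 W2 W3)
    show "norm (LINT x|lebesgue. K N x *\<^sub>R f x) \<le> C * Lp_norm 2 f" for N
      unfolding I C_def sum_distrib_right distrib_right
      by (intro sum_norm_le order_trans [OF norm_triangle_ineq] add_mono W1 W2 W3)
    have "(\<lambda>N. LINT x|lebesgue. K N x *\<^sub>R f x) \<longlonglongrightarrow>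
        (\<Sum>j\<in>UNIV. 1 *\<^sub>R (LINT x|lebesgue. synth (h2 j) x *\<^sub>R f x)
          + 0 *\<^sub>R (LINT x|lebesgue. synth (h1 j) x *\<^sub>R f x) + 0 *\<^sub>R (LINT x|lebesgue. ?\<psi> x *\<^sub>R f x))"
      unfolding I by (intro tendsto_sum tendsto_add W1 W2 W3)
    also have "(\<Sum>j\<in>UNIV. 1 *\<^sub>R (LINT x|lebesgue. synth (h2 j) x *\<^sub>R f x)
          + 0 *\<^sub>R (LINT x|lebesgue. synth (h1 j) x *\<^sub>R f x) + 0 *\<^sub>R (LINT x|lebesgue. ?\<psi> x *\<^sub>R f x))
        = (\<Sum>j\<in>UNIV. LINT x|lebesgue. synth (h2 j) x *\<^sub>R f x)" by simp
    also have "(\<Sum>j\<in>UNIV. LINT x|lebesgue. synth (h2 j) x *\<^sub>R f x) = (LINT x|lebesgue. (\<Sum>j\<in>UNIV. synth (h2 j) x) *\<^sub>R f x)"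
      unfolding scaleR_sum_left
      by (rule Bochner_Integration.integral_sum [symmetric]) (intro Lp_2_Cauchy_Schwarz(1) Lp_2_synth b2 f)
    also have "(\<lambda>x. \<Sum>j\<in>UNIV. synth (h2 j) x) = (\<lambda>x. - synth (\<lambda>\<xi>. of_real ((norm \<xi>)\<^sup>2) * h \<xi>) x)"
    proof
      fix x
      have "(\<Sum>j\<in>UNIV. synth (h2 j) x) = synth (\<lambda>\<xi>. \<Sum>j\<in>UNIV. h2 j \<xi>) x"
        by (rule synth_sum [symmetric]) (rule band_limited_integrable [OF b2])
      also have "(\<lambda>\<xi>. \<Sum>j\<in>UNIV. h2 j \<xi>) = (\<lambda>\<xi>. - (of_real ((norm \<xi>)\<^sup>2) * h \<xi>))"
      proof
        fix \<xi>
        have "h2 j \<xi> = - (of_real ((\<xi> $ j)\<^sup>2) * h \<xi>)" for j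
        proof -
          have "h2 j \<xi> = (\<i> * \<i>) * of_real ((\<xi> $ j)\<^sup>2) * h \<xi>"
            by (simp add: h2_def h1_def power2_eq_square del: i_squared)
          then show ?thesis by simp
        qed
        moreover have "(norm \<xi>)\<^sup>2 = (\<Sum>j\<in>UNIV. (\<xi> $ j)\<^sup>2)"
          unfolding power2_norm_eq_inner inner_vec_def by (simp add: power2_eq_square)
        ultimately show "(\<Sum>j\<in>UNIV. h2 j \<xi>) = - (of_real ((norm \<xi>)\<^sup>2) * h \<xi>)"
          by (simp only: sum_negf sum_distrib_right [symmetric] of_real_sum [symmetric])
      qed
      finally show "(\<Sum>j\<in>UNIV. synth (h2 j) x) = - synth (\<lambda>\<xi>. of_real ((norm \<xi>)\<^sup>2) * h \<xi>) x"
        by (simp only: synth_minus)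
    qed
    finally show "(\<lambda>N. LINT x|lebesgue. K N x *\<^sub>R f x) \<longlonglongrightarrow>
        - (LINT x|lebesgue. synth (\<lambda>\<xi>. of_real ((norm \<xi>)\<^sup>2) * h \<xi>) x *\<^sub>R f x)" by simp
  qed
qed

text \<open>A common interface for the weights that are paired with \<open>u t\<close>:
  \<open>synth h\<close> is known to be in L^2, whereas the Laplacian of cutoff times
  \<open>synth h\<close> is known only through its estimated action on L^2 functions.\<close>

definition L2_functional :: "('a::euclidean_space \<Rightarrow> real) \<Rightarrow> real \<Rightarrow> bool" where
  "L2_functional \<kappa> C \<longleftrightarrow> (\<forall>f::'a \<Rightarrow> complex. Lp 2 f \<longrightarrow> integrable lebesgue (\<lambda>x. \<kappa> x *\<^sub>R f x) \<and>
     norm (LINT x|lebesgue. \<kappa> x *\<^sub>R f x) \<le> C * Lp_norm 2 f)"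

lemma L2_functional_Lp_2: "Lp 2 \<kappa> \<Longrightarrow> L2_functional \<kappa> (Lp_norm 2 \<kappa>)"
  by (simp add: L2_functional_def Lp_2_Cauchy_Schwarz)

section \<open>Continuity and differentiability in time of pairings\<close>

lemma continuous_on_L2_dist:
  fixes u :: "real \<Rightarrow> real^'n::finite \<Rightarrow> complex" and F :: "real \<Rightarrow> 'b::metric_space"
  assumes u: "continuous_L2 u"
    and F: "\<And>s t. 0 \<le> s \<Longrightarrow> 0 \<le> t \<Longrightarrow> dist (F s) (F t) \<le> C * Lp_norm 2 (\<lambda>x. u s x - u t x)"
  shows "continuous_on {0..} F"
  unfolding continuous_on_def
proof
  fix t :: real assume t: "t \<in> {0..}"
  have "((\<lambda>s. C * Lp_norm 2 (\<lambda>x. u s x - u t x)) \<longlongrightarrow> C * 0) (at t within {0..})"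
    using u t unfolding continuous_L2_def by (intro tendsto_mult tendsto_const) auto
  then have l: "((\<lambda>s. C * Lp_norm 2 (\<lambda>x. u s x - u t x)) \<longlongrightarrow> 0) (at t within {0..})" by simp
  have "\<forall>\<^sub>F s in at t within {0..}. norm (dist (F s) (F t)) \<le> C * Lp_norm 2 (\<lambda>x. u s x - u t x)"
    using F t by (auto simp: eventually_at_filter)
  from Lim_null_comparison [OF this l] have "((\<lambda>s. dist (F s) (F t)) \<longlongrightarrow> 0) (at t within {0..})" .
  then show "(F \<longlongrightarrow> F t) (at t within {0..})"
    using tendsto_dist_iff by blast
qed

lemma continuous_L2_Lp: "continuous_L2 u \<Longrightarrow> 0 \<le> t \<Longrightarrow> Lp 2 (u t)"
  by (simp add: continuous_L2_def)

lemma continuous_L2_norm: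
  assumes u: "continuous_L2 u" shows "continuous_on {0..} (\<lambda>t. Lp_norm 2 (u t))"
proof (rule continuous_on_L2_dist [OF u, of _ 1])
  fix s t :: real assume st: "0 \<le> s" "0 \<le> t"
  note L = continuous_L2_Lp [OF u]
  have "Lp_norm 2 (u p) \<le> Lp_norm 2 (u q) + Lp_norm 2 (\<lambda>x. u p x - u q x)" if "0 \<le> p" "0 \<le> q" for p q
    using Lp_2_triangle(2) [OF L [OF that(2)] Lp_2_diff [OF L [OF that(1)] L [OF that(2)]]] by simp
  from this [OF st] this [OF st(2,1)] show "dist (Lp_norm 2 (u s)) (Lp_norm 2 (u t)) \<le> 1 * Lp_norm 2 (\<lambda>x. u s x - u t x)"
    by (simp add: dist_real_def Lp_norm_2_eq norm_minus_commute)
qed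

lemma L2_functional_diff:
  assumes "L2_functional \<kappa> C" and f: "Lp 2 f" and g: "Lp 2 g"
  shows "(LINT x|lebesgue. \<kappa> x *\<^sub>R (f x - g x :: complex)) = (LINT x|lebesgue. \<kappa> x *\<^sub>R f x) - (LINT x|lebesgue. \<kappa> x *\<^sub>R g x)"
  using assms unfolding L2_functional_def by (simp add: scaleR_diff_right)

lemma continuous_L2_pairing:
  assumes u: "continuous_L2 u" and \<kappa>: "L2_functional \<kappa> C"
  shows "continuous_on {0..} (\<lambda>t. LINT x|lebesgue. \<kappa> x *\<^sub>R u t x)"
proof (rule continuous_on_L2_dist [OF u, of _ C])
  fix s t :: real assume "0 \<le> s" "0 \<le> t"
  then have L: "Lp 2 (u s)" "Lp 2 (u t)" using continuous_L2_Lp [OF u] by auto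
  show "dist (LINT x|lebesgue. \<kappa> x *\<^sub>R u s x) (LINT x|lebesgue. \<kappa> x *\<^sub>R u t x) \<le> C * Lp_norm 2 (\<lambda>x. u s x - u t x)"
    unfolding dist_norm L2_functional_diff [OF \<kappa> L, symmetric]
    using \<kappa> Lp_2_diff [OF L] unfolding L2_functional_def by blast
qed

lemma C1_L2_pairing:
  assumes u: "C1_L2 u ut" and \<kappa>: "L2_functional \<kappa> C" and t: "0 \<le> t"
  shows "((\<lambda>t. LINT x|lebesgue. \<kappa> x *\<^sub>R u t x) has_vector_derivative (LINT x|lebesgue. \<kappa> x *\<^sub>R ut t x)) (at t within {0..})"
  unfolding has_vector_derivative_def
proof (rule has_derivativeI_sandwich [of 1])
  show "bounded_linear (\<lambda>v. v *\<^sub>R (LINT x|lebesgue. \<kappa> x *\<^sub>R ut t x))" by (rule bounded_linear_scaleR_left)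
  let ?q = "\<lambda>s x. (u s x - u t x) /\<^sub>R (s - t) - ut t x"
  have "((\<lambda>s. C * Lp_norm 2 (?q s)) \<longlongrightarrow> C * 0) (at t within {0..})"
    using u t unfolding C1_L2_def by (intro tendsto_mult tendsto_const) auto
  then show "((\<lambda>s. C * Lp_norm 2 (?q s)) \<longlongrightarrow> 0) (at t within {0..})" by simp
  fix s :: real assume s: "s \<in> {0..}" "s \<noteq> t"
  have L: "Lp 2 (u s)" "Lp 2 (u t)" "Lp 2 (ut t)"
    using u s t by (auto simp: C1_L2_def continuous_L2_def)
  note D = Lp_2_diff [OF L(1,2)]
  let ?I = "\<lambda>f. LINT x|lebesgue. \<kappa> x *\<^sub>R (f x :: complex)"
  have "?I (?q s) = ?I (\<lambda>x. (u s x - u t x) /\<^sub>R (s - t)) - ?I (ut t)"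
    by (rule L2_functional_diff [OF \<kappa> Lp_2_scale [OF D] L(3)])
  also have "?I (\<lambda>x. (u s x - u t x) /\<^sub>R (s - t)) = ?I (\<lambda>x. u s x - u t x) /\<^sub>R (s - t)"
    unfolding scaleR_left_commute [of "\<kappa> _"] by (rule integral_scaleR_right)
  also have "?I (\<lambda>x. u s x - u t x) = ?I (u s) - ?I (u t)"
    by (rule L2_functional_diff [OF \<kappa> L(1,2)])
  finally have eq: "?I (u s) - ?I (u t) - (s - t) *\<^sub>R ?I (ut t) = (s - t) *\<^sub>R ?I (?q s)"
    using s by (simp add: scaleR_diff_right)
  have "norm (?I (?q s)) \<le> C * Lp_norm 2 (?q s)"
    using \<kappa> Lp_2_diff [OF Lp_2_scale [OF D] L(3)] unfolding L2_functional_def by blast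
  then show "norm (?I (u s) - ?I (u t) - (s - t) *\<^sub>R ?I (ut t)) / norm (s - t) \<le> C * Lp_norm 2 (?q s)"
    unfolding eq using s by simp
qed simp

section \<open>The equation satisfied by the pairing with a band-limited function\<close>

lemma dir_deriv_product:
  fixes p :: "real \<Rightarrow> real" and q :: "'a::euclidean_space \<Rightarrow> real"
  assumes p: "smooth p" and q: "smooth q"
  shows "smooth (\<lambda>z. p (fst z) * q (snd z))"
    and "dir_deriv v (\<lambda>z. p (fst z) * q (snd z)) =
      (\<lambda>z. p (fst z) * dir_deriv (snd v) q (snd z) + dir_deriv (fst v) p (fst z) * q (snd z))"
proof -
  note P = dir_deriv_compose_linear [OF bounded_linear_fst p]
  note Q = dir_deriv_compose_linear [OF bounded_linear_snd q]
  show "smooth (\<lambda>z. p (fst z) * q (snd z))"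
    by (intro smooth_mult smooth_compose_linear [OF bounded_linear_fst p] smooth_compose_linear [OF bounded_linear_snd q])
  show "dir_deriv v (\<lambda>z. p (fst z) * q (snd z)) =
      (\<lambda>z. p (fst z) * dir_deriv (snd v) q (snd z) + dir_deriv (fst v) p (fst z) * q (snd z))"
    by (subst dir_deriv_mult) (simp_all add: P Q)
qed

text \<open>Test functions p (t) q (x) suffice for the equation in time. The directions
  \<open>e_t\<close> and \<open>e_x j\<close> differentiate one factor only, the other one being
  differentiated in direction 0.\<close>

lemma adjoint_op_product:
  fixes q :: "real^'n::finite \<Rightarrow> real"
  assumes p: "smooth p" and q: "smooth q"
  defines "L \<equiv> \<lambda>x. \<Sum>j\<in>UNIV. dir_deriv (axis j 1) (dir_deriv (axis j 1) q) x"
  shows "adjoint_op m (\<lambda>z. p (fst z) * q (snd z)) (t, x) =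
    dir_deriv 1 (dir_deriv 1 p) t * q x - p t * L x + m\<^sup>2 * p t * q x + dir_deriv 1 p t * L x"
proof -
  have t: "dir_deriv e_t (\<lambda>z. p (fst z) * q (snd z)) = (\<lambda>z. dir_deriv 1 p (fst z) * q (snd z))"
    if "smooth p" "smooth q" for p and q :: "real^'n \<Rightarrow> real"
    by (simp add: dir_deriv_product(2) [OF that] dir_deriv_0 [OF that(2)])
  have x: "dir_deriv (e_x j) (\<lambda>z. p (fst z) * q (snd z)) = (\<lambda>z. p (fst z) * dir_deriv (axis j 1) q (snd z))"
    if "smooth p" "smooth q" for p and q :: "real^'n \<Rightarrow> real" and j
    by (simp add: dir_deriv_product(2) [OF that] dir_deriv_0 [OF that(1)])
  show ?thesis
    unfolding adjoint_op_def L_def by (simp add: t x p q smooth_dir_deriv sum_distrib_left)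
qed

text \<open>Let a, d, c be the pairings of \<open>u t\<close> with multipliers 1, |\<xi>|^2 and
  |\<xi>|^2 + m^2 in front of \<open>h\<close>. The equation becomes (a' + d)' = - c, with the
  damping term appearing as the time derivative of d. It is obtained weakly from products of \<eta>
  (t) with cut-off \<open>synth h\<close>; the cutoff is removed before \<open>weak_ode\<close> is
  applied.\<close>

lemma weak_solution_pairing:
  fixes u :: "real \<Rightarrow> real^'n::finite \<Rightarrow> complex"
  assumes ws: "weak_solution m u0 u1 u ut" and h: "band_limited h" and t: "0 \<le> t"
  shows "((\<lambda>t. (LINT x|lebesgue. synth h x *\<^sub>R ut t x) + (LINT x|lebesgue. synth (\<lambda>\<xi>. of_real ((norm \<xi>)\<^sup>2) * h \<xi>) x *\<^sub>R u t x))
    has_vector_derivative - (LINT x|lebesgue. synth (\<lambda>\<xi>. of_real ((norm \<xi>)\<^sup>2 + m\<^sup>2) * h \<xi>) x *\<^sub>R u t x)) (at t within {0..})"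
proof -
  have C1: "C1_L2 u ut" and u: "continuous_L2 u" and ut: "continuous_L2 ut"
    using ws by (auto simp: weak_solution_def C1_L2_def)
  note Lu = continuous_L2_Lp [OF u]
  let ?\<psi> = "synth h" and ?hd = "\<lambda>\<xi>. of_real ((norm \<xi>)\<^sup>2) * h \<xi>" and ?hc = "\<lambda>\<xi>. of_real ((norm \<xi>)\<^sup>2 + m\<^sup>2) * h \<xi>"
  have bd: "band_limited ?hd" by (rule band_limited_mult_continuous [OF h]) (intro continuous_intros)
  have bc: "band_limited ?hc" by (rule band_limited_mult_continuous [OF h]) (intro continuous_intros)
  note pf = L2_functional_Lp_2 [OF Lp_2_synth]
  define a where "a t = (LINT x|lebesgue. ?\<psi> x *\<^sub>R u t x)" for t
  define d where "d t = (LINT x|lebesgue. synth ?hd x *\<^sub>R u t x)" for t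
  define c where "c t = (LINT x|lebesgue. synth ?hc x *\<^sub>R u t x)" for t
  have c_eq: "c t = d t + m\<^sup>2 *\<^sub>R a t" if "0 \<le> t" for t
  proof -
    have "synth ?hc x = synth ?hd x + m\<^sup>2 * ?\<psi> x" for x
    proof -
      have "?hc = (\<lambda>\<xi>. of_real ((norm \<xi>)\<^sup>2) * h \<xi> + of_real (m\<^sup>2) * h \<xi>)"
        by (simp add: distrib_right)
      then show ?thesis
        using synth_add [OF band_limited_integrable [OF bd], of "\<lambda>\<xi>. of_real (m\<^sup>2) * h \<xi>" x]
          band_limited_integrable [OF h] synth_scale [of "m\<^sup>2" h x] by simp
    qed
    then have "c t = (LINT x|lebesgue. synth ?hd x *\<^sub>R u t x + m\<^sup>2 *\<^sub>R (?\<psi> x *\<^sub>R u t x))"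
      by (simp add: c_def scaleR_add_left)
    also have "\<dots> = d t + m\<^sup>2 *\<^sub>R a t"
      unfolding d_def a_def integral_scaleR_right [symmetric]
      by (intro Bochner_Integration.integral_add integrable_scaleR_right Lp_2_Cauchy_Schwarz(1)
          Lp_2_synth bd h Lu [OF that])
    finally show ?thesis .
  qed
  define \<kappa> where "\<kappa> N x = scaled_cutoff N x * ?\<psi> x" for N x
  define K where "K N x = (\<Sum>j\<in>UNIV. dir_deriv (axis j 1) (dir_deriv (axis j 1) (\<kappa> N)) x)" for N x
  have \<kappa>': "\<kappa> N = (\<lambda>x. scaled_cutoff N x * ?\<psi> x)" for N by (auto simp: \<kappa>_def)
  have sm\<kappa>: "smooth (\<kappa> N)" for N unfolding \<kappa>' by (rule smooth_mult [OF smooth_scaled_cutoff smooth_synth [OF h]])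
  have "\<exists>C. \<forall>f::real^'n \<Rightarrow> complex. Lp 2 f \<longrightarrow> (\<forall>N. integrable lebesgue (\<lambda>x. K N x *\<^sub>R f x)) \<and>
      (\<forall>N. norm (LINT x|lebesgue. K N x *\<^sub>R f x) \<le> C * Lp_norm 2 f) \<and>
      (\<lambda>N. LINT x|lebesgue. K N x *\<^sub>R f x) \<longlonglongrightarrow> - (LINT x|lebesgue. synth ?hd x *\<^sub>R f x)"
    unfolding K_def \<kappa>' by (rule laplacian_scaled_cutoff_synth [OF h])
  then obtain CK where CK: "\<And>f::real^'n \<Rightarrow> complex. Lp 2 f \<Longrightarrow> (\<forall>N. integrable lebesgue (\<lambda>x. K N x *\<^sub>R f x)) \<and>
      (\<forall>N. norm (LINT x|lebesgue. K N x *\<^sub>R f x) \<le> CK * Lp_norm 2 f) \<and>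
      (\<lambda>N. LINT x|lebesgue. K N x *\<^sub>R f x) \<longlonglongrightarrow> - (LINT x|lebesgue. synth ?hd x *\<^sub>R f x)"
    by blast
  obtain C0 where C0: "weight_limit (scaled_cutoff :: nat \<Rightarrow> real^'n \<Rightarrow> real) 1 C0" using weight_limit_scaled_cutoff by blast
  note W = weight_limit_pairing [OF C0 Lp_2_synth [OF h], folded \<kappa>_def]
  define CA where "CA = C0 * Lp_norm 2 ?\<psi>"
  have funA: "L2_functional (\<kappa> N) CA" and funK: "L2_functional (K N) CK" for N
    using W CK by (auto simp: L2_functional_def CA_def)
  define A where "A N t = (LINT x|lebesgue. \<kappa> N x *\<^sub>R u t x)" for N t
  define L where "L N t = (LINT x|lebesgue. K N x *\<^sub>R u t x)" for N t
  have A_lim: "(\<lambda>N. A N t) \<longlonglongrightarrow> a t" and L_lim: "(\<lambda>N. L N t) \<longlonglongrightarrow> - d t"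
    and A_le: "norm (A N t) \<le> CA * Lp_norm 2 (u t)" and L_le: "norm (L N t) \<le> CK * Lp_norm 2 (u t)"
    and iA: "integrable lebesgue (\<lambda>x. \<kappa> N x *\<^sub>R u t x)" and iK: "integrable lebesgue (\<lambda>x. K N x *\<^sub>R u t x)"
    if "0 \<le> t" for t N
    using W(3) [OF Lu [OF that]] CK [OF Lu [OF that]] funA funK Lu [OF that]
    by (auto simp: A_def L_def a_def d_def L2_functional_def)
  have contA: "continuous_on {0..} (A N)" and contL: "continuous_on {0..} (L N)" for N
    unfolding A_def L_def by (rule continuous_L2_pairing [OF u funA], rule continuous_L2_pairing [OF u funK])
  have conta: "continuous_on {0..} a" and contc: "continuous_on {0..} c" and contd: "continuous_on {0..} d"
    unfolding a_def c_def d_def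
    by (rule continuous_L2_pairing [OF u pf [OF h]], rule continuous_L2_pairing [OF u pf [OF bc]],
        rule continuous_L2_pairing [OF u pf [OF bd]])
  show ?thesis
    unfolding c_def [symmetric] d_def [symmetric]
  proof (rule weak_ode [of a _ c d, OF _ _ contc contd _ t])
    show "(a has_vector_derivative (LINT x|lebesgue. ?\<psi> x *\<^sub>R ut t x)) (at t within {0..})" if "0 \<le> t" for t
      unfolding a_def [abs_def] by (rule C1_L2_pairing [OF C1 pf [OF h] that])
    show "continuous_on {0..} (\<lambda>t. LINT x|lebesgue. ?\<psi> x *\<^sub>R ut t x)"
      by (rule continuous_L2_pairing [OF ut pf [OF h]])
    fix \<eta> :: "real \<Rightarrow> real" and \<alpha> \<beta> T :: real
    assume \<eta>: "smooth \<eta>" "0 < \<alpha>" "\<beta> < T" "\<And>t. t \<notin> {\<alpha>..\<beta>} \<Longrightarrow> \<eta> t = 0"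
    let ?d1 = "dir_deriv 1 \<eta>" and ?d2 = "dir_deriv 1 (dir_deriv 1 \<eta>)"
    have d1_0: "?d1 t = 0" if "t \<notin> {\<alpha>..\<beta>}" for t
      by (rule dir_deriv_eq_0_outside_closed [OF _ \<eta>(4) that]) auto
    have d2_0: "?d2 t = 0" if "t \<notin> {\<alpha>..\<beta>}" for t
      by (rule dir_deriv_eq_0_outside_closed [OF _ d1_0 that]) auto
    have cont\<eta>: "continuous_on S \<eta>" "continuous_on S ?d1" "continuous_on S ?d2" for S
      by (intro continuous_on_subset [OF smooth_continuous subset_UNIV] smooth_dir_deriv \<eta>)+
    define F where "F t = ?d2 t *\<^sub>R a t + \<eta> t *\<^sub>R c t - ?d1 t *\<^sub>R d t" for t
    define FN where "FN N t = ?d2 t *\<^sub>R A N t - \<eta> t *\<^sub>R L N t + (m\<^sup>2 * \<eta> t) *\<^sub>R A N t + ?d1 t *\<^sub>R L N t" for N t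
    have F_0: "F t = 0" "FN N t = 0" if "t \<notin> {\<alpha>..\<beta>}" for t N
      unfolding F_def FN_def using \<eta>(4) [OF that] d1_0 [OF that] d2_0 [OF that] by simp_all
    have weak: "(LINT t:{0<..}|lebesgue. FN N t) = 0" for N
    proof -
      let ?\<phi> = "\<lambda>z. \<eta> (fst z) * \<kappa> N (snd z)"
      obtain S where S: "compact S" "\<And>x. x \<notin> S \<Longrightarrow> \<kappa> N x = 0"
        using test_function_scaled_cutoff_mult [OF smooth_synth [OF h], of N] unfolding test_function_def \<kappa>' by blast
      have "test_function ({0<..} \<times> UNIV) ?\<phi>"
        unfolding test_function_def
      proof (intro conjI exI [of _ "{\<alpha>..\<beta>} \<times> S"] allI impI)
        show "smooth ?\<phi>" by (rule dir_deriv_product(1) [OF \<eta>(1) sm\<kappa>])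
        show "compact ({\<alpha>..\<beta>} \<times> S)" by (intro compact_Times S compact_Icc)
        show "{\<alpha>..\<beta>} \<times> S \<subseteq> {0<..} \<times> UNIV" using \<eta>(2) by auto
        show "?\<phi> z = 0" if "z \<notin> {\<alpha>..\<beta>} \<times> S" for z
          using that \<eta>(4) [of "fst z"] S(2) [of "snd z"] by (cases z) auto
      qed
      then have "(LINT t:{0<..}|lebesgue. (LINT x|lebesgue. adjoint_op m ?\<phi> (t, x) *\<^sub>R u t x)) = 0"
        using ws unfolding weak_solution_def by blast
      moreover have "(LINT x|lebesgue. adjoint_op m ?\<phi> (t, x) *\<^sub>R u t x) = FN N t" if "t \<in> {0<..}" for t
      proof -
        have t: "0 \<le> t" using that by simp
        have "(LINT x|lebesgue. adjoint_op m ?\<phi> (t, x) *\<^sub>R u t x) =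
          (LINT x|lebesgue. ?d2 t *\<^sub>R (\<kappa> N x *\<^sub>R u t x) - \<eta> t *\<^sub>R (K N x *\<^sub>R u t x)
            + (m\<^sup>2 * \<eta> t) *\<^sub>R (\<kappa> N x *\<^sub>R u t x) + ?d1 t *\<^sub>R (K N x *\<^sub>R u t x))"
          unfolding adjoint_op_product [OF \<eta>(1) sm\<kappa>] K_def [symmetric]
          by (simp only: scaleR_add_left scaleR_diff_left scaleR_scaleR)
        also have "\<dots> = FN N t"
        proof -
          have "(LINT x|lebesgue. p *\<^sub>R X x - q *\<^sub>R Y x + r *\<^sub>R X x + s *\<^sub>R Y x) =
              p *\<^sub>R (LINT x|lebesgue. X x) - q *\<^sub>R (LINT x|lebesgue. Y x)
                + r *\<^sub>R (LINT x|lebesgue. X x) + s *\<^sub>R (LINT x|lebesgue. Y x)"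
            if "integrable lebesgue X" "integrable lebesgue Y"
            for X Y :: "real^'n \<Rightarrow> complex" and p q r s
            using that by simp
          from this [OF iA [OF t] iK [OF t]] show ?thesis unfolding FN_def A_def L_def .
        qed
        finally show ?thesis .
      qed
      ultimately show ?thesis
        by (subst (asm) set_lebesgue_integral_cong) auto
    qed
    have "bounded (\<eta> ` {0..T})" "bounded (?d1 ` {0..T})" "bounded (?d2 ` {0..T})"
      "bounded ((\<lambda>t. Lp_norm 2 (u t)) ` {0..T})"
      by (intro compact_imp_bounded compact_continuous_image cont\<eta> compact_Icc
          continuous_on_subset [OF continuous_L2_norm [OF u]]; simp)+
    then obtain E0 E1 E2 U where E: "\<And>t. t \<in> {0..T} \<Longrightarrow> \<bar>\<eta> t\<bar> \<le> E0" "\<And>t. t \<in> {0..T} \<Longrightarrow> \<bar>?d1 t\<bar> \<le> E1"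
        "\<And>t. t \<in> {0..T} \<Longrightarrow> \<bar>?d2 t\<bar> \<le> E2" and U: "\<And>t. t \<in> {0..T} \<Longrightarrow> Lp_norm 2 (u t) \<le> U"
      unfolding bounded_iff by fastforce
    define M where "M = E2 * (\<bar>CA\<bar> * U) + E0 * (\<bar>CK\<bar> * U) + m\<^sup>2 * E0 * (\<bar>CA\<bar> * U) + E1 * (\<bar>CK\<bar> * U)"
    have FN_le: "norm (FN N t) \<le> M" if t: "t \<in> {0..T}" for N t
    proof -
      have "0 \<le> t" using t by simp
      have "C * Lp_norm 2 (u t) \<le> \<bar>C\<bar> * U" for C
        using U [OF t] by (intro mult_mono) auto
      then have A: "norm (A N t) \<le> \<bar>CA\<bar> * U" and L: "norm (L N t) \<le> \<bar>CK\<bar> * U"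
        using A_le [OF \<open>0 \<le> t\<close>] L_le [OF \<open>0 \<le> t\<close>] order_trans by blast+
      have E': "0 \<le> E0" "0 \<le> E1" "0 \<le> E2" "0 \<le> m\<^sup>2" "\<bar>m\<^sup>2 * \<eta> t\<bar> \<le> m\<^sup>2 * E0"
        using E [OF t] by (auto simp: abs_mult intro: mult_left_mono)
      have "norm (FN N t) \<le> norm (?d2 t *\<^sub>R A N t) + norm (\<eta> t *\<^sub>R L N t)
          + norm ((m\<^sup>2 * \<eta> t) *\<^sub>R A N t) + norm (?d1 t *\<^sub>R L N t)"
        unfolding FN_def
        by (intro order_trans [OF norm_triangle_ineq] order_trans [OF norm_triangle_ineq4] add_mono order_refl)
      also have "\<dots> \<le> M"
        unfolding norm_scaleR real_norm_def M_def
        using E' E [OF t] A L by (intro add_mono mult_mono) auto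
      finally show ?thesis .
    qed
    have borelF: "(\<lambda>t. indicator {0<..} t *\<^sub>R G t) \<in> borel_measurable lebesgue"
      if "continuous_on {0..} G" for G :: "real \<Rightarrow> complex"
    proof -
      have "continuous_on {0<..} G" by (rule continuous_on_subset [OF that]) auto
      then have "(\<lambda>t. indicator {0<..} t *\<^sub>R G t) \<in> borel_measurable borel"
        by (intro borel_measurable_continuous_on_indicator) auto
      then show ?thesis by (intro measurable_completion) simp
    qed
    have contF: "continuous_on {0..} F" "continuous_on {0..} (FN N)" for N
      unfolding F_def FN_def by (intro continuous_intros cont\<eta> conta contc contd contA contL)+
    \<comment> \<open>The limit in N is known for each t. The bound \<open>M\<close> does not depend
      on N, and \<open>FN N\<close> vanishes outside the support of \<eta>, so the limit passes
      through the time integral.\<close>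
    have "(\<lambda>N. LINT t:{0<..}|lebesgue. FN N t) \<longlonglongrightarrow> (LINT t:{0<..}|lebesgue. F t)"
      unfolding set_lebesgue_integral_def
    proof (rule integral_dominated_convergence [OF borelF [OF contF(1)] borelF [OF contF(2)]])
      have "integrable lborel (\<lambda>t. indicator {0..T} t *\<^sub>R M)"
        by (rule borel_integrable_compact) auto
      then show "integrable lebesgue (\<lambda>t. indicator {0..T} t *\<^sub>R M)"
        by (subst integrable_completion) auto
      have "(\<lambda>N. FN N t) \<longlonglongrightarrow> F t" if t: "0 \<le> t" for t
      proof -
        have "(\<lambda>N. FN N t) \<longlonglongrightarrow> ?d2 t *\<^sub>R a t - \<eta> t *\<^sub>R (- d t) + (m\<^sup>2 * \<eta> t) *\<^sub>R a t + ?d1 t *\<^sub>R (- d t)"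
          unfolding FN_def by (intro tendsto_intros A_lim L_lim t)
        also have "?d2 t *\<^sub>R a t - \<eta> t *\<^sub>R (- d t) + (m\<^sup>2 * \<eta> t) *\<^sub>R a t + ?d1 t *\<^sub>R (- d t) = F t"
          unfolding F_def c_eq [OF t] by (simp add: scaleR_add_right mult.commute)
        finally show ?thesis .
      qed
      then show "AE t in lebesgue. (\<lambda>N. indicator {0<..} t *\<^sub>R FN N t) \<longlonglongrightarrow> indicator {0<..} t *\<^sub>R F t"
        by (intro AE_I2) (auto simp: indicator_def)
      show "AE t in lebesgue. norm (indicator {0<..} t *\<^sub>R FN N t) \<le> indicator {0..T} t *\<^sub>R M" for N
      proof (intro AE_I2)
        fix t
        show "norm (indicator {0<..} t *\<^sub>R FN N t) \<le> indicator {0..T} t *\<^sub>R M"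
        proof (cases "t \<in> {0..T}")
          case True
          then show ?thesis using FN_le [OF True, of N] order_trans [OF norm_ge_zero FN_le [OF True, of N]]
            by (auto simp: indicator_def)
        next
          case False
          then show ?thesis using F_0(2) [of t N] \<eta>(2,3) by (auto simp: indicator_def)
        qed
      qed
    qed
    then have z: "(LINT t:{0<..}|lebesgue. F t) = 0"
      unfolding weak by (simp add: LIMSEQ_const_iff)
    have "F absolutely_integrable_on {0..T}"
      by (rule absolutely_integrable_continuous_real) (rule continuous_on_subset [OF contF(1)], auto)
    from set_lebesgue_integral_eq_integral [OF this]
    have "(F has_integral (LINT t:{0..T}|lebesgue. F t)) {0..T}"
      by (simp add: has_integral_integral)
    \<comment> \<open>The two domains differ only where F is zero, since \<eta> lives between
      \<alpha> > 0 and \<beta> < T.\<close>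
    also have "(LINT t:{0..T}|lebesgue. F t) = (LINT t:{0<..}|lebesgue. F t)"
      unfolding set_lebesgue_integral_def
    proof (rule Bochner_Integration.integral_cong [OF refl])
      fix t
      show "indicator {0..T} t *\<^sub>R F t = indicator {0<..} t *\<^sub>R F t"
        using F_0(1) [of t] \<eta>(2,3) by (cases "t \<in> {\<alpha>..\<beta>}") (auto simp: indicator_def)
    qed
    finally have "(F has_integral 0) {0..T}" unfolding z .
    then show "((\<lambda>t. ?d2 t *\<^sub>R a t + \<eta> t *\<^sub>R c t - ?d1 t *\<^sub>R d t) has_integral 0) {0..T}"
      unfolding F_def [abs_def] .
  qed
qed

section \<open>Duality with the scalar equation\<close>

definition multiplier :: "('a::euclidean_space \<Rightarrow> real) \<Rightarrow> bool" where
  "multiplier \<mu> \<longleftrightarrow> \<mu> \<in> borel_measurable borel \<and> (\<forall>R. \<exists>B. \<forall>\<xi>. norm \<xi> \<le> R \<longrightarrow> \<bar>\<mu> \<xi>\<bar> \<le> B)"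

text \<open>Formally the Fourier multiplier \<mu> acts between \<open>H\<close> and
  \<open>f\<close>. Keeping \<open>H\<close> fixed and \<mu> as an argument reduces linearity,
  bounds and time derivatives to statements about real functions of \<xi>.\<close>

definition mpair :: "('a::euclidean_space \<Rightarrow> complex) \<Rightarrow> ('a \<Rightarrow> real) \<Rightarrow> ('a \<Rightarrow> complex) \<Rightarrow> complex" where
  "mpair H \<mu> f = (LINT x|lebesgue. synth (\<lambda>\<xi>. of_real (\<mu> \<xi>) * H \<xi>) x *\<^sub>R f x)"

lemma multiplier_continuous:
  fixes \<mu> :: "'a::euclidean_space \<Rightarrow> real"
  assumes "continuous_on UNIV \<mu>" shows "multiplier \<mu>"
  unfolding multiplier_def
proof (intro conjI allI)
  show "\<mu> \<in> borel_measurable borel" using assms by (rule borel_measurable_continuous_onI)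
  fix R
  have "bounded (\<mu> ` cball 0 R)"
    by (intro compact_imp_bounded compact_continuous_image continuous_on_subset [OF assms]) auto
  then obtain B where "\<forall>y\<in>\<mu> ` cball 0 R. norm y \<le> B" unfolding bounded_iff by blast
  then show "\<exists>B. \<forall>\<xi>. norm \<xi> \<le> R \<longrightarrow> \<bar>\<mu> \<xi>\<bar> \<le> B" by (intro exI [of _ B]) auto
qed

lemma multiplier_add:
  assumes "multiplier \<mu>" "multiplier \<nu>" shows "multiplier (\<lambda>\<xi>. \<mu> \<xi> + \<nu> \<xi>)"
  unfolding multiplier_def
proof (intro conjI allI)
  show "(\<lambda>\<xi>. \<mu> \<xi> + \<nu> \<xi>) \<in> borel_measurable borel"
    using assms unfolding multiplier_def by (intro borel_measurable_add) auto
  fix R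
  obtain B C where "\<forall>\<xi>. norm \<xi> \<le> R \<longrightarrow> \<bar>\<mu> \<xi>\<bar> \<le> B" "\<forall>\<xi>. norm \<xi> \<le> R \<longrightarrow> \<bar>\<nu> \<xi>\<bar> \<le> C"
    using assms unfolding multiplier_def by blast
  then show "\<exists>B. \<forall>\<xi>. norm \<xi> \<le> R \<longrightarrow> \<bar>\<mu> \<xi> + \<nu> \<xi>\<bar> \<le> B"
    by (intro exI [of _ "B + C"] allI impI order_trans [OF abs_triangle_ineq] add_mono) auto
qed

lemma multiplier_mult:
  assumes "multiplier \<mu>" "multiplier \<nu>" shows "multiplier (\<lambda>\<xi>. \<mu> \<xi> * \<nu> \<xi>)"
  unfolding multiplier_def
proof (intro conjI allI)
  show "(\<lambda>\<xi>. \<mu> \<xi> * \<nu> \<xi>) \<in> borel_measurable borel"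
    using assms unfolding multiplier_def by (intro borel_measurable_times) auto
  fix R
  obtain B C where "\<forall>\<xi>. norm \<xi> \<le> R \<longrightarrow> \<bar>\<mu> \<xi>\<bar> \<le> B" "\<forall>\<xi>. norm \<xi> \<le> R \<longrightarrow> \<bar>\<nu> \<xi>\<bar> \<le> C"
    using assms unfolding multiplier_def by blast
  then have "\<bar>\<mu> \<xi> * \<nu> \<xi>\<bar> \<le> \<bar>B\<bar> * \<bar>C\<bar>" if "norm \<xi> \<le> R" for \<xi>
    unfolding abs_mult using that by (intro mult_mono) (auto intro: order_trans [OF _ abs_ge_self])
  then show "\<exists>B. \<forall>\<xi>. norm \<xi> \<le> R \<longrightarrow> \<bar>\<mu> \<xi> * \<nu> \<xi>\<bar> \<le> B" by blast
qed

lemma multiplier_const: "multiplier (\<lambda>\<xi>. c)"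
  by (rule multiplier_continuous) (rule continuous_on_const)

lemma multiplier_cmult: "multiplier \<mu> \<Longrightarrow> multiplier (\<lambda>\<xi>. c * \<mu> \<xi>)"
  by (rule multiplier_mult [OF multiplier_const])

lemma multiplier_minus: "multiplier \<mu> \<Longrightarrow> multiplier (\<lambda>\<xi>. - \<mu> \<xi>)"
  using multiplier_cmult [of \<mu> "-1"] by simp

lemma multiplier_norm: "multiplier (\<lambda>\<xi>. (norm \<xi>)\<^sup>2 + c)" "multiplier (\<lambda>\<xi>. (norm \<xi>)\<^sup>2)"
  by (intro multiplier_continuous continuous_intros)+

lemma band_limited_multiplier:
  assumes H: "band_limited H" and \<mu>: "multiplier \<mu>"
  shows "band_limited (\<lambda>\<xi>. of_real (\<mu> \<xi>) * H \<xi>)"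
proof (rule band_limited_mult [OF H])
  have [measurable]: "\<mu> \<in> borel_measurable borel" using \<mu> by (simp add: multiplier_def)
  show "(\<lambda>\<xi>. complex_of_real (\<mu> \<xi>)) \<in> borel_measurable borel" by measurable
  show "\<exists>B. \<forall>\<xi>. norm \<xi> \<le> R \<longrightarrow> norm (complex_of_real (\<mu> \<xi>)) \<le> B" for R
    using \<mu> by (simp add: multiplier_def)
qed

lemma Lp_norm_2_multiplier:
  assumes H: "band_limited H" and \<mu>: "multiplier \<mu>" and B: "\<And>\<xi>. H \<xi> \<noteq> 0 \<Longrightarrow> \<bar>\<mu> \<xi>\<bar> \<le> B" "0 \<le> B"
  shows "Lp_norm 2 (\<lambda>\<xi>. of_real (\<mu> \<xi>) * H \<xi>) \<le> B * Lp_norm 2 H"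
proof -
  note b = band_limited_multiplier [OF H \<mu>]
  have "(norm (of_real (\<mu> \<xi>) * H \<xi>))\<^sup>2 \<le> B\<^sup>2 * (norm (H \<xi>))\<^sup>2" for \<xi>
  proof (cases "H \<xi> = 0")
    case False
    have "\<bar>\<mu> \<xi>\<bar> * norm (H \<xi>) \<le> B * norm (H \<xi>)" using B(1) [OF False] by (rule mult_right_mono) simp
    then have "(\<bar>\<mu> \<xi>\<bar> * norm (H \<xi>))\<^sup>2 \<le> (B * norm (H \<xi>))\<^sup>2" by (rule power_mono) simp
    then show ?thesis by (simp add: norm_mult power_mult_distrib)
  qed simp
  then have "(LINT \<xi>|lborel. (norm (of_real (\<mu> \<xi>) * H \<xi>))\<^sup>2) \<le> (LINT \<xi>|lborel. B\<^sup>2 * (norm (H \<xi>))\<^sup>2)"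
    by (intro integral_mono band_limited_square_integrable b integrable_mult_right H)
  then have "sqrt (LINT \<xi>|lborel. (norm (of_real (\<mu> \<xi>) * H \<xi>))\<^sup>2) \<le> sqrt (B\<^sup>2 * (LINT \<xi>|lborel. (norm (H \<xi>))\<^sup>2))"
    by simp
  then show ?thesis
    unfolding Lp_2_lborel(2) [OF band_limited_measurable [OF b]] Lp_2_lborel(2) [OF band_limited_measurable [OF H]]
    using B(2) by (simp only: real_sqrt_mult real_sqrt_abs abs_of_nonneg)
qed

lemma mpair_linear:
  assumes H: "band_limited H" and \<mu>: "multiplier \<mu>" and \<nu>: "multiplier \<nu>" and f: "Lp 2 f"
  shows "mpair H (\<lambda>\<xi>. \<mu> \<xi> + c * \<nu> \<xi>) f = mpair H \<mu> f + c *\<^sub>R mpair H \<nu> f"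
proof -
  note b = band_limited_multiplier [OF H \<mu>] band_limited_multiplier [OF H \<nu>]
  have "synth (\<lambda>\<xi>. of_real (\<mu> \<xi> + c * \<nu> \<xi>) * H \<xi>) x =
      synth (\<lambda>\<xi>. of_real (\<mu> \<xi>) * H \<xi>) x + c * synth (\<lambda>\<xi>. of_real (\<nu> \<xi>) * H \<xi>) x" for x
  proof -
    have "(\<lambda>\<xi>. of_real (\<mu> \<xi> + c * \<nu> \<xi>) * H \<xi>) =
        (\<lambda>\<xi>. of_real (\<mu> \<xi>) * H \<xi> + of_real c * (of_real (\<nu> \<xi>) * H \<xi>))"
      by (simp add: distrib_right mult.assoc)
    then show ?thesis
      using synth_add [OF band_limited_integrable [OF b(1)] integrable_mult_right [OF band_limited_integrable [OF b(2)]], of c]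
      by (simp only: synth_scale)
  qed
  then have "mpair H (\<lambda>\<xi>. \<mu> \<xi> + c * \<nu> \<xi>) f = (LINT x|lebesgue. synth (\<lambda>\<xi>. of_real (\<mu> \<xi>) * H \<xi>) x *\<^sub>R f x
      + c *\<^sub>R (synth (\<lambda>\<xi>. of_real (\<nu> \<xi>) * H \<xi>) x *\<^sub>R f x))"
    unfolding mpair_def by (simp only: scaleR_add_left scaleR_scaleR)
  also have "\<dots> = mpair H \<mu> f + c *\<^sub>R mpair H \<nu> f"
    unfolding mpair_def integral_scaleR_right [symmetric]
    by (intro Bochner_Integration.integral_add integrable_scaleR_right Lp_2_Cauchy_Schwarz(1) Lp_2_synth b f)
  finally show ?thesis .
qed

lemma mpair_bound:
  fixes H :: "'a::euclidean_space \<Rightarrow> complex"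
  assumes H: "band_limited H" and \<mu>: "multiplier \<mu>" and f: "Lp 2 f"
    and B: "\<And>\<xi>. H \<xi> \<noteq> 0 \<Longrightarrow> \<bar>\<mu> \<xi>\<bar> \<le> B" "0 \<le> B"
  shows "norm (mpair H \<mu> f) \<le> sqrt (2 * pi) ^ DIM('a) * Lp_norm 2 f * B * Lp_norm 2 H"
proof -
  note b = band_limited_multiplier [OF H \<mu>]
  let ?h = "\<lambda>\<xi>. of_real (\<mu> \<xi>) * H \<xi>"
  have "norm (mpair H \<mu> f) \<le> Lp_norm 2 (synth ?h) * Lp_norm 2 f"
    unfolding mpair_def by (rule Lp_2_Cauchy_Schwarz(3) [OF Lp_2_synth [OF b] f])
  also have "\<dots> \<le> (sqrt (2 * pi) ^ DIM('a) * (B * Lp_norm 2 H)) * Lp_norm 2 f"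
  proof (rule mult_right_mono)
    have "Lp_norm 2 (synth ?h) \<le> sqrt (2 * pi) ^ DIM('a) * Lp_norm 2 ?h"
      by (intro synth_Lp2_bound band_limited_integrable band_limited_square_integrable b)
    also have "\<dots> \<le> sqrt (2 * pi) ^ DIM('a) * (B * Lp_norm 2 H)"
      by (intro mult_left_mono Lp_norm_2_multiplier H \<mu> B) auto
    finally show "Lp_norm 2 (synth ?h) \<le> sqrt (2 * pi) ^ DIM('a) * (B * Lp_norm 2 H)" .
  qed simp
  finally show ?thesis by (simp only: mult_ac)
qed

text \<open>The mean value inequality is used twice, hence no factor 1/2; \<open>y\<close> may lie
  on either side of \<open>x\<close>.\<close>

lemma second_order_taylor_bound:
  fixes f f1 f2 :: "real \<Rightarrow> real"
  assumes f: "\<And>z. (f has_real_derivative f1 z) (at z)" and f1: "\<And>z. (f1 has_real_derivative f2 z) (at z)"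
    and K: "\<And>z. z \<in> {a..b} \<Longrightarrow> \<bar>f2 z\<bar> \<le> K" and xy: "x \<in> {a..b}" "y \<in> {a..b}"
  shows "\<bar>f y - f x - (y - x) * f1 x\<bar> \<le> K * (y - x)\<^sup>2"
proof -
  let ?S = "closed_segment x y"
  have S: "?S \<subseteq> {a..b}" using xy by (auto simp: closed_segment_eq_real_ivl)
  have K0: "0 \<le> K" using K [OF xy(1)] by linarith
  have seg: "\<bar>z - x\<bar> \<le> \<bar>y - x\<bar>" if "z \<in> ?S" for z
    using that by (auto simp: closed_segment_eq_real_ivl split: if_splits)
  have d1: "\<bar>f1 z - f1 x\<bar> \<le> K * \<bar>y - x\<bar>" if z: "z \<in> ?S" for z
  proof -
    have "norm (f1 z - f1 x) \<le> K * norm (z - x)"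
      by (rule field_differentiable_bound [of ?S f1 f2])
        (use z S K f1 in \<open>auto intro: has_field_derivative_at_within\<close>)
    also have "\<dots> \<le> K * \<bar>y - x\<bar>" using seg [OF z] K0 by (auto intro: mult_left_mono)
    finally show ?thesis by simp
  qed
  have "norm ((f y - y * f1 x) - (f x - x * f1 x)) \<le> (K * \<bar>y - x\<bar>) * norm (y - x)"
  proof (rule field_differentiable_bound [of ?S "\<lambda>z. f z - z * f1 x" "\<lambda>z. f1 z - f1 x"])
    show "((\<lambda>z. f z - z * f1 x) has_real_derivative f1 z - f1 x) (at z within ?S)" for z
      by (rule has_field_derivative_at_within) (auto intro!: derivative_eq_intros f)
  qed (use d1 in auto)
  then show ?thesis by (simp add: algebra_simps power2_eq_square abs_mult_self_eq)
qed

text \<open>The product rule for a moving linear functional applied to a moving multiplier.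
  Multipliers carry no norm here: the bound \<open>M\<close> on frequencies up to \<open>R\<close>
  and the Taylor estimate, uniform on the same ball, play its part.\<close>

lemma multiplier_product_rule:
  fixes A A1 :: "real \<Rightarrow> ('a::euclidean_space \<Rightarrow> real) \<Rightarrow> complex" and g g' :: "real \<Rightarrow> 'a \<Rightarrow> real"
  assumes lin: "\<And>s \<mu> \<nu> c. s \<in> S \<Longrightarrow> multiplier \<mu> \<Longrightarrow> multiplier \<nu> \<Longrightarrow>
      A s (\<lambda>\<xi>. \<mu> \<xi> + c * \<nu> \<xi>) = A s \<mu> + c *\<^sub>R A s \<nu>"
    and bound: "\<And>s \<mu> B. s \<in> S \<Longrightarrow> multiplier \<mu> \<Longrightarrow> 0 \<le> B \<Longrightarrow> (\<And>\<xi>. norm \<xi> \<le> R \<Longrightarrow> \<bar>\<mu> \<xi>\<bar> \<le> B) \<Longrightarrow>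
      norm (A s \<mu>) \<le> M * B"
    and der: "\<And>s \<mu>. s \<in> S \<Longrightarrow> multiplier \<mu> \<Longrightarrow>
      ((\<lambda>s. A s \<mu>) has_vector_derivative A1 s \<mu>) (at s within S)"
    and g: "\<And>s. s \<in> S \<Longrightarrow> multiplier (g s)" and g': "\<And>s. s \<in> S \<Longrightarrow> multiplier (g' s)"
    and taylor: "\<And>s s' \<xi>. s \<in> S \<Longrightarrow> s' \<in> S \<Longrightarrow> norm \<xi> \<le> R \<Longrightarrow>
      \<bar>g s' \<xi> - g s \<xi> - (s' - s) * g' s \<xi>\<bar> \<le> K * (s' - s)\<^sup>2"
    and K: "0 \<le> K" and s: "s \<in> S"
  shows "((\<lambda>s. A s (g s)) has_vector_derivative A1 s (g s) + A s (g' s)) (at s within S)"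
  unfolding has_vector_derivative_def
proof (rule has_derivativeI_sandwich [of 1])
  show "bounded_linear (\<lambda>v. v *\<^sub>R (A1 s (g s) + A s (g' s)))" by (rule bounded_linear_scaleR_left)
  let ?X = "\<lambda>s'. norm (A s' (g s) - A s (g s) - (s' - s) *\<^sub>R A1 s (g s)) / norm (s' - s)"
  let ?Y = "\<lambda>s'. norm (A s' (g' s) - A s (g' s))"
  have X: "(?X \<longlongrightarrow> 0) (at s within S)"
    using der [OF s g [OF s]] unfolding has_vector_derivative_def has_derivative_iff_norm by blast
  have "((\<lambda>s'. A s' (g' s)) \<longlongrightarrow> A s (g' s)) (at s within S)"
    using has_vector_derivative_continuous [OF der [OF s g' [OF s]]] unfolding continuous_within .
  then have Y: "(?Y \<longlongrightarrow> 0) (at s within S)"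
    using tendsto_norm_zero LIM_zero by fastforce
  have "((\<lambda>s'. M * (K * \<bar>s' - s\<bar>)) \<longlongrightarrow> M * (K * \<bar>s - s\<bar>)) (at s within S)"
    by (intro tendsto_intros)
  then have Z: "((\<lambda>s'. M * (K * \<bar>s' - s\<bar>)) \<longlongrightarrow> 0) (at s within S)" by simp
  show "((\<lambda>s'. ?X s' + ?Y s' + M * (K * \<bar>s' - s\<bar>)) \<longlongrightarrow> 0) (at s within S)"
    using tendsto_add [OF tendsto_add [OF X Y] Z] by simp
  fix s' assume s': "s' \<in> S" "s' \<noteq> s"
  \<comment> \<open>The Taylor remainder of the multiplier, written with -1 as a factor so that
    \<open>lin\<close> applies twice.\<close>
  define r where "r \<xi> = g s' \<xi> + (-1) * (g s \<xi> + (s' - s) * g' s \<xi>)" for \<xi>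
  note m = multiplier_add [OF g [OF s] multiplier_cmult [OF g' [OF s]], of "s' - s"]
  have mr: "multiplier r" unfolding r_def [abs_def]
    by (rule multiplier_add [OF g [OF s'(1)] multiplier_cmult [OF m]])
  have r_eq: "A s' r = A s' (g s') + (-1) *\<^sub>R (A s' (g s) + (s' - s) *\<^sub>R A s' (g' s))"
    unfolding r_def [abs_def] lin [OF s'(1) g [OF s'(1)] m]
      lin [OF s'(1) g [OF s] g' [OF s]] ..
  have r_le: "norm (A s' r) \<le> M * (K * (s' - s)\<^sup>2)"
  proof (rule bound [OF s'(1) mr])
    show "\<bar>r \<xi>\<bar> \<le> K * (s' - s)\<^sup>2" if "norm \<xi> \<le> R" for \<xi>
      using taylor [OF s s'(1) that] by (simp add: r_def algebra_simps)
  qed (use K in simp)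
  have "A s' (g s') - A s (g s) - (s' - s) *\<^sub>R (A1 s (g s) + A s (g' s)) =
      (A s' (g s) - A s (g s) - (s' - s) *\<^sub>R A1 s (g s)) + (s' - s) *\<^sub>R (A s' (g' s) - A s (g' s)) + A s' r"
    unfolding r_eq by (simp add: algebra_simps)
  then have "norm (A s' (g s') - A s (g s) - (s' - s) *\<^sub>R (A1 s (g s) + A s (g' s))) \<le>
      norm (A s' (g s) - A s (g s) - (s' - s) *\<^sub>R A1 s (g s)) + norm ((s' - s) *\<^sub>R (A s' (g' s) - A s (g' s))) + norm (A s' r)"
    by (metis norm_triangle_mono norm_triangle_ineq order_refl)
  also have "\<dots> \<le> (?X s' + ?Y s' + M * (K * \<bar>s' - s\<bar>)) * norm (s' - s)"
  proof -
    have "?X s' * norm (s' - s) = norm (A s' (g s) - A s (g s) - (s' - s) *\<^sub>R A1 s (g s))" using s'(2) by simp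
    moreover have "?Y s' * norm (s' - s) = norm ((s' - s) *\<^sub>R (A s' (g' s) - A s (g' s)))"
      by (simp add: mult.commute)
    moreover have "M * (K * \<bar>s' - s\<bar>) * norm (s' - s) = M * (K * (s' - s)\<^sup>2)"
      by (simp add: mult.assoc power2_eq_square abs_mult_self_eq)
    ultimately show ?thesis using r_le unfolding distrib_right by linarith
  qed
  finally show "norm (A s' (g s') - A s (g s) - (s' - s) *\<^sub>R (A1 s (g s) + A s (g' s))) / norm (s' - s)
      \<le> ?X s' + ?Y s' + M * (K * \<bar>s' - s\<bar>)"
    using s'(2) by (subst pos_divide_le_eq) auto
qed simp

text \<open>The solution is taken at time s and the scalar multiplier at time T - s. The pairing
  \<open>Q\<close> of the two is then independent of s, and its values at s = T and s = 0 are the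
  two sides. \<open>q\<close> may be any solution of the scalar equation, so its initial data can be
  chosen to isolate \<open>u T\<close> or \<open>ut T\<close>.\<close>

lemma weak_solution_duality:
  fixes u :: "real \<Rightarrow> real^'n::finite \<Rightarrow> complex" and q q1 :: "real \<Rightarrow> real^'n \<Rightarrow> real"
  assumes ws: "weak_solution m u0 u1 u ut" and H: "band_limited H" and T: "0 \<le> T"
    and q: "\<And>\<tau> \<xi>. ((\<lambda>\<tau>. q \<tau> \<xi>) has_real_derivative q1 \<tau> \<xi>) (at \<tau>)"
    and q1: "\<And>\<tau> \<xi>. ((\<lambda>\<tau>. q1 \<tau> \<xi>) has_real_derivative - (norm \<xi>)\<^sup>2 * q1 \<tau> \<xi> - ((norm \<xi>)\<^sup>2 + m\<^sup>2) * q \<tau> \<xi>) (at \<tau>)"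
    and qm: "\<And>\<tau>. 0 \<le> \<tau> \<Longrightarrow> multiplier (q \<tau>)" "\<And>\<tau>. 0 \<le> \<tau> \<Longrightarrow> multiplier (q1 \<tau>)"
    and qb: "\<And>R. \<exists>B. \<forall>\<tau>\<in>{0..T}. \<forall>\<xi>. norm \<xi> \<le> R \<longrightarrow> \<bar>q \<tau> \<xi>\<bar> \<le> B \<and> \<bar>q1 \<tau> \<xi>\<bar> \<le> B"
  shows "mpair H (q 0) (ut T) + mpair H (\<lambda>\<xi>. (norm \<xi>)\<^sup>2 * q 0 \<xi> + q1 0 \<xi>) (u T) =
    mpair H (q T) (ut 0) + mpair H (\<lambda>\<xi>. (norm \<xi>)\<^sup>2 * q T \<xi> + q1 T \<xi>) (u 0)"
proof -
  have C1: "C1_L2 u ut" and u: "continuous_L2 u" and ut: "continuous_L2 ut"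
    using ws by (auto simp: weak_solution_def C1_L2_def)
  note Lu = continuous_L2_Lp [OF u] and Lut = continuous_L2_Lp [OF ut]
  let ?r = "\<lambda>\<xi>::real^'n. (norm \<xi>)\<^sup>2" and ?b = "\<lambda>\<xi>::real^'n. (norm \<xi>)\<^sup>2 + m\<^sup>2"
  let ?c = "sqrt (2 * pi) ^ DIM(real^'n)"
  define S where "S = {0..T}"
  have S0: "0 \<le> s" if "s \<in> S" for s using that by (simp add: S_def)
  obtain R0 where R0: "\<And>\<xi>. norm \<xi> > R0 \<Longrightarrow> H \<xi> = 0" using H unfolding band_limited_def by blast
  \<comment> \<open>The maximum with 0 puts \<xi> = 0 into the ball, which \<open>K_nonneg\<close>
    uses.\<close>
  define R where "R = max R0 0"
  have R: "H \<xi> \<noteq> 0 \<Longrightarrow> norm \<xi> \<le> R" for \<xi> using R0 [of \<xi>] unfolding R_def by linarith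
  have R_nonneg: "0 \<le> R" by (simp add: R_def)
  obtain B where B: "\<And>\<tau> \<xi>. \<tau> \<in> S \<Longrightarrow> norm \<xi> \<le> R \<Longrightarrow> \<bar>q \<tau> \<xi>\<bar> \<le> B"
      "\<And>\<tau> \<xi>. \<tau> \<in> S \<Longrightarrow> norm \<xi> \<le> R \<Longrightarrow> \<bar>q1 \<tau> \<xi>\<bar> \<le> B"
    using qb [of R] unfolding S_def by blast
  \<comment> \<open>\<open>q2\<close> and \<open>q3\<close> are the second and third time
    derivatives, read off from the equation; their bounds feed the Taylor estimates of
    \<open>q\<close> and \<open>q1\<close>.\<close>
  define q2 where "q2 \<tau> \<xi> = - ?r \<xi> * q1 \<tau> \<xi> - ?b \<xi> * q \<tau> \<xi>" for \<tau> \<xi>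
  define q3 where "q3 \<tau> \<xi> = - ?r \<xi> * q2 \<tau> \<xi> - ?b \<xi> * q1 \<tau> \<xi>" for \<tau> \<xi>
  have D1: "((\<lambda>\<tau>. q1 \<tau> \<xi>) has_real_derivative q2 \<tau> \<xi>) (at \<tau>)" for \<tau> \<xi>
    unfolding q2_def by (rule q1)
  have D2: "((\<lambda>\<tau>. q2 \<tau> \<xi>) has_real_derivative q3 \<tau> \<xi>) (at \<tau>)" for \<tau> \<xi>
  proof -
    have "((\<lambda>\<tau>. - ?r \<xi> * q1 \<tau> \<xi> - ?b \<xi> * q \<tau> \<xi>) has_real_derivative q3 \<tau> \<xi>) (at \<tau>)"
      unfolding q3_def by (intro DERIV_diff DERIV_cmult D1 q)
    then show ?thesis by (simp only: q2_def)
  qed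
  have qm2: "multiplier (q2 \<tau>)" if "0 \<le> \<tau>" for \<tau>
  proof -
    have "q2 \<tau> = (\<lambda>\<xi>. - (?r \<xi> * q1 \<tau> \<xi>) + - (?b \<xi> * q \<tau> \<xi>))" by (auto simp: q2_def)
    then show ?thesis by (simp only:) (intro multiplier_add multiplier_minus multiplier_mult multiplier_norm qm that)
  qed
  have comb: "\<bar>- ?r \<xi> * x - ?b \<xi> * y\<bar> \<le> R\<^sup>2 * X + (R\<^sup>2 + m\<^sup>2) * Y"
    if "norm \<xi> \<le> R" "\<bar>x\<bar> \<le> X" "\<bar>y\<bar> \<le> Y" for x y X Y \<xi>
  proof -
    have r: "?r \<xi> \<le> R\<^sup>2" using that(1) by (intro power_mono) auto
    have "\<bar>- ?r \<xi> * x - ?b \<xi> * y\<bar> \<le> \<bar>- ?r \<xi> * x\<bar> + \<bar>?b \<xi> * y\<bar>" by (rule abs_triangle_ineq4)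
    also have "\<dots> = ?r \<xi> * \<bar>x\<bar> + ?b \<xi> * \<bar>y\<bar>" by (simp add: abs_mult)
    also have "\<dots> \<le> R\<^sup>2 * X + (R\<^sup>2 + m\<^sup>2) * Y"
      using r that by (intro add_mono mult_mono) auto
    finally show ?thesis .
  qed
  define K2 where "K2 = R\<^sup>2 * B + (R\<^sup>2 + m\<^sup>2) * B"
  define K3 where "K3 = R\<^sup>2 * K2 + (R\<^sup>2 + m\<^sup>2) * B"
  have q2_le: "\<bar>q2 \<tau> \<xi>\<bar> \<le> K2" if "\<tau> \<in> S" "norm \<xi> \<le> R" for \<tau> \<xi>
    unfolding q2_def K2_def using that by (intro comb B)
  have q3_le: "\<bar>q3 \<tau> \<xi>\<bar> \<le> K3" if "\<tau> \<in> S" "norm \<xi> \<le> R" for \<tau> \<xi>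
    unfolding q3_def K3_def using that by (intro comb B q2_le)
  have K_nonneg: "0 \<le> K2" "0 \<le> K3"
    using q2_le [of 0 0] q3_le [of 0 0] T R_nonneg by (auto simp: S_def)
  have refl: "T - s \<in> S" if "s \<in> S" for s using that by (auto simp: S_def)
  have taylor1: "\<bar>q (T - s') \<xi> - q (T - s) \<xi> - (s' - s) * - q1 (T - s) \<xi>\<bar> \<le> K2 * (s' - s)\<^sup>2"
    if "s \<in> S" "s' \<in> S" "norm \<xi> \<le> R" for s s' \<xi>
    using second_order_taylor_bound [of "\<lambda>\<tau>. q \<tau> \<xi>" "\<lambda>\<tau>. q1 \<tau> \<xi>" "\<lambda>\<tau>. q2 \<tau> \<xi>" 0 T K2 "T - s" "T - s'"]
      q D1 q2_le [OF _ that(3)] refl [OF that(1)] refl [OF that(2)]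
    by (simp add: S_def power2_commute [of s'] algebra_simps)
  have taylor2: "\<bar>q1 (T - s') \<xi> - q1 (T - s) \<xi> - (s' - s) * - q2 (T - s) \<xi>\<bar> \<le> K3 * (s' - s)\<^sup>2"
    if "s \<in> S" "s' \<in> S" "norm \<xi> \<le> R" for s s' \<xi>
    using second_order_taylor_bound [of "\<lambda>\<tau>. q1 \<tau> \<xi>" "\<lambda>\<tau>. q2 \<tau> \<xi>" "\<lambda>\<tau>. q3 \<tau> \<xi>" 0 T K3 "T - s" "T - s'"]
      D1 D2 q3_le [OF _ that(3)] refl [OF that(1)] refl [OF that(2)]
    by (simp add: S_def power2_commute [of s'] algebra_simps)
  have "bounded ((\<lambda>t. Lp_norm 2 (u t)) ` S)" "bounded ((\<lambda>t. Lp_norm 2 (ut t)) ` S)"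
    unfolding S_def
    by (intro compact_imp_bounded compact_continuous_image compact_Icc
        continuous_on_subset [OF continuous_L2_norm [OF u]] continuous_on_subset [OF continuous_L2_norm [OF ut]]; simp)+
  then obtain U V where U: "\<And>t. t \<in> S \<Longrightarrow> Lp_norm 2 (u t) \<le> U" and V: "\<And>t. t \<in> S \<Longrightarrow> Lp_norm 2 (ut t) \<le> V"
    unfolding bounded_iff by fastforce
  define a where "a s \<mu> = mpair H \<mu> (u s)" for s \<mu>
  define b where "b s \<mu> = mpair H \<mu> (ut s) + mpair H (\<lambda>\<xi>. ?r \<xi> * \<mu> \<xi>) (u s)" for s \<mu>
  have rlin: "(\<lambda>\<xi>. ?r \<xi> * (\<mu> \<xi> + c * \<nu> \<xi>)) = (\<lambda>\<xi>. ?r \<xi> * \<mu> \<xi> + c * (?r \<xi> * \<nu> \<xi>))" for \<mu> \<nu> c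
    by (auto simp: algebra_simps)
  have lin_a: "a s (\<lambda>\<xi>. \<mu> \<xi> + c * \<nu> \<xi>) = a s \<mu> + c *\<^sub>R a s \<nu>"
    if "s \<in> S" "multiplier \<mu>" "multiplier \<nu>" for s \<mu> \<nu> c
    unfolding a_def using that by (intro mpair_linear H Lu S0)
  have lin_b: "b s (\<lambda>\<xi>. \<mu> \<xi> + c * \<nu> \<xi>) = b s \<mu> + c *\<^sub>R b s \<nu>"
    if "s \<in> S" "multiplier \<mu>" "multiplier \<nu>" for s \<mu> \<nu> c
    unfolding b_def rlin mpair_linear [OF H that(2,3) Lut [OF S0 [OF that(1)]]]
      mpair_linear [OF H multiplier_mult [OF multiplier_norm(2) that(2)] multiplier_mult [OF multiplier_norm(2) that(3)] Lu [OF S0 [OF that(1)]]]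
    by (simp add: scaleR_add_right)
  have pb: "norm (mpair H \<mu> f) \<le> ?c * F * Lp_norm 2 H * B'"
    if "multiplier \<mu>" "Lp 2 f" "Lp_norm 2 f \<le> F" "0 \<le> B'" "\<And>\<xi>. norm \<xi> \<le> R \<Longrightarrow> \<bar>\<mu> \<xi>\<bar> \<le> B'" for \<mu> f F B'
  proof -
    have "norm (mpair H \<mu> f) \<le> ?c * Lp_norm 2 f * B' * Lp_norm 2 H"
      using that R by (intro mpair_bound H) auto
    also have "\<dots> \<le> ?c * F * B' * Lp_norm 2 H"
      using that by (intro mult_right_mono mult_left_mono) auto
    finally show ?thesis by (simp only: mult_ac)
  qed
  have bound_a: "norm (a s \<mu>) \<le> (?c * U * Lp_norm 2 H) * B'"
    if "s \<in> S" "multiplier \<mu>" "0 \<le> B'" "\<And>\<xi>. norm \<xi> \<le> R \<Longrightarrow> \<bar>\<mu> \<xi>\<bar> \<le> B'" for s \<mu> B'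
    unfolding a_def by (rule pb [OF that(2) Lu [OF S0 [OF that(1)]] U [OF that(1)] that(3,4)])
  have bound_b: "norm (b s \<mu>) \<le> (?c * V * Lp_norm 2 H + ?c * U * Lp_norm 2 H * R\<^sup>2) * B'"
    if s: "s \<in> S" and \<mu>: "multiplier \<mu>" and B': "0 \<le> B'" "\<And>\<xi>. norm \<xi> \<le> R \<Longrightarrow> \<bar>\<mu> \<xi>\<bar> \<le> B'" for s \<mu> B'
  proof -
    have "\<bar>?r \<xi> * \<mu> \<xi>\<bar> \<le> R\<^sup>2 * B'" if "norm \<xi> \<le> R" for \<xi>
      unfolding abs_mult using B' that by (intro mult_mono) (auto intro: power_mono)
    then have "norm (mpair H (\<lambda>\<xi>. ?r \<xi> * \<mu> \<xi>) (u s)) \<le> ?c * U * Lp_norm 2 H * (R\<^sup>2 * B')"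
      using B' by (intro pb [OF multiplier_mult [OF multiplier_norm(2) \<mu>] Lu [OF S0 [OF s]] U [OF s]]) auto
    moreover have "norm (mpair H \<mu> (ut s)) \<le> ?c * V * Lp_norm 2 H * B'"
      by (rule pb [OF \<mu> Lut [OF S0 [OF s]] V [OF s] B'])
    ultimately have "norm (b s \<mu>) \<le> ?c * V * Lp_norm 2 H * B' + ?c * U * Lp_norm 2 H * (R\<^sup>2 * B')"
      unfolding b_def by (intro norm_triangle_mono)
    then show ?thesis by (simp only: distrib_right mult.assoc)
  qed
  have der_a: "((\<lambda>s. a s \<mu>) has_vector_derivative mpair H \<mu> (ut s)) (at s within S)"
    if "s \<in> S" "multiplier \<mu>" for s \<mu>
    unfolding a_def mpair_def
    by (rule has_vector_derivative_within_subset
        [OF C1_L2_pairing [OF C1 L2_functional_Lp_2 [OF Lp_2_synth [OF band_limited_multiplier [OF H that(2)]]] S0 [OF that(1)]]])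
      (auto simp: S_def)
  have der_b: "((\<lambda>s. b s \<mu>) has_vector_derivative - mpair H (\<lambda>\<xi>. ?b \<xi> * \<mu> \<xi>) (u s)) (at s within S)"
    if "s \<in> S" "multiplier \<mu>" for s \<mu>
    unfolding b_def mpair_def
    using has_vector_derivative_within_subset
        [OF weak_solution_pairing [OF ws band_limited_multiplier [OF H that(2)] S0 [OF that(1)]], of S]
    by (simp only: mult.assoc of_real_mult) (auto simp: S_def)
  define Q where "Q s = b s (q (T - s)) + a s (q1 (T - s))" for s
  have dQ: "(Q has_vector_derivative 0) (at s within S)" if s: "s \<in> S" for s
  proof -
    have 1: "((\<lambda>s. b s (q (T - s))) has_vector_derivative
        - mpair H (\<lambda>\<xi>. ?b \<xi> * q (T - s) \<xi>) (u s) + b s (\<lambda>\<xi>. - q1 (T - s) \<xi>)) (at s within S)"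
      by (rule multiplier_product_rule [where R = R and K = K2, OF lin_b bound_b der_b
            qm(1) [OF S0 [OF refl]] multiplier_minus [OF qm(2) [OF S0 [OF refl]]] taylor1 K_nonneg(1) s])
    have 2: "((\<lambda>s. a s (q1 (T - s))) has_vector_derivative
        mpair H (q1 (T - s)) (ut s) + a s (\<lambda>\<xi>. - q2 (T - s) \<xi>)) (at s within S)"
      by (rule multiplier_product_rule [where R = R and K = K3, OF lin_a bound_a der_a
            qm(2) [OF S0 [OF refl]] multiplier_minus [OF qm2 [OF S0 [OF refl]]] taylor2 K_nonneg(2) s])
    have Ts: "0 \<le> T - s" by (rule S0 [OF refl [OF s]])
    let ?P = "q (T - s)" and ?P1 = "q1 (T - s)"
    have m0: "multiplier (\<lambda>\<xi>::real^'n. 0)" by (rule multiplier_const)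
    have a0: "a s (\<lambda>\<xi>. 0) = 0" "b s (\<lambda>\<xi>. 0) = 0"
      by (simp_all add: a_def b_def mpair_def synth_def fourier_def)
    have "b s (\<lambda>\<xi>. - ?P1 \<xi>) = - b s ?P1"
      using lin_b [OF s m0 qm(2) [OF Ts], of "-1"] a0 by simp
    moreover
    have e: "(\<lambda>\<xi>. - q2 (T - s) \<xi>) = (\<lambda>\<xi>. ?r \<xi> * ?P1 \<xi> + 1 * (?b \<xi> * ?P \<xi>))"
      by (auto simp: q2_def)
    have "a s (\<lambda>\<xi>. - q2 (T - s) \<xi>) = a s (\<lambda>\<xi>. ?r \<xi> * ?P1 \<xi>) + 1 *\<^sub>R a s (\<lambda>\<xi>. ?b \<xi> * ?P \<xi>)"
      unfolding e by (rule lin_a [OF s multiplier_mult [OF multiplier_norm(2) qm(2)] multiplier_mult [OF multiplier_norm(1) qm(1)]])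
        (use Ts in simp_all)
    \<comment> \<open>The terms with \<open>ut s\<close> cancel, and so do, at \<open>u s\<close>,
      those with |\<xi>|^2 q1 and with (|\<xi>|^2 + m^2) q.\<close>
    ultimately have "(- mpair H (\<lambda>\<xi>. ?b \<xi> * ?P \<xi>) (u s) + b s (\<lambda>\<xi>. - ?P1 \<xi>))
        + (mpair H ?P1 (ut s) + a s (\<lambda>\<xi>. - q2 (T - s) \<xi>)) = 0"
      by (simp add: a_def b_def)
    then show ?thesis using has_vector_derivative_add [OF 1 2] by (simp add: Q_def [abs_def])
  qed
  have "convex S" by (simp add: S_def)
  then obtain c where "\<And>s. s \<in> S \<Longrightarrow> Q s = c" using has_vector_derivative_zero_constant [OF _ dQ] by blast
  then have "Q 0 = Q T" using T by (simp add: S_def)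
  have split: "mpair H (\<lambda>\<xi>. ?r \<xi> * q \<tau> \<xi> + q1 \<tau> \<xi>) f = mpair H (\<lambda>\<xi>. ?r \<xi> * q \<tau> \<xi>) f + mpair H (q1 \<tau>) f"
    if "Lp 2 f" "0 \<le> \<tau>" for \<tau> f
    using mpair_linear [OF H multiplier_mult [OF multiplier_norm(2) qm(1) [OF that(2)]] qm(2) [OF that(2)] that(1), where c = 1]
    by simp
  show ?thesis
    using \<open>Q 0 = Q T\<close> split [OF Lu [OF T], of 0] split [OF Lu [of 0] T] by (simp add: Q_def a_def b_def add.assoc)
qed

section \<open>Low and high frequencies\<close>

text \<open>The factor for amplitudes, hence 4 where the energy rate has 2.\<close>

definition decay :: "real \<Rightarrow> 'a::euclidean_space \<Rightarrow> real" where
  "decay t \<xi> = exp (- (min 1 ((norm \<xi>)\<^sup>2) * t / 4))"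

definition damped :: "real \<Rightarrow> real \<Rightarrow> 'a::euclidean_space \<Rightarrow> real" where
  "damped m t \<xi> = kern ((norm \<xi>)\<^sup>2) ((norm \<xi>)\<^sup>2 + m\<^sup>2) t"

definition damped_d :: "real \<Rightarrow> real \<Rightarrow> 'a::euclidean_space \<Rightarrow> real" where
  "damped_d m t \<xi> = kern_d ((norm \<xi>)\<^sup>2) ((norm \<xi>)\<^sup>2 + m\<^sup>2) t"

text \<open>Two instances of the oscillator's energy bound. The first is for data 0, 1, with initial
  energy 1. The second is for |\<xi>|^2 y + y' with y the first solution: its derivative is -
  (|\<xi>|^2 + m^2) y, its data are 1, 0 and its initial energy is |\<xi>|^2 + m^2.\<close>

lemma
  fixes \<xi> :: "'a::euclidean_space"
  assumes m: "m > 0" and t: "0 \<le> t"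
  shows damped_energy: "(damped_d m t \<xi>)\<^sup>2 + ((norm \<xi>)\<^sup>2 + m\<^sup>2) * (damped m t \<xi>)\<^sup>2 \<le> (2 * decay t \<xi>)\<^sup>2"
    and damped_energy': "(- ((norm \<xi>)\<^sup>2 + m\<^sup>2) * damped m t \<xi>)\<^sup>2
        + ((norm \<xi>)\<^sup>2 + m\<^sup>2) * ((norm \<xi>)\<^sup>2 * damped m t \<xi> + damped_d m t \<xi>)\<^sup>2
      \<le> ((norm \<xi>)\<^sup>2 + m\<^sup>2) * (2 * decay t \<xi>)\<^sup>2"
proof -
  define a where "a = (norm \<xi>)\<^sup>2"
  define b where "b = (norm \<xi>)\<^sup>2 + m\<^sup>2"
  \<comment> \<open>The largest value allowed by \<beta> \<le> 1/2 and 2 \<beta> \<le> |\<xi>|^2. It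
    does not involve m, and therefore neither does the decay rate.\<close>
  define \<beta> where "\<beta> = min 1 ((norm \<xi>)\<^sup>2) / 2"
  have \<beta>: "0 \<le> \<beta>" "\<beta> \<le> 1/2" "2 * \<beta> \<le> a" "a \<le> b" by (auto simp: \<beta>_def a_def b_def)
  have "4 * \<beta>\<^sup>2 = (2 * \<beta>) * (2 * \<beta>)" by (simp add: power2_eq_square)
  also have "\<dots> \<le> 1 * (2 * \<beta>)" using \<beta> by (intro mult_right_mono) auto
  also have "\<dots> \<le> b" using \<beta> by linarith
  finally have \<beta>2: "4 * \<beta>\<^sup>2 \<le> b" .
  have e: "4 * exp (- \<beta> * t) = (2 * decay t \<xi>)\<^sup>2"
    by (simp add: decay_def \<beta>_def power_mult_distrib flip: exp_double)
  show "(damped_d m t \<xi>)\<^sup>2 + ((norm \<xi>)\<^sup>2 + m\<^sup>2) * (damped m t \<xi>)\<^sup>2 \<le> (2 * decay t \<xi>)\<^sup>2"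
    using damped_oscillator_energy [OF kern_deriv kern_d_deriv \<beta>(1-3) \<beta>2 \<beta>(4) t]
    unfolding e by (simp add: damped_def damped_d_def a_def b_def)
  have d1: "((\<lambda>t. a * kern a b t + kern_d a b t) has_real_derivative - b * kern a b t) (at t)" for t
    by (auto intro!: derivative_eq_intros kern_deriv kern_d_deriv)
  have d2: "((\<lambda>t. - b * kern a b t) has_real_derivative
      - a * (- b * kern a b t) - b * (a * kern a b t + kern_d a b t)) (at t)" for t
    by (auto intro!: derivative_eq_intros kern_deriv simp: algebra_simps)
  show "(- ((norm \<xi>)\<^sup>2 + m\<^sup>2) * damped m t \<xi>)\<^sup>2
        + ((norm \<xi>)\<^sup>2 + m\<^sup>2) * ((norm \<xi>)\<^sup>2 * damped m t \<xi> + damped_d m t \<xi>)\<^sup>2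
      \<le> ((norm \<xi>)\<^sup>2 + m\<^sup>2) * (2 * decay t \<xi>)\<^sup>2"
    using damped_oscillator_energy [OF d1 d2 \<beta>(1-3) \<beta>2 \<beta>(4) t]
    unfolding e by (simp add: damped_def damped_d_def a_def b_def mult.commute)
qed

text \<open>Each square in the two energies is estimated on its own. The last bound has sqrt
  (|\<xi>|^2 + m^2) as its natural factor, majorised by |\<xi>| + m; it is the one that grows in
  frequency.\<close>

lemma damped_bounds:
  fixes \<xi> :: "'a::euclidean_space"
  assumes m: "m > 0" and t: "0 \<le> t"
  shows "\<bar>damped_d m t \<xi>\<bar> \<le> 2 * decay t \<xi>"
    and "norm \<xi> * \<bar>damped m t \<xi>\<bar> \<le> 2 * decay t \<xi>"
    and "m * \<bar>damped m t \<xi>\<bar> \<le> 2 * decay t \<xi>"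
    and "\<bar>(norm \<xi>)\<^sup>2 * damped m t \<xi> + damped_d m t \<xi>\<bar> \<le> 2 * decay t \<xi>"
    and "\<bar>((norm \<xi>)\<^sup>2 + m\<^sup>2) * damped m t \<xi>\<bar> \<le> (norm \<xi> + m) * (2 * decay t \<xi>)"
proof -
  let ?k = "damped m t \<xi>" and ?k1 = "damped_d m t \<xi>" and ?e = "2 * decay t \<xi>" and ?b = "(norm \<xi>)\<^sup>2 + m\<^sup>2"
  have e0: "0 \<le> ?e" by (simp add: decay_def)
  have b0: "0 < ?b" using m by (intro add_nonneg_pos) auto
  note E = damped_energy [OF m t, of \<xi>] and E' = damped_energy' [OF m t, of \<xi>]
  have nn: "0 \<le> ?k1\<^sup>2" "0 \<le> (norm \<xi> * ?k)\<^sup>2" "0 \<le> (m * ?k)\<^sup>2" by simp_all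
  have sum: "?k1\<^sup>2 + (norm \<xi> * ?k)\<^sup>2 + (m * ?k)\<^sup>2 \<le> ?e\<^sup>2"
    using E by (simp add: power_mult_distrib distrib_right)
  have root: "\<bar>x\<bar> \<le> ?e" if "x\<^sup>2 \<le> ?e\<^sup>2" for x
    using that unfolding abs_le_square_iff [symmetric] abs_of_nonneg [OF e0] .
  show "\<bar>?k1\<bar> \<le> ?e" by (rule root) (use sum nn in linarith)
  have "\<bar>norm \<xi> * ?k\<bar> \<le> ?e" by (rule root) (use sum nn in linarith)
  then show "norm \<xi> * \<bar>?k\<bar> \<le> ?e" by (simp add: abs_mult)
  have "\<bar>m * ?k\<bar> \<le> ?e" by (rule root) (use sum nn in linarith)
  then show "m * \<bar>?k\<bar> \<le> ?e" using m by (simp add: abs_mult)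
  let ?l = "(norm \<xi>)\<^sup>2 * ?k + ?k1"
  have "0 \<le> (- ?b * ?k)\<^sup>2" by (rule zero_le_power2)
  then have "?b * ?l\<^sup>2 \<le> ?b * ?e\<^sup>2" using E' by linarith
  then have "?l\<^sup>2 \<le> ?e\<^sup>2" using b0 by (simp only: mult_le_cancel_left_pos)
  then show "\<bar>?l\<bar> \<le> ?e" by (rule root)
  have "0 \<le> ?b * ?l\<^sup>2" using b0 by (intro mult_nonneg_nonneg) auto
  moreover have "(- ?b * ?k)\<^sup>2 = (?b * ?k)\<^sup>2" by (simp only: mult_minus_left power2_minus)
  ultimately have "(?b * ?k)\<^sup>2 \<le> ?b * ?e\<^sup>2" using E' by linarith
  also have "?b * ?e\<^sup>2 \<le> (norm \<xi> + m)\<^sup>2 * ?e\<^sup>2"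
    using m by (intro mult_right_mono) (auto simp: power2_sum)
  finally have "(?b * ?k)\<^sup>2 \<le> ((norm \<xi> + m) * ?e)\<^sup>2" by (simp only: power_mult_distrib)
  then have "\<bar>?b * ?k\<bar> \<le> \<bar>(norm \<xi> + m) * ?e\<bar>" by (simp only: abs_le_square_iff)
  then show "\<bar>?b * ?k\<bar> \<le> (norm \<xi> + m) * ?e" using e0 m by simp
qed

lemma damped_derivs:
  "((\<lambda>\<tau>. damped m \<tau> \<xi>) has_real_derivative damped_d m \<tau> \<xi>) (at \<tau>)"
  "((\<lambda>\<tau>. damped_d m \<tau> \<xi>) has_real_derivative
     - (norm \<xi>)\<^sup>2 * damped_d m \<tau> \<xi> - ((norm \<xi>)\<^sup>2 + m\<^sup>2) * damped m \<tau> \<xi>) (at \<tau>)"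
  unfolding damped_def damped_d_def by (rule kern_deriv, rule kern_d_deriv)

lemma decay_le_1: "0 \<le> t \<Longrightarrow> decay t \<xi> \<le> 1"
  by (simp add: decay_def)

lemma damped_uniform_bounds:
  fixes \<xi> :: "'a::euclidean_space"
  assumes m: "m > 0" and t: "0 \<le> t"
  shows "\<bar>damped m t \<xi>\<bar> \<le> 2 / m" "\<bar>damped_d m t \<xi>\<bar> \<le> 2"
proof -
  have d: "decay t \<xi> \<le> 1" using t by (rule decay_le_1)
  show "\<bar>damped_d m t \<xi>\<bar> \<le> 2" using damped_bounds(1) [OF m t, of \<xi>] d by linarith
  have "m * \<bar>damped m t \<xi>\<bar> \<le> 2" using damped_bounds(3) [OF m t, of \<xi>] d by linarith
  then show "\<bar>damped m t \<xi>\<bar> \<le> 2 / m" using m by (simp add: field_simps)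
qed

lemma damped_multiplier:
  assumes m: "m > 0" and t: "0 \<le> t"
  shows "multiplier (damped m t)" "multiplier (damped_d m t)"
proof -
  have "damped m t \<in> borel_measurable borel" "damped_d m t \<in> borel_measurable borel"
    unfolding damped_def [abs_def] damped_d_def [abs_def] by measurable
  then show "multiplier (damped m t)" "multiplier (damped_d m t)"
    using damped_uniform_bounds [OF m t] unfolding multiplier_def by blast+
qed

text \<open>\<open>damped\<close> solves the scalar equation with data \<open>0, 1\<close>; \<open>lam0\<close> is the solution with data \<open>1, 0\<close>
  and \<open>lam1\<close> its derivative in time.\<close>

definition lam0 :: "real \<Rightarrow> real \<Rightarrow> 'a::euclidean_space \<Rightarrow> real" where
  "lam0 m t \<xi> = (norm \<xi>)\<^sup>2 * damped m t \<xi> + damped_d m t \<xi>"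

definition lam1 :: "real \<Rightarrow> real \<Rightarrow> 'a::euclidean_space \<Rightarrow> real" where
  "lam1 m t \<xi> = - (((norm \<xi>)\<^sup>2 + m\<^sup>2) * damped m t \<xi>)"

lemma lam_multiplier:
  assumes m: "m > 0" and t: "0 \<le> t"
  shows "multiplier (lam0 m t)" "multiplier (lam1 m t)"
  unfolding lam0_def [abs_def] lam1_def [abs_def]
  by (intro multiplier_add multiplier_minus multiplier_mult multiplier_norm damped_multiplier assms)+

lemma mpair_zero: "mpair H (\<lambda>\<xi>. 0) f = 0"
  by (simp add: mpair_def synth_def fourier_def)

text \<open>Duality with two scalar solutions. \<open>damped\<close> has data 0, 1, which leaves
  \<open>u T\<close> with multiplier 1. Its derivative \<open>damped_d\<close> has data 1, -
  |\<xi>|^2; there the contribution |\<xi>|^2 of the damping cancels the multiplier of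
  \<open>u T\<close> and only \<open>ut T\<close> remains.\<close>

lemma weak_solution_representation:
  fixes u :: "real \<Rightarrow> real^'n::finite \<Rightarrow> complex"
  assumes m: "m > 0" and ws: "weak_solution m u0 u1 u ut" and H: "band_limited H" and T: "0 \<le> T"
  shows "mpair H (\<lambda>\<xi>. 1) (u T) = mpair H (damped m T) (ut 0) + mpair H (lam0 m T) (u 0)" (is ?u)
    and "mpair H (\<lambda>\<xi>. 1) (ut T) = mpair H (damped_d m T) (ut 0) + mpair H (lam1 m T) (u 0)" (is ?ut)
proof -
  define k2 where "k2 \<tau> \<xi> = - (norm \<xi>)\<^sup>2 * damped_d m \<tau> \<xi> - ((norm \<xi>)\<^sup>2 + m\<^sup>2) * damped m \<tau> \<xi>" for \<tau> and \<xi> :: "real^'n"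
  have k2: "((\<lambda>\<tau>. k2 \<tau> \<xi>) has_real_derivative - (norm \<xi>)\<^sup>2 * k2 \<tau> \<xi> - ((norm \<xi>)\<^sup>2 + m\<^sup>2) * damped_d m \<tau> \<xi>) (at \<tau>)" for \<tau> \<xi>
  proof -
    have "((\<lambda>\<tau>. - (norm \<xi>)\<^sup>2 * damped_d m \<tau> \<xi> - ((norm \<xi>)\<^sup>2 + m\<^sup>2) * damped m \<tau> \<xi>) has_real_derivative
        - (norm \<xi>)\<^sup>2 * k2 \<tau> \<xi> - ((norm \<xi>)\<^sup>2 + m\<^sup>2) * damped_d m \<tau> \<xi>) (at \<tau>)"
      unfolding k2_def by (intro DERIV_diff DERIV_cmult damped_derivs)
    then show ?thesis by (simp only: k2_def)
  qed
  have k1: "((\<lambda>\<tau>. damped_d m \<tau> \<xi>) has_real_derivative k2 \<tau> \<xi>) (at \<tau>)" for \<tau> \<xi>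
    unfolding k2_def by (rule damped_derivs)
  have k2m: "multiplier (k2 \<tau>)" if "0 \<le> \<tau>" for \<tau>
  proof -
    have "k2 \<tau> = (\<lambda>\<xi>. - ((norm \<xi>)\<^sup>2 * damped_d m \<tau> \<xi>) + - (((norm \<xi>)\<^sup>2 + m\<^sup>2) * damped m \<tau> \<xi>))"
      by (auto simp: k2_def)
    then show ?thesis
      by (simp only:) (intro multiplier_add multiplier_minus multiplier_mult multiplier_norm damped_multiplier m that)
  qed
  note ub = damped_uniform_bounds [OF m, where 'a = "real^'n"]
  have "\<exists>B. \<forall>\<tau>\<in>{0..T}. \<forall>\<xi>::real^'n. norm \<xi> \<le> R \<longrightarrow> \<bar>damped m \<tau> \<xi>\<bar> \<le> B \<and> \<bar>damped_d m \<tau> \<xi>\<bar> \<le> B" for R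
    by (rule exI [of _ "max (2 / m) 2"]) (use ub in \<open>auto simp: le_max_iff_disj\<close>)
  from weak_solution_duality [OF ws H T damped_derivs damped_multiplier [OF m] this]
  show ?u
    by (simp add: damped_def [of _ 0] damped_d_def [of _ 0] mpair_zero lam0_def [abs_def])
  have "\<exists>B. \<forall>\<tau>\<in>{0..T}. \<forall>\<xi>::real^'n. norm \<xi> \<le> R \<longrightarrow> \<bar>damped_d m \<tau> \<xi>\<bar> \<le> B \<and> \<bar>k2 \<tau> \<xi>\<bar> \<le> B" for R
  proof (rule exI [of _ "2 + R\<^sup>2 * 2 + (R\<^sup>2 + m\<^sup>2) * (2 / m)"], intro ballI allI impI conjI)
    fix \<tau> and \<xi> :: "real^'n" assume \<tau>: "\<tau> \<in> {0..T}" and \<xi>: "norm \<xi> \<le> R"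
    have r: "(norm \<xi>)\<^sup>2 \<le> R\<^sup>2" using \<xi> by (intro power_mono) auto
    have nn: "0 \<le> R\<^sup>2 * 2 + (R\<^sup>2 + m\<^sup>2) * (2 / m)" using m by (intro add_nonneg_nonneg mult_nonneg_nonneg) auto
    have "\<bar>damped_d m \<tau> \<xi>\<bar> \<le> 2" using \<tau> by (intro ub) auto
    then show "\<bar>damped_d m \<tau> \<xi>\<bar> \<le> 2 + R\<^sup>2 * 2 + (R\<^sup>2 + m\<^sup>2) * (2 / m)" using nn by linarith
    have "\<bar>k2 \<tau> \<xi>\<bar> \<le> \<bar>- (norm \<xi>)\<^sup>2 * damped_d m \<tau> \<xi>\<bar> + \<bar>((norm \<xi>)\<^sup>2 + m\<^sup>2) * damped m \<tau> \<xi>\<bar>"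
      unfolding k2_def by (rule abs_triangle_ineq4)
    also have "\<dots> = (norm \<xi>)\<^sup>2 * \<bar>damped_d m \<tau> \<xi>\<bar> + ((norm \<xi>)\<^sup>2 + m\<^sup>2) * \<bar>damped m \<tau> \<xi>\<bar>"
      by (simp add: abs_mult)
    also have "\<dots> \<le> R\<^sup>2 * 2 + (R\<^sup>2 + m\<^sup>2) * (2 / m)"
      using r \<tau> m by (intro add_mono mult_mono ub) auto
    finally show "\<bar>k2 \<tau> \<xi>\<bar> \<le> 2 + R\<^sup>2 * 2 + (R\<^sup>2 + m\<^sup>2) * (2 / m)" by linarith
  qed
  from weak_solution_duality [OF ws H T k1 k2 damped_multiplier(2) [OF m] k2m this]
  moreover have "(\<lambda>\<xi>. (norm \<xi>)\<^sup>2 * damped_d m T \<xi> + k2 T \<xi>) = lam1 m T"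
    by (auto simp: k2_def lam1_def)
  moreover have "(\<lambda>\<xi>. (norm \<xi>)\<^sup>2 * damped_d m 0 \<xi> + k2 0 \<xi>) = (\<lambda>\<xi>. 0)"
    by (auto simp: k2_def damped_def)
  moreover have "damped_d m 0 = (\<lambda>\<xi>::real^'n. 1)" by (auto simp: damped_d_def)
  ultimately show ?ut by (simp only: mpair_zero add_0_right)
qed

section \<open>Pairings split at the frequency |\<xi>| = 1\<close>

definition lowpass :: "('a::euclidean_space \<Rightarrow> complex) \<Rightarrow> 'a \<Rightarrow> complex" where
  "lowpass h \<xi> = (if norm \<xi> \<le> 1 then h \<xi> else 0)"

definition highpass :: "('a::euclidean_space \<Rightarrow> complex) \<Rightarrow> 'a \<Rightarrow> complex" where
  "highpass h \<xi> = (if norm \<xi> \<le> 1 then 0 else h \<xi>)"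

lemma band_limited_pass:
  assumes h: "band_limited h" shows "band_limited (lowpass h)" "band_limited (highpass h)"
proof -
  have [measurable]: "h \<in> borel_measurable borel" using h by (rule band_limited_measurable)
  have m: "lowpass h \<in> borel_measurable borel" "highpass h \<in> borel_measurable borel"
    unfolding lowpass_def [abs_def] highpass_def [abs_def] by measurable
  obtain R B where R: "\<And>\<xi>. norm \<xi> > R \<Longrightarrow> h \<xi> = 0" and B: "\<And>\<xi>. norm (h \<xi>) \<le> B"
    using h unfolding band_limited_def by blast
  have "0 \<le> B" using B [of 0] norm_ge_zero order_trans by blast
  then have "norm (lowpass h \<xi>) \<le> B" "norm (highpass h \<xi>) \<le> B" for \<xi>
    using B by (simp_all add: lowpass_def highpass_def)
  moreover have "lowpass h \<xi> = 0" "highpass h \<xi> = 0" if "norm \<xi> > R" for \<xi>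
    using R [OF that] by (simp_all add: lowpass_def highpass_def)
  ultimately show "band_limited (lowpass h)" "band_limited (highpass h)"
    unfolding band_limited_def using m by blast+
qed

text \<open>On the unit ball exp (- t |\<xi>|^2 / 4) is at most exp (1/4) times
  \<open>gauss ((1 + t) / 2)\<close>; passing from t to 1 + t keeps the Gaussian square-integrable
  down to t = 0. The remaining factors are the L^2 norm of this Gaussian.\<close>

definition heat_decay :: "nat \<Rightarrow> real \<Rightarrow> real" where
  "heat_decay n t = exp (1 / 4) * sqrt (sqrt (2 * pi) ^ n) * (1 + t) powr (- (real n / 4))"

text \<open>The datum enters by its L^1 norm, so \<open>synth\<close> is needed in the supremum
  norm, which is at most the L^1 norm of the low-frequency part of \<open>h\<close>. Cauchy-Schwarz
  against the Gaussian majorant of \<open>decay\<close> turns that into the L^2 norm of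
  \<open>H\<close>.\<close>

lemma lowpass_pairing:
  fixes h H :: "'a::euclidean_space \<Rightarrow> complex" and f :: "'a \<Rightarrow> complex"
  assumes h: "band_limited h" and H: "band_limited H" and t: "0 \<le> t" and M: "0 \<le> M"
    and le: "\<And>\<xi>. norm \<xi> \<le> 1 \<Longrightarrow> norm (h \<xi>) \<le> M * decay t \<xi> * norm (H \<xi>)" and f: "Lp 1 f"
  shows "norm (LINT x|lebesgue. synth (lowpass h) x *\<^sub>R f x) \<le> M * heat_decay DIM('a) t * Lp_norm 1 f * Lp_norm 2 H"
proof -
  let ?h = "lowpass h"
  note bl = band_limited_pass(1) [OF h]
  have fm [measurable]: "f \<in> borel_measurable lebesgue" and fi: "integrable lebesgue (\<lambda>x. norm (f x))"
    using f by (auto simp: Lp_def)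
  have sm [measurable]: "synth ?h \<in> borel_measurable lebesgue"
    using Lp_2_synth [OF bl] by (simp add: Lp_2_iff)
  let ?N = "LINT \<xi>|lborel. norm (?h \<xi>)"
  have N0: "0 \<le> ?N" by simp
  let ?g = "gauss ((1 + t) / 2) :: 'a \<Rightarrow> real"
  have pos: "(1 + t) / 2 > 0" using t by simp
  have H2: "Lp 2 H" using Lp_2_lborel(1) [OF band_limited_measurable [OF H]] band_limited_square_integrable [OF H] by simp
  note g2 = Lp_2_gauss [OF pos]
  have gH: "integrable lborel (\<lambda>\<xi>. ?g \<xi> * norm (H \<xi>))"
    using Lp_2_Cauchy_Schwarz(1) [OF g2 H2] band_limited_measurable [OF H]
    by (subst integrable_completion [symmetric]) (auto dest: integrable_norm)
  have "?N \<le> (LINT \<xi>|lborel. M * exp (1 / 4) * (?g \<xi> * norm (H \<xi>)))"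
  proof (rule integral_mono [OF integrable_norm [OF band_limited_integrable [OF bl]] integrable_mult_right [OF gH]])
    fix \<xi>
    show "norm (?h \<xi>) \<le> M * exp (1 / 4) * (?g \<xi> * norm (H \<xi>))"
    proof (cases "norm \<xi> \<le> 1")
      case True
      then have r: "(norm \<xi>)\<^sup>2 \<le> 1" by (simp add: power_le_one)
      then have "decay t \<xi> \<le> exp (1 / 4 + - ((1 + t) / 2) * (norm \<xi>)\<^sup>2 / 2)"
        unfolding decay_def by (simp add: min_absorb2 field_simps)
      also have "\<dots> = exp (1 / 4) * ?g \<xi>" by (simp only: exp_add gauss_def)
      finally have "M * decay t \<xi> * norm (H \<xi>) \<le> M * (exp (1 / 4) * ?g \<xi>) * norm (H \<xi>)"
        using M by (intro mult_right_mono mult_left_mono) auto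
      with le [OF True] True show ?thesis by (simp add: lowpass_def mult.assoc)
    qed (use M in \<open>simp add: lowpass_def\<close>)
  qed
  also have "\<dots> = M * exp (1 / 4) * (LINT \<xi>|lebesgue. \<bar>?g \<xi>\<bar> * norm (H \<xi>))"
    using band_limited_measurable [OF H] by (subst integral_completion) auto
  also have "\<dots> \<le> M * exp (1 / 4) * (Lp_norm 2 ?g * Lp_norm 2 H)"
    using M by (intro mult_left_mono Lp_2_Cauchy_Schwarz(2) g2 H2) auto
  also have "Lp_norm 2 ?g = sqrt (sqrt (2 * pi) ^ DIM('a)) * (1 + t) powr (- (real DIM('a) / 4))"
  proof -
    have "(?g x)\<^sup>2 = gauss (1 + t) x" for x
      by (simp add: gauss_def algebra_simps flip: exp_double)
    then have "Lp_norm 2 ?g = sqrt (sqrt (2 * pi / (1 + t)) ^ DIM('a))"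
      using t by (simp add: Lp_2_lborel integral_gauss)
    also have "\<dots> = sqrt (sqrt (2 * pi) ^ DIM('a)) * sqrt (sqrt (1 / (1 + t)) ^ DIM('a))"
      by (simp add: real_sqrt_divide power_divide)
    also have "sqrt (sqrt (1 / (1 + t)) ^ DIM('a)) = (1 + t) powr (- (real DIM('a) / 4))"
    proof -
      have "1 / (1 + t) = (1 + t) powr (- 1)" using t by (simp add: powr_minus_divide)
      then have "sqrt (1 / (1 + t)) = (1 + t) powr (- 1 / 2)"
        using t by (simp only: powr_half_sqrt [symmetric] powr_ge_zero powr_powr) simp
      then have "sqrt (1 / (1 + t)) ^ DIM('a) = (1 + t) powr (- 1 / 2 * real DIM('a))"
        using t by (simp only:) (simp add: powr_realpow [symmetric] powr_powr)
      then show ?thesis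
        using t by (simp only: powr_half_sqrt [symmetric] powr_ge_zero powr_powr) simp
    qed
    finally show ?thesis .
  qed
  finally have N: "?N \<le> M * heat_decay DIM('a) t * Lp_norm 2 H"
    by (simp add: heat_decay_def mult_ac)
  have b: "norm (synth ?h x *\<^sub>R f x) \<le> ?N * norm (f x)" for x
    unfolding norm_scaleR by (intro mult_right_mono) (use synth_bound [of ?h x] in auto)
  have iN: "integrable lebesgue (\<lambda>x. ?N * norm (f x))" using fi by simp
  have si: "integrable lebesgue (\<lambda>x. synth ?h x *\<^sub>R f x)"
    by (rule Bochner_Integration.integrable_bound [OF iN _ AE_I2]) (measurable, use b order_trans [OF b abs_ge_self] in simp)
  have "norm (LINT x|lebesgue. synth ?h x *\<^sub>R f x) \<le> (LINT x|lebesgue. norm (synth ?h x *\<^sub>R f x))"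
    by (rule integral_norm_bound)
  also have "\<dots> \<le> (LINT x|lebesgue. ?N * norm (f x))"
    by (rule integral_mono [OF integrable_norm [OF si] iN b])
  also have "\<dots> = ?N * Lp_norm 1 f" by (simp add: Lp_norm_def)
  also have "\<dots> \<le> (M * heat_decay DIM('a) t * Lp_norm 2 H) * Lp_norm 1 f"
    using N by (rule mult_right_mono) simp
  finally show ?thesis by (simp only: mult_ac)
qed

text \<open>Outside the unit ball \<open>decay\<close> is the constant exp (- t / 4), so the L^2
  bound for \<open>synth\<close> and Cauchy-Schwarz suffice.\<close>

lemma highpass_pairing:
  fixes h H :: "'a::euclidean_space \<Rightarrow> complex" and f :: "'a \<Rightarrow> complex"
  assumes h: "band_limited h" and H: "band_limited H" and t: "0 \<le> t" and M: "0 \<le> M"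
    and le: "\<And>\<xi>. 1 < norm \<xi> \<Longrightarrow> norm (h \<xi>) \<le> M * decay t \<xi> * norm (H \<xi>)" and f: "Lp 2 f"
  shows "norm (LINT x|lebesgue. synth (highpass h) x *\<^sub>R f x)
    \<le> M * sqrt (2 * pi) ^ DIM('a) * exp (- t / 4) * Lp_norm 2 f * Lp_norm 2 H"
proof -
  let ?h = "highpass h" and ?c = "sqrt (2 * pi) ^ DIM('a)"
  note bl = band_limited_pass(2) [OF h]
  have pt: "norm (?h \<xi>) \<le> M * exp (- t / 4) * norm (H \<xi>)" for \<xi>
  proof (cases "norm \<xi> \<le> 1")
    case False
    then have "1 \<le> (norm \<xi>)\<^sup>2" by (simp add: one_le_power)
    then have "decay t \<xi> = exp (- t / 4)" by (simp add: decay_def min_absorb1)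
    with le [of \<xi>] False show ?thesis by (simp add: highpass_def)
  qed (use M in \<open>simp add: highpass_def\<close>)
  have "(LINT \<xi>|lborel. (norm (?h \<xi>))\<^sup>2) \<le> (LINT \<xi>|lborel. (M * exp (- t / 4))\<^sup>2 * (norm (H \<xi>))\<^sup>2)"
    using power_mono [OF pt norm_ge_zero, of _ 2]
    by (intro integral_mono band_limited_square_integrable bl integrable_mult_right H)
      (simp add: power_mult_distrib)
  then have "sqrt (LINT \<xi>|lborel. (norm (?h \<xi>))\<^sup>2) \<le> sqrt ((M * exp (- t / 4))\<^sup>2 * (LINT \<xi>|lborel. (norm (H \<xi>))\<^sup>2))"
    by simp
  then have n: "Lp_norm 2 ?h \<le> M * exp (- t / 4) * Lp_norm 2 H"
    unfolding Lp_2_lborel(2) [OF band_limited_measurable [OF bl]] Lp_2_lborel(2) [OF band_limited_measurable [OF H]]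
    using M by (simp add: real_sqrt_mult)
  have "norm (LINT x|lebesgue. synth ?h x *\<^sub>R f x) \<le> Lp_norm 2 (synth ?h) * Lp_norm 2 f"
    by (rule Lp_2_Cauchy_Schwarz(3) [OF Lp_2_synth [OF bl] f])
  also have "\<dots> \<le> (?c * Lp_norm 2 ?h) * Lp_norm 2 f"
    by (intro mult_right_mono synth_Lp2_bound band_limited_integrable band_limited_square_integrable bl) simp
  also have "\<dots> \<le> (?c * (M * exp (- t / 4) * Lp_norm 2 H)) * Lp_norm 2 f"
    using n by (intro mult_right_mono mult_left_mono) auto
  finally show ?thesis by (simp only: mult_ac)
qed

lemma synth_pass:
  assumes h: "band_limited h" and f: "Lp 2 f"
  shows "(LINT x|lebesgue. synth h x *\<^sub>R (f x :: complex)) =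
    (LINT x|lebesgue. synth (lowpass h) x *\<^sub>R f x) + (LINT x|lebesgue. synth (highpass h) x *\<^sub>R f x)"
proof -
  note b = band_limited_pass [OF h]
  have "h = (\<lambda>\<xi>. lowpass h \<xi> + highpass h \<xi>)" by (auto simp: lowpass_def highpass_def)
  then have "synth h x = synth (lowpass h) x + synth (highpass h) x" for x
    using synth_add [OF band_limited_integrable [OF b(1)] band_limited_integrable [OF b(2)], of x] by simp
  then show ?thesis
    by (simp only: scaleR_add_left)
      (intro Bochner_Integration.integral_add Lp_2_Cauchy_Schwarz(1) Lp_2_synth b f)
qed

lemma full_pairing:
  fixes h H :: "'a::euclidean_space \<Rightarrow> complex" and f :: "'a \<Rightarrow> complex"
  assumes h: "band_limited h" and H: "band_limited H" and t: "0 \<le> t" and M: "0 \<le> M"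
    and le: "\<And>\<xi>. norm (h \<xi>) \<le> M * decay t \<xi> * norm (H \<xi>)" and f: "Lp 1 f" "Lp 2 f"
  shows "norm (LINT x|lebesgue. synth h x *\<^sub>R f x)
    \<le> (M * heat_decay DIM('a) t * Lp_norm 1 f + M * sqrt (2 * pi) ^ DIM('a) * exp (- t / 4) * Lp_norm 2 f) * Lp_norm 2 H"
  unfolding synth_pass [OF h f(2)] distrib_right
  by (intro order_trans [OF norm_triangle_ineq] add_mono lowpass_pairing highpass_pairing h H t M le f)

text \<open>A weak solution attains its data only almost everywhere; this lets the data replace
  \<open>u 0\<close> and \<open>ut 0\<close> in pairings.\<close>

lemma mpair_AE_cong:
  assumes H: "band_limited H" and \<mu>: "multiplier \<mu>" and f: "Lp 2 f" and g: "Lp 2 g"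
    and ae: "AE x in lebesgue. f x = g x"
  shows "mpair H \<mu> f = mpair H \<mu> g"
  unfolding mpair_def
proof (rule integral_cong_AE)
  note b = Lp_2_synth [OF band_limited_multiplier [OF H \<mu>]]
  show "(\<lambda>x. synth (\<lambda>\<xi>. of_real (\<mu> \<xi>) * H \<xi>) x *\<^sub>R f x) \<in> borel_measurable lebesgue"
    "(\<lambda>x. synth (\<lambda>\<xi>. of_real (\<mu> \<xi>) * H \<xi>) x *\<^sub>R g x) \<in> borel_measurable lebesgue"
    using Lp_2_Cauchy_Schwarz(1) [OF b f] Lp_2_Cauchy_Schwarz(1) [OF b g] by auto
  show "AE x in lebesgue. synth (\<lambda>\<xi>. of_real (\<mu> \<xi>) * H \<xi>) x *\<^sub>R f x = synth (\<lambda>\<xi>. of_real (\<mu> \<xi>) * H \<xi>) x *\<^sub>R g x"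
    using ae by eventually_elim simp
qed

lemma Lp_norm_2_component_le:
  fixes g :: "'a::euclidean_space \<Rightarrow> complex^'n::finite"
  assumes g: "Lp 2 g" shows "Lp_norm 2 (\<lambda>x. g x $ j) \<le> Lp_norm 2 g"
proof -
  have "(LINT x|lebesgue. (norm (g x $ j))\<^sup>2) \<le> (LINT x|lebesgue. (norm (g x))\<^sup>2)"
    using g Lp_2_component [OF g, of j]
    by (intro integral_mono power_mono Finite_Cartesian_Product.norm_nth_le) (auto simp: Lp_2_iff)
  then show ?thesis by (simp add: Lp_norm_2_eq)
qed

lemma Lp_norm_2_le_sum_components:
  fixes g :: "'a::euclidean_space \<Rightarrow> complex^'n::finite"
  assumes g: "Lp 2 g" shows "Lp_norm 2 g \<le> (\<Sum>j\<in>UNIV. Lp_norm 2 (\<lambda>x. g x $ j))"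
proof -
  have "(LINT x|lebesgue. (norm (g x))\<^sup>2) = (LINT x|lebesgue. (\<Sum>j\<in>UNIV. (norm (g x $ j))\<^sup>2))"
    by (simp add: norm_vec_def L2_set_def sum_nonneg)
  also have "\<dots> = (\<Sum>j\<in>UNIV. (Lp_norm 2 (\<lambda>x. g x $ j))\<^sup>2)"
    unfolding Lp_norm_2_sq
    by (rule Bochner_Integration.integral_sum) (use Lp_2_component [OF g] in \<open>simp add: Lp_2_iff\<close>)
  finally have "Lp_norm 2 g = L2_set (\<lambda>j. Lp_norm 2 (\<lambda>x. g x $ j)) UNIV"
    by (simp add: Lp_norm_2_eq [of g] L2_set_def)
  also have "\<dots> \<le> (\<Sum>j\<in>UNIV. Lp_norm 2 (\<lambda>x. g x $ j))" by (rule L2_set_le_sum) simp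
  finally show ?thesis .
qed

lemma H1_grad:
  assumes "H1 f" shows "Lp 2 f" "Lp 2 (grad f)" "weak_gradient f (grad f)"
  using assms someI_ex [of "\<lambda>g. Lp 2 g \<and> weak_gradient f g"] unfolding H1_def grad_def by blast+

lemma H1_norm_ge:
  "Lp_norm 2 f \<le> H1_norm f" "Lp_norm 2 (grad f) \<le> H1_norm f"
  unfolding H1_norm_def by (simp_all add: real_le_rsqrt)

text \<open>At high frequencies the multiplier of \<open>u0\<close> in \<open>u\<^sub>t\<close> grows like \<open>\<bar>\<xi>\<bar>\<close>; one factor \<open>\<xi>\<close> is
  integrated by parts onto the initial datum.\<close>

lemma highpass_gradient_pairing:
  fixes h H :: "real^'n::finite \<Rightarrow> complex" and f :: "real^'n \<Rightarrow> complex"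
  assumes h: "band_limited h" and H: "band_limited H" and t: "0 \<le> t" and M: "0 \<le> M"
    and le: "\<And>\<xi>. 1 < norm \<xi> \<Longrightarrow> norm (h \<xi>) \<le> norm \<xi> * (M * decay t \<xi> * norm (H \<xi>))"
    and f: "Lp 2 f" and g: "Lp 2 g" and wg: "weak_gradient f g"
  shows "norm (LINT x|lebesgue. synth (highpass h) x *\<^sub>R f x)
    \<le> real CARD('n) * (M * sqrt (2 * pi) ^ CARD('n) * exp (- t / 4) * Lp_norm 2 g) * Lp_norm 2 H"
proof -
  \<comment> \<open>Since the sum of \<xi>_j \<xi>_j / |\<xi>|^2 is 1, the high-frequency part of
    \<open>h\<close> is the sum of i \<xi>_j w_j. The division is harmless where |\<xi>| > 1, and
    each w_j is smaller than \<open>h\<close> by a factor |\<xi>|.\<close>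
  define \<mu> where "\<mu> j \<xi> = (if norm \<xi> \<le> 1 then 0 else \<xi> $ j / (norm \<xi>)\<^sup>2)" for j and \<xi> :: "real^'n"
  define w where "w j \<xi> = (- \<i> * of_real (\<mu> j \<xi>)) * h \<xi>" for j \<xi>
  have \<mu>_le: "\<bar>\<mu> j \<xi>\<bar> * norm \<xi> \<le> 1" for j \<xi>
  proof (cases "norm \<xi> \<le> 1")
    case False
    have "\<bar>\<xi> $ j\<bar> \<le> norm \<xi>" by (rule component_le_norm_cart)
    with False show ?thesis by (simp add: \<mu>_def abs_mult power2_eq_square divide_le_eq)
  qed (simp add: \<mu>_def)
  have \<mu>_1: "\<bar>\<mu> j \<xi>\<bar> \<le> 1" for j \<xi>
  proof (cases "norm \<xi> \<le> 1")
    case False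
    then have "\<bar>\<mu> j \<xi>\<bar> * 1 \<le> \<bar>\<mu> j \<xi>\<bar> * norm \<xi>" by (intro mult_left_mono) auto
    then show ?thesis using \<mu>_le [of j \<xi>] by linarith
  qed (simp add: \<mu>_def)
  have bw: "band_limited (w j)" for j
    unfolding w_def [abs_def]
  proof (rule band_limited_mult [OF h])
    have [measurable]: "(\<lambda>\<xi>::real^'n. \<xi> $ j) \<in> borel_measurable borel"
      by (intro borel_measurable_continuous_onI continuous_intros)
    show "(\<lambda>\<xi>. - \<i> * of_real (\<mu> j \<xi>)) \<in> borel_measurable borel"
      unfolding \<mu>_def [abs_def] by measurable
    show "\<exists>B. \<forall>\<xi>. norm \<xi> \<le> R \<longrightarrow> norm (- \<i> * of_real (\<mu> j \<xi>)) \<le> B" for R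
      using \<mu>_1 by (intro exI [of _ 1]) (simp add: norm_mult)
  qed
  define w' where "w' j \<xi> = \<i> * of_real (\<xi> $ j) * w j \<xi>" for j \<xi>
  have bw': "band_limited (w' j)" for j
    unfolding w'_def [abs_def] using band_limited_dir [OF bw, of "axis j 1"] by (simp add: inner_axis')
  have "highpass h = (\<lambda>\<xi>. \<Sum>j\<in>UNIV. w' j \<xi>)"
  proof
    fix \<xi>
    show "highpass h \<xi> = (\<Sum>j\<in>UNIV. w' j \<xi>)"
    proof (cases "norm \<xi> \<le> 1")
      case False
      then have n0: "(norm \<xi>)\<^sup>2 \<noteq> 0" by auto
      have "w' j \<xi> = of_real ((\<xi> $ j)\<^sup>2 / (norm \<xi>)\<^sup>2) * h \<xi>" for j
      proof -
        have "w' j \<xi> = (\<i> * (- \<i>)) * of_real (\<xi> $ j * \<mu> j \<xi>) * h \<xi>"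
          unfolding w'_def w_def of_real_mult by (simp only: mult_ac)
        then show ?thesis using False by (simp add: \<mu>_def power2_eq_square)
      qed
      then have "(\<Sum>j\<in>UNIV. w' j \<xi>) = of_real ((\<Sum>j\<in>UNIV. (\<xi> $ j)\<^sup>2) / (norm \<xi>)\<^sup>2) * h \<xi>"
        by (simp only: sum_distrib_right [symmetric] of_real_sum [symmetric] sum_divide_distrib)
      also have "(\<Sum>j\<in>UNIV. (\<xi> $ j)\<^sup>2) = (norm \<xi>)\<^sup>2"
        unfolding power2_norm_eq_inner inner_vec_def by (simp add: power2_eq_square)
      finally show ?thesis using False n0 by (simp add: highpass_def)
    qed (simp add: highpass_def w'_def w_def \<mu>_def)
  qed
  then have "synth (highpass h) x = (\<Sum>j\<in>UNIV. synth (w' j) x)" for x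
    using synth_sum [of UNIV w' x] band_limited_integrable [OF bw'] by simp
  then have "(LINT x|lebesgue. synth (highpass h) x *\<^sub>R f x) = (\<Sum>j\<in>UNIV. LINT x|lebesgue. synth (w' j) x *\<^sub>R f x)"
    by (simp only: scaleR_sum_left)
      (intro Bochner_Integration.integral_sum Lp_2_Cauchy_Schwarz(1) Lp_2_synth bw' f)
  also have "norm \<dots> \<le> (\<Sum>j\<in>(UNIV::'n set). M * sqrt (2 * pi) ^ CARD('n) * exp (- t / 4) * Lp_norm 2 g * Lp_norm 2 H)"
  proof (rule sum_norm_le)
    fix j :: 'n
    have hw: "highpass (w j) = w j"
      by (auto simp: highpass_def w_def \<mu>_def)
    have "norm (w j \<xi>) \<le> M * decay t \<xi> * norm (H \<xi>)" if "1 < norm \<xi>" for \<xi>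
    proof -
      have "norm (w j \<xi>) = \<bar>\<mu> j \<xi>\<bar> * norm (h \<xi>)" by (simp add: w_def norm_mult)
      also have "\<dots> \<le> \<bar>\<mu> j \<xi>\<bar> * (norm \<xi> * (M * decay t \<xi> * norm (H \<xi>)))"
        using le [OF that] by (rule mult_left_mono) simp
      also have "\<dots> = (\<bar>\<mu> j \<xi>\<bar> * norm \<xi>) * (M * decay t \<xi> * norm (H \<xi>))" by (simp only: mult.assoc)
      also have "\<dots> \<le> 1 * (M * decay t \<xi> * norm (H \<xi>))"
        using \<mu>_le M by (intro mult_right_mono) (auto simp: decay_def)
      finally show ?thesis by simp
    qed
    from highpass_pairing [OF bw H t M this Lp_2_component [OF g, of j]]
    have "norm (LINT x|lebesgue. synth (w j) x *\<^sub>R (g x $ j)) \<le>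
        M * sqrt (2 * pi) ^ CARD('n) * exp (- t / 4) * Lp_norm 2 (\<lambda>x. g x $ j) * Lp_norm 2 H"
      by (simp add: hw)
    also have "\<dots> \<le> M * sqrt (2 * pi) ^ CARD('n) * exp (- t / 4) * Lp_norm 2 g * Lp_norm 2 H"
      using M by (intro mult_right_mono mult_left_mono Lp_norm_2_component_le g) auto
    also have "norm (LINT x|lebesgue. synth (w j) x *\<^sub>R (g x $ j)) = norm (LINT x|lebesgue. synth (w' j) x *\<^sub>R f x)"
      unfolding w'_def [abs_def] weak_gradient_synth [OF f g wg bw] by simp
    finally show "norm (LINT x|lebesgue. synth (w' j) x *\<^sub>R f x)
      \<le> M * sqrt (2 * pi) ^ CARD('n) * exp (- t / 4) * Lp_norm 2 g * Lp_norm 2 H" .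
  qed
  finally show ?thesis by simp
qed

text \<open>\<open>M\<close> dominates 2, 2 / m and 2 (1 + m), the constants of the multiplier
  bounds. One common \<Lambda> serves \<open>u\<close>, \<open>ut\<close> and the derivatives of
  \<open>u\<close>; the factor CARD('n) + 1 covers the sum over components in the high-frequency
  estimate of \<open>ut\<close>.\<close>

lemma solution_pairing_bounds:
  fixes u :: "real \<Rightarrow> real^'n::finite \<Rightarrow> complex"
  assumes m: "m > 0" and ws: "weak_solution m u0 u1 u ut"
    and u0: "H1 u0" "Lp 1 u0" and u1: "Lp 2 u1" "Lp 1 u1"
    and t: "0 \<le> t" and H: "band_limited H"
  defines "M \<equiv> 2 * (1 + m + 1 / m)"
  defines "\<Lambda> \<equiv> M * heat_decay CARD('n) t * (Lp_norm 1 u1 + Lp_norm 1 u0)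
    + (real CARD('n) + 1) * (M * sqrt (2 * pi) ^ CARD('n)) * exp (- t / 4) * (Lp_norm 2 u1 + H1_norm u0)"
  shows "norm (mpair H (\<lambda>\<xi>. 1) (u t)) \<le> \<Lambda> * Lp_norm 2 H"
    and "norm (mpair H (\<lambda>\<xi>. 1) (ut t)) \<le> \<Lambda> * Lp_norm 2 H"
    and "norm (mpair (\<lambda>\<xi>. \<i> * of_real (\<xi> $ j) * H \<xi>) (\<lambda>\<xi>. 1) (u t)) \<le> \<Lambda> * Lp_norm 2 H"
proof -
  let ?D = "heat_decay CARD('n) t" and ?c = "sqrt (2 * pi) ^ CARD('n)" and ?e = "exp (- t / 4)" and ?n = "real CARD('n)"
  note G = H1_grad [OF u0(1)]
  let ?g = "grad u0"
  have C1: "C1_L2 u ut" and ae: "AE x in lebesgue. u 0 x = u0 x" "AE x in lebesgue. ut 0 x = u1 x"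
    using ws by (auto simp: weak_solution_def)
  have L0: "Lp 2 (u 0)" "Lp 2 (ut 0)" using C1 by (auto simp: C1_L2_def continuous_L2_def)
  have M: "2 \<le> M" "2 / m \<le> M" "2 * (1 + m) \<le> M" "0 \<le> M" using m by (auto simp: M_def algebra_simps)
  have D0: "0 \<le> ?D" by (simp add: heat_decay_def)
  have n1: "1 \<le> ?n" by (simp add: Suc_leI)
  have dec: "0 \<le> decay t \<xi>" for \<xi> :: "real^'n" by (simp add: decay_def)
  have k: "\<bar>damped m t \<xi>\<bar> \<le> M * decay t \<xi>" for \<xi> :: "real^'n"
  proof -
    have "\<bar>damped m t \<xi>\<bar> \<le> 2 / m * decay t \<xi>"
      using damped_bounds(3) [OF m t, of \<xi>] m by (simp add: field_simps)
    also have "\<dots> \<le> M * decay t \<xi>" by (intro mult_right_mono M dec)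
    finally show ?thesis .
  qed
  have M2: "2 * decay t \<xi> \<le> M * decay t \<xi>" for \<xi> :: "real^'n" by (intro mult_right_mono M dec)
  note k1 = order_trans [OF damped_bounds(1) [OF m t] M2] and rk = order_trans [OF damped_bounds(2) [OF m t] M2]
  have l0: "\<bar>lam0 m t \<xi>\<bar> \<le> M * decay t \<xi>" for \<xi> :: "real^'n"
    unfolding lam0_def using order_trans [OF damped_bounds(4) [OF m t] M2] .
  have l1: "\<bar>lam1 m t \<xi>\<bar> \<le> (norm \<xi> + m) * (2 * decay t \<xi>)" for \<xi> :: "real^'n"
    using damped_bounds(5) [OF m t, of \<xi>] by (simp only: lam1_def abs_minus)
  have l1_low: "\<bar>lam1 m t \<xi>\<bar> \<le> M * decay t \<xi>" if "norm \<xi> \<le> 1" for \<xi> :: "real^'n"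
  proof -
    have "\<bar>lam1 m t \<xi>\<bar> \<le> (1 + m) * (2 * decay t \<xi>)"
      by (rule order_trans [OF l1]) (use that dec in \<open>intro mult_right_mono, auto\<close>)
    also have "\<dots> = (2 * (1 + m)) * decay t \<xi>" by simp
    also have "\<dots> \<le> M * decay t \<xi>" by (intro mult_right_mono M dec)
    finally show ?thesis .
  qed
  have l1_high: "\<bar>lam1 m t \<xi>\<bar> \<le> norm \<xi> * (M * decay t \<xi>)" if "1 < norm \<xi>" for \<xi> :: "real^'n"
  proof -
    have "m \<le> norm \<xi> * m" using that m by simp
    then have "\<bar>lam1 m t \<xi>\<bar> \<le> (norm \<xi> + norm \<xi> * m) * (2 * decay t \<xi>)"
      by (intro order_trans [OF l1] mult_right_mono) (use dec in auto)
    also have "\<dots> = norm \<xi> * ((2 * (1 + m)) * decay t \<xi>)" by (simp add: algebra_simps)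
    also have "\<dots> \<le> norm \<xi> * (M * decay t \<xi>)" by (intro mult_left_mono mult_right_mono M dec) auto
    finally show ?thesis .
  qed
  have cmp: "norm (of_real a * z) \<le> b * norm z" if "\<bar>a\<bar> \<le> b" for a b and z :: complex
    using that by (simp add: norm_mult mult_right_mono)
  note dm = damped_multiplier [OF m t] lam_multiplier [OF m t]
  note N = H1_norm_ge [of u0]
  have H1_nonneg: "0 \<le> H1_norm u0" by (simp add: H1_norm_def)
  have HH: "0 \<le> Lp_norm 2 H" by simp
  let ?A1 = "M * ?D * Lp_norm 1 u1 + M * ?c * ?e * Lp_norm 2 u1"
  \<comment> \<open>\<open>x\<close> is the high-frequency share of \<open>u0\<close>. It costs
    CARD('n) units for \<open>ut\<close> but a single one in the other two cases, which
    \<open>single\<close> fits into the same bound.\<close>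
  have \<Lambda>_ge: "?A1 + (M * ?D * Lp_norm 1 u0 + x) \<le> \<Lambda>" if "x \<le> ?n * (M * ?c * ?e * H1_norm u0)" for x
  proof -
    have p: "0 \<le> M * ?c * ?e * Lp_norm 2 u1" "0 \<le> M * ?c * ?e * H1_norm u0"
      using M H1_nonneg by simp_all
    then have "0 \<le> ?n * (M * ?c * ?e * Lp_norm 2 u1)" by simp
    moreover have "\<Lambda> = M * ?D * Lp_norm 1 u1 + M * ?D * Lp_norm 1 u0
        + (?n * (M * ?c * ?e * Lp_norm 2 u1) + M * ?c * ?e * Lp_norm 2 u1
          + ?n * (M * ?c * ?e * H1_norm u0) + M * ?c * ?e * H1_norm u0)"
      unfolding \<Lambda>_def by (simp only: distrib_left distrib_right mult_1_left mult.assoc add.assoc)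
    ultimately show ?thesis using that p by linarith
  qed
  have single: "x \<le> ?n * (M * ?c * ?e * H1_norm u0)" if "x \<le> M * ?c * ?e * H1_norm u0" for x
  proof -
    have "1 * (M * ?c * ?e * H1_norm u0) \<le> ?n * (M * ?c * ?e * H1_norm u0)"
      using n1 M H1_nonneg by (intro mult_right_mono) auto
    with that show ?thesis by simp
  qed
  have combine: "norm (x + y) \<le> \<Lambda> * Lp_norm 2 H"
    if x: "norm x \<le> ?A1 * Lp_norm 2 H" and y: "norm y \<le> (M * ?D * Lp_norm 1 u0 + z) * Lp_norm 2 H"
      and z: "z \<le> ?n * (M * ?c * ?e * H1_norm u0)" for x y :: complex and z
  proof -
    have "norm (x + y) \<le> ?A1 * Lp_norm 2 H + (M * ?D * Lp_norm 1 u0 + z) * Lp_norm 2 H"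
      using norm_triangle_ineq [of x y] x y by linarith
    also have "\<dots> = (?A1 + (M * ?D * Lp_norm 1 u0 + z)) * Lp_norm 2 H" by (simp only: distrib_right)
    also have "\<dots> \<le> \<Lambda> * Lp_norm 2 H" by (rule mult_right_mono [OF \<Lambda>_ge [OF z] HH])
    finally show ?thesis .
  qed
  have mono: "M * ?c * ?e * x \<le> M * ?c * ?e * H1_norm u0" if "x \<le> H1_norm u0" for x
    using that M by (intro mult_left_mono) auto
  have full: "norm (LINT x|lebesgue. synth h x *\<^sub>R f x) \<le> (M * ?D * Lp_norm 1 f + M * ?c * ?e * Lp_norm 2 f) * Lp_norm 2 H"
    if "band_limited h" "\<And>\<xi>. norm (h \<xi>) \<le> M * decay t \<xi> * norm (H \<xi>)" "Lp 1 f" "Lp 2 f" for h and f :: "real^'n \<Rightarrow> complex"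
    using full_pairing [OF that(1) H t M(4) that(2-4)] by simp
  have ut0: "mpair h \<mu> (ut 0) = mpair h \<mu> u1" and u0': "mpair h \<mu> (u 0) = mpair h \<mu> u0"
    if "band_limited h" "multiplier \<mu>" for h \<mu>
    using mpair_AE_cong [OF that L0(2) u1(1) ae(2)] mpair_AE_cong [OF that L0(1) G(1) ae(1)] by auto
  show "norm (mpair H (\<lambda>\<xi>. 1) (u t)) \<le> \<Lambda> * Lp_norm 2 H"
    unfolding weak_solution_representation(1) [OF m ws H t] ut0 [OF H dm(1)] u0' [OF H dm(3)]
  proof (rule combine [OF _ _ single [OF mono [OF N(1)]]])
    show "norm (mpair H (damped m t) u1) \<le> ?A1 * Lp_norm 2 H"
      unfolding mpair_def by (intro full band_limited_multiplier H dm cmp k u1)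
    show "norm (mpair H (lam0 m t) u0) \<le> (M * ?D * Lp_norm 1 u0 + M * ?c * ?e * Lp_norm 2 u0) * Lp_norm 2 H"
      unfolding mpair_def by (intro full band_limited_multiplier H dm cmp l0 u0 G)
  qed
  show "norm (mpair H (\<lambda>\<xi>. 1) (ut t)) \<le> \<Lambda> * Lp_norm 2 H"
    unfolding weak_solution_representation(2) [OF m ws H t] ut0 [OF H dm(2)] u0' [OF H dm(4)]
  proof (rule combine)
    show "norm (mpair H (damped_d m t) u1) \<le> ?A1 * Lp_norm 2 H"
      unfolding mpair_def by (intro full band_limited_multiplier H dm cmp k1 u1)
    \<comment> \<open>\<open>lam1\<close> is bounded by \<open>M\<close> times \<open>decay\<close>
      only for |\<xi>| \<le> 1, so the two frequency ranges need different norms of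
      \<open>u0\<close>: L^1 below, the gradient above.\<close>
    let ?h = "\<lambda>\<xi>. of_real (lam1 m t \<xi>) * H \<xi>"
    have bh: "band_limited ?h" by (rule band_limited_multiplier [OF H dm(4)])
    have "norm (LINT x|lebesgue. synth (lowpass ?h) x *\<^sub>R u0 x) \<le> M * ?D * Lp_norm 1 u0 * Lp_norm 2 H"
      using lowpass_pairing [OF bh H t M(4) cmp [OF l1_low] u0(2)] by simp
    moreover have "norm (LINT x|lebesgue. synth (highpass ?h) x *\<^sub>R u0 x) \<le> ?n * (M * ?c * ?e * Lp_norm 2 ?g) * Lp_norm 2 H"
      by (rule highpass_gradient_pairing [OF bh H t M(4) _ G])
        (use cmp [OF l1_high] in \<open>simp add: mult.assoc\<close>)
    ultimately show "norm (mpair H (lam1 m t) u0) \<le> (M * ?D * Lp_norm 1 u0 + ?n * (M * ?c * ?e * Lp_norm 2 ?g)) * Lp_norm 2 H"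
      unfolding mpair_def synth_pass [OF bh G(1)] distrib_right by (rule norm_triangle_mono)
    show "?n * (M * ?c * ?e * Lp_norm 2 ?g) \<le> ?n * (M * ?c * ?e * H1_norm u0)"
      by (rule mult_left_mono [OF mono [OF N(2)]]) simp
  qed
  let ?Hj = "\<lambda>\<xi>. \<i> * of_real (\<xi> $ j) * H \<xi>"
  have bHj: "band_limited ?Hj" using band_limited_dir [OF H, of "axis j 1"] by (simp add: inner_axis')
  have Hj_le: "norm (?Hj \<xi>) \<le> norm \<xi> * norm (H \<xi>)" for \<xi>
    by (simp add: norm_mult mult_right_mono component_le_norm_cart)
  show "norm (mpair ?Hj (\<lambda>\<xi>. 1) (u t)) \<le> \<Lambda> * Lp_norm 2 H"
    unfolding weak_solution_representation(1) [OF m ws bHj t] ut0 [OF bHj dm(1)] u0' [OF bHj dm(3)]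
  proof (rule combine [OF _ _ single [OF mono [OF N(2)]]])
    \<comment> \<open>For the datum \<open>u1\<close> the factor |\<xi>| of the derivative is
      absorbed by \<open>damped\<close>, without using derivatives of \<open>u1\<close>.\<close>
    have "norm (of_real (damped m t \<xi>) * ?Hj \<xi>) \<le> M * decay t \<xi> * norm (H \<xi>)" for \<xi>
    proof -
      have "norm (of_real (damped m t \<xi>) * ?Hj \<xi>) \<le> \<bar>damped m t \<xi>\<bar> * (norm \<xi> * norm (H \<xi>))"
        unfolding norm_mult [of "of_real _"] norm_of_real by (rule mult_left_mono [OF Hj_le]) simp
      also have "\<dots> = (norm \<xi> * \<bar>damped m t \<xi>\<bar>) * norm (H \<xi>)" by (simp only: mult_ac)
      also have "\<dots> \<le> M * decay t \<xi> * norm (H \<xi>)" by (rule mult_right_mono [OF rk]) simp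
      finally show ?thesis .
    qed
    then show "norm (mpair ?Hj (damped m t) u1) \<le> ?A1 * Lp_norm 2 H"
      unfolding mpair_def by (intro full band_limited_multiplier bHj dm u1)
    let ?h = "\<lambda>\<xi>. of_real (lam0 m t \<xi>) * ?Hj \<xi>" and ?l = "\<lambda>\<xi>. of_real (lam0 m t \<xi>) * H \<xi>"
    have bh: "band_limited ?h" by (rule band_limited_multiplier [OF bHj dm(3)])
    have bl: "band_limited ?l" by (rule band_limited_multiplier [OF H dm(3)])
    have low: "norm (LINT x|lebesgue. synth (lowpass ?h) x *\<^sub>R u0 x) \<le> M * ?D * Lp_norm 1 u0 * Lp_norm 2 H"
    proof -
      have "norm (?h \<xi>) \<le> M * decay t \<xi> * norm (H \<xi>)" if "norm \<xi> \<le> 1" for \<xi>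
      proof -
        have "norm (?h \<xi>) \<le> (M * decay t \<xi>) * norm (?Hj \<xi>)" by (rule cmp [OF l0])
        also have "\<dots> \<le> (M * decay t \<xi>) * (1 * norm (H \<xi>))"
          using M dec that by (intro mult_left_mono order_trans [OF Hj_le] mult_right_mono) auto
        finally show ?thesis by simp
      qed
      from lowpass_pairing [OF bh H t M(4) this u0(2)] show ?thesis by simp
    qed
    \<comment> \<open>The bound on \<open>lam0\<close> leaves no room for the factor |\<xi>|. At
      high frequencies i \<xi>_j is therefore pulled out and integrated by parts onto
      \<open>u0\<close>; at low frequencies it is at most 1.\<close>
    have "highpass ?h = (\<lambda>\<xi>. \<i> * of_real (\<xi> $ j) * highpass ?l \<xi>)"
      by (auto simp: highpass_def mult_ac)
    then have "(LINT x|lebesgue. synth (highpass ?h) x *\<^sub>R u0 x) = - (LINT x|lebesgue. synth (highpass ?l) x *\<^sub>R (?g x $ j))"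
      using weak_gradient_synth [OF G band_limited_pass(2) [OF bl], of j] by simp
    moreover have "norm (LINT x|lebesgue. synth (highpass ?l) x *\<^sub>R (?g x $ j)) \<le>
        M * ?c * ?e * Lp_norm 2 (\<lambda>x. ?g x $ j) * Lp_norm 2 H"
      using highpass_pairing [OF bl H t M(4) cmp [OF l0] Lp_2_component [OF G(2), of j]] by simp
    moreover have "M * ?c * ?e * Lp_norm 2 (\<lambda>x. ?g x $ j) * Lp_norm 2 H \<le> M * ?c * ?e * Lp_norm 2 ?g * Lp_norm 2 H"
      using M by (intro mult_right_mono mult_left_mono Lp_norm_2_component_le G) auto
    ultimately have "norm (LINT x|lebesgue. synth (highpass ?h) x *\<^sub>R u0 x) \<le> M * ?c * ?e * Lp_norm 2 ?g * Lp_norm 2 H"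
      by simp
    then show "norm (mpair ?Hj (lam0 m t) u0) \<le> (M * ?D * Lp_norm 1 u0 + M * ?c * ?e * Lp_norm 2 ?g) * Lp_norm 2 H"
      unfolding mpair_def synth_pass [OF bh G(1)] distrib_right using low by (intro norm_triangle_mono)
  qed
qed

section \<open>From pairings to norms by duality\<close>

theorem theorem1p1:
  shows "\<exists>\<alpha>>0. \<forall>m>0. \<exists>C>0.
    \<forall>(u0 :: real^'n::finite \<Rightarrow> complex) u1 u ut.
      H1 u0 \<and> Lp 1 u0 \<and> Lp 2 u1 \<and> Lp 1 u1 \<and> weak_solution m u0 u1 u ut \<longrightarrow>
      (\<forall>t\<ge>0.
        Lp_norm 2 (ut t) + Lp_norm 2 (u t) + Lp_norm 2 (grad (u t))
        \<le> C * (1 + t) powr (- (real CARD('n) / 4)) * (Lp_norm 1 u1 + Lp_norm 1 u0)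
          + C * exp (- \<alpha> * t) * (Lp_norm 2 u1 + H1_norm u0))"
proof (rule exI [of _ "1/4"], intro conjI allI impI)
  fix m :: real assume m: "m > 0"
  let ?n = "real CARD('n)" and ?c = "sqrt (2 * pi) ^ CARD('n)"
  define M where "M = 2 * (1 + m + 1 / m)"
  define P where "P = M * (exp (1 / 4) * sqrt ?c)"
  define Q where "Q = (?n + 1) * (M * ?c)"
  have M: "0 < M" using m by (simp add: M_def add_pos_pos)
  have P: "0 < P" and Q: "0 < Q" using M by (simp_all add: P_def Q_def add_nonneg_pos)
  \<comment> \<open>Duality gives 2 \<Lambda> for each of \<open>u t\<close> and
    \<open>ut t\<close>, and 2 \<Lambda> for each of the CARD('n) components of the gradient. P and
    Q belong to the polynomial and the exponential term; their sum allows one constant for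
    both.\<close>
  define C where "C = (4 + 2 * ?n) * (P + Q)"
  show "\<exists>C>0. \<forall>(u0 :: real^'n \<Rightarrow> complex) u1 u ut.
      H1 u0 \<and> Lp 1 u0 \<and> Lp 2 u1 \<and> Lp 1 u1 \<and> weak_solution m u0 u1 u ut \<longrightarrow>
      (\<forall>t\<ge>0.
        Lp_norm 2 (ut t) + Lp_norm 2 (u t) + Lp_norm 2 (grad (u t))
        \<le> C * (1 + t) powr (- (?n / 4)) * (Lp_norm 1 u1 + Lp_norm 1 u0)
          + C * exp (- (1/4) * t) * (Lp_norm 2 u1 + H1_norm u0))"
  proof (intro exI [of _ C] conjI allI impI)
    show "0 < C" using P Q by (simp add: C_def add_pos_nonneg)
    fix u0 u1 :: "real^'n \<Rightarrow> complex" and u ut and t :: real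
    assume "H1 u0 \<and> Lp 1 u0 \<and> Lp 2 u1 \<and> Lp 1 u1 \<and> weak_solution m u0 u1 u ut" and t: "0 \<le> t"
    then have data: "H1 u0" "Lp 1 u0" "Lp 2 u1" "Lp 1 u1" and ws: "weak_solution m u0 u1 u ut" by auto
    let ?X = "(1 + t) powr (- (?n / 4)) * (Lp_norm 1 u1 + Lp_norm 1 u0)"
    let ?Y = "exp (- (1/4) * t) * (Lp_norm 2 u1 + H1_norm u0)"
    have X: "0 \<le> ?X" and Y: "0 \<le> ?Y" by (simp_all add: H1_norm_def)
    define \<Lambda> where "\<Lambda> = P * ?X + Q * ?Y"
    have \<Lambda>0: "0 \<le> \<Lambda>" using P Q X Y by (simp add: \<Lambda>_def)
    have \<Lambda>_eq: "M * heat_decay CARD('n) t * (Lp_norm 1 u1 + Lp_norm 1 u0)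
        + (?n + 1) * (M * ?c) * exp (- t / 4) * (Lp_norm 2 u1 + H1_norm u0) = \<Lambda>"
      by (simp add: \<Lambda>_def P_def Q_def heat_decay_def mult.assoc)
    note bounds = solution_pairing_bounds [OF m ws data t, folded M_def, unfolded \<Lambda>_eq]
    have pair: "(LINT x|lebesgue. synth h x *\<^sub>R f x) = mpair h (\<lambda>\<xi>. 1) f" for h :: "real^'n \<Rightarrow> complex" and f
      by (simp add: mpair_def)
    have L: "Lp 2 (u t)" "Lp 2 (ut t)" and H1u: "H1 (u t)"
      using ws t by (auto simp: weak_solution_def C1_L2_def continuous_L2_def continuous_H1_def)
    note G = H1_grad [OF H1u]
    have "Lp_norm 2 (u t) \<le> 2 * \<Lambda>"
      by (rule band_limited_duality_complex [OF L(1) \<Lambda>0]) (simp only: pair bounds)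
    moreover have "Lp_norm 2 (ut t) \<le> 2 * \<Lambda>"
      by (rule band_limited_duality_complex [OF L(2) \<Lambda>0]) (simp only: pair bounds)
    moreover have "Lp_norm 2 (grad (u t)) \<le> ?n * (2 * \<Lambda>)"
    proof -
      have "Lp_norm 2 (\<lambda>x. grad (u t) x $ j) \<le> 2 * \<Lambda>" for j
      proof (rule band_limited_duality_complex [OF Lp_2_component [OF G(2)] \<Lambda>0])
        fix h :: "real^'n \<Rightarrow> complex" assume h: "band_limited h"
        have "norm (LINT x|lebesgue. synth h x *\<^sub>R (grad (u t) x $ j)) =
            norm (mpair (\<lambda>\<xi>. \<i> * of_real (\<xi> $ j) * h \<xi>) (\<lambda>\<xi>. 1) (u t))"
          using weak_gradient_synth [OF G h, of j] by (simp add: pair)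
        then show "norm (LINT x|lebesgue. synth h x *\<^sub>R (grad (u t) x $ j)) \<le> \<Lambda> * Lp_norm 2 h"
          using bounds(3) [OF h, of j] by simp
      qed
      then have "(\<Sum>j\<in>UNIV. Lp_norm 2 (\<lambda>x. grad (u t) x $ j)) \<le> ?n * (2 * \<Lambda>)"
        by (intro sum_bounded_above)
      with Lp_norm_2_le_sum_components [OF G(2)] show ?thesis by linarith
    qed
    ultimately have "Lp_norm 2 (ut t) + Lp_norm 2 (u t) + Lp_norm 2 (grad (u t)) \<le> (4 + 2 * ?n) * \<Lambda>"
      by (simp add: algebra_simps)
    also have "\<dots> \<le> C * ?X + C * ?Y"
    proof -
      have "\<Lambda> \<le> (P + Q) * ?X + (P + Q) * ?Y"
        unfolding \<Lambda>_def using P Q X Y by (intro add_mono mult_right_mono) auto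
      then have "(4 + 2 * ?n) * \<Lambda> \<le> (4 + 2 * ?n) * ((P + Q) * ?X + (P + Q) * ?Y)"
        by (rule mult_left_mono) simp
      moreover have "k * (p * x + p * y) = k * p * x + k * p * y" for k p x y :: real
        by (simp add: distrib_left)
      ultimately show ?thesis by (simp only: C_def)
    qed
    finally show "Lp_norm 2 (ut t) + Lp_norm 2 (u t) + Lp_norm 2 (grad (u t))
        \<le> C * (1 + t) powr (- (?n / 4)) * (Lp_norm 1 u1 + Lp_norm 1 u0)
          + C * exp (- (1/4) * t) * (Lp_norm 2 u1 + H1_norm u0)"
      by (simp only: mult.assoc)
  qed
qed simp

end
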